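(* Let $G\subset\mathbb{C}$ be a bounded simply-connected domain whose boundary $\Gamma=\partial G$ is a Jordan curve, and assume that $\Gamma$ is quasiconformal and rectifiable, with reflection factor $k$ (associated with a quasiconformal reflection $y$). For $n\in\mathbb{N}$ let $\lambda_n>0$ be the leading coefficient of the Bergman polynomial $p_n$ of $G$ and define $\alpha_n$ by $\frac{n+1}{\pi}\frac{\gamma^{2(n+1)}}{\lambda_n^2}=1-\alpha_n$. Then for every $n\in\mathbb{N}$ $$\alpha_n\ge \frac{\pi(1-k^2)}{A(G)}\,(n+1)\,|b_{n+1}|^2,$$ where $A(G)$ is the area of $G$ and $b_{n+1}$ is the coefficient of $1/w^{n+1}$ in the Laurent expansion of $\Psi$ at infinity.
   Context: $\mathbb{N}=\{1,2,\dots\}$; $dA$ is area measure. The Bergman polynomials $p_n(z)=\lambda_n z^n+\cdots$, $\lambda_n>0$, $n=0,1,2,\dots$, of $G$ are the polynomials (with $\deg p_n=n$) that are orthonormal with respect to $\langle f,g\rangle_G=\int_G f\overline{g}\,dA$. Let $\Omega=\overline{\mathbb{C}}\setminus\overline{G}$, $\Delta=\{w:|w|>1\}\cup\{\infty\}$, $\Phi:\Omega\to\Delta$ the conformal map with $\Phi(z)=\gamma z+\gamma_0+\gamma_1/z+\cdots$ near infinity, $\gamma>0$, and $\Psi=\Phi^{-1}:\Delta\to\Omega$, $\Psi(w)=bw+b_0+b_1/w+b_2/w^2+\cdots$ for $|w|>1$, where $b=1/\gamma$. A Jordan curve $\Gamma$ is quasiconformal if there is a constant $M$ with $\operatorname{diam}\Gamma(z,\zeta)\le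 M|z-\zeta|$ for all $z,\zeta\in\Gamma$, where $\Gamma(z,\zeta)$ is the arc of smaller diameter of $\Gamma$ between $z$ and $\zeta$. For such $\Gamma$ there exists, for some $K\ge1$ and a fixed point $a\in G$, a $K$-quasiconformal reflection $y:\overline{\mathbb{C}}\to\overline{\mathbb{C}}$, i.e. a map such that $\overline{y}$ is a $K$-quasiconformal mapping of $\overline{\mathbb{C}}$ onto itself; $y(G)=\Omega$, $y(\Omega)=G$, $y(a)=\infty$, $y(\infty)=a$; $y(z)=z$ for $z\in\Gamma$ and $y(y(z))=z$ for all $z$. The reflection factor of $\Gamma$ (associated with $y$) is $k=(K-1)/(K+1)\in[0,1)$. *)

theory Defs
  imports "HOL-Analysis.Analysis" "HOL-Computational_Algebra.Polynomial"
begin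

section \<open>Jordan curves\<close>

definition jordan_curve_param :: "(real \<Rightarrow> complex) \<Rightarrow> complex set \<Rightarrow> bool" where
  "jordan_curve_param g \<Gamma> \<longleftrightarrow>
     simple_path g \<and> pathfinish g = pathstart g \<and> path_image g = \<Gamma>"

definition jordan_curve :: "complex set \<Rightarrow> bool" where
  "jordan_curve \<Gamma> \<longleftrightarrow> (\<exists>g. jordan_curve_param g \<Gamma>)"

definition finite_length :: "(real \<Rightarrow> complex) \<Rightarrow> bool" where
  "finite_length g \<longleftrightarrow>
     (\<exists>B. \<forall>n (t :: nat \<Rightarrow> real).
        (\<forall>i\<le>n. t i \<in> {0..1}) \<and> (\<forall>i<n. t i \<le> t (Suc i)) \<longrightarrow>
        (\<Sum>i<n. dist (g (t i)) (g (t (Suc i)))) \<le> B)"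

definition rectifiable_jordan_curve :: "complex set \<Rightarrow> bool" where
  "rectifiable_jordan_curve \<Gamma> \<longleftrightarrow> (\<exists>g. jordan_curve_param g \<Gamma> \<and> finite_length g)"

definition subarc_between :: "complex set \<Rightarrow> complex \<Rightarrow> complex \<Rightarrow> complex set \<Rightarrow> bool" where
  "subarc_between \<Gamma> z \<zeta> S \<longleftrightarrow>
     S \<subseteq> \<Gamma> \<and> (\<exists>h. arc h \<and> pathstart h = z \<and> pathfinish h = \<zeta> \<and> path_image h = S)"

text \<open>
  For distinct points \<open>z\<close>, \<open>\<zeta>\<close> of a Jordan curve there are exactly two arcs between them; the
  relation below selects the one of smaller diameter (either one, if the diameters agree).
  For \<open>z = \<zeta>\<close> it holds for no \<open>S\<close>, where the condition on a quasiconformal curve is trivial.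
\<close>

definition smaller_arc :: "complex set \<Rightarrow> complex \<Rightarrow> complex \<Rightarrow> complex set \<Rightarrow> bool" where
  "smaller_arc \<Gamma> z \<zeta> S \<longleftrightarrow>
     subarc_between \<Gamma> z \<zeta> S \<and> (\<forall>T. subarc_between \<Gamma> z \<zeta> T \<longrightarrow> diameter S \<le> diameter T)"

definition quasiconformal_curve :: "complex set \<Rightarrow> bool" where
  "quasiconformal_curve \<Gamma> \<longleftrightarrow>
     jordan_curve \<Gamma> \<and>
     (\<exists>M. \<forall>z\<in>\<Gamma>. \<forall>\<zeta>\<in>\<Gamma>. \<forall>S. smaller_arc \<Gamma> z \<zeta> S \<longrightarrow> diameter S \<le> M * norm (z - \<zeta>))"


section \<open>Quasiconformal maps\<close>

definition absolutely_continuous_real :: "real \<Rightarrow> real \<Rightarrow> (real \<Rightarrow> complex) \<Rightarrow> bool" where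
  "absolutely_continuous_real a b f \<longleftrightarrow>
     (\<forall>\<epsilon>>0. \<exists>\<delta>>0. \<forall>n (u :: nat \<Rightarrow> real) (v :: nat \<Rightarrow> real).
        (\<forall>i<n. a \<le> u i \<and> u i \<le> v i \<and> v i \<le> b) \<and>
        (\<forall>i<n. \<forall>j<n. i \<noteq> j \<longrightarrow> {u i<..<v i} \<inter> {u j<..<v j} = {}) \<and>
        (\<Sum>i<n. v i - u i) < \<delta> \<longrightarrow>
        (\<Sum>i<n. dist (f (u i)) (f (v i))) < \<epsilon>)"

definition absolutely_continuous_on_lines :: "complex set \<Rightarrow> (complex \<Rightarrow> complex) \<Rightarrow> bool" where
  "absolutely_continuous_on_lines U f \<longleftrightarrow>
     (\<forall>a b c d. a < b \<and> c < d \<and> cbox (Complex a c) (Complex b d) \<subseteq> U \<longrightarrow>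
        (AE t in lebesgue. t \<in> {c..d} \<longrightarrow> absolutely_continuous_real a b (\<lambda>s. f (Complex s t))) \<and>
        (AE s in lebesgue. s \<in> {a..b} \<longrightarrow> absolutely_continuous_real c d (\<lambda>t. f (Complex s t))))"

text \<open>
  The analytic definition of a \<open>K\<close>-quasiconformal map (Ahlfors): a homeomorphism that is
  absolutely continuous on lines and whose Wirtinger derivatives, \<open>(f\<^sub>x - \<i> f\<^sub>y) / 2\<close> with respect
  to \<open>z\<close> and \<open>(f\<^sub>x + \<i> f\<^sub>y) / 2\<close> with respect to \<open>cnj z\<close>, satisfy the dilatation inequality almost
  everywhere. This inequality forces \<open>f\<close> to preserve the orientation.
\<close>

definition quasiconformal_on :: "real \<Rightarrow> complex set \<Rightarrow> (complex \<Rightarrow> complex) \<Rightarrow> bool" where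
  "quasiconformal_on K U f \<longleftrightarrow>
     K \<ge> 1 \<and> open U \<and> (\<exists>g. homeomorphism U (f ` U) f g) \<and>
     absolutely_continuous_on_lines U f \<and>
     (AE z in lebesgue. z \<in> U \<longrightarrow>
        (\<exists>fx fy.
           ((\<lambda>s. f (z + of_real s)) has_vector_derivative fx) (at 0) \<and>
           ((\<lambda>t. f (z + \<i> * of_real t)) has_vector_derivative fy) (at 0) \<and>
           norm ((fx + \<i> * fy) / 2) \<le> (K - 1) / (K + 1) * norm ((fx - \<i> * fy) / 2)))"

text \<open>
  The Riemann sphere is the type \<^typ>\<open>complex option\<close>, with \<open>None\<close> as the point at infinity and
  the topology of the one-point compactification. The map \<open>sphere_inverse\<close> is \<open>z \<mapsto> 1 / z\<close>.
\<close>

definition sphere_topology :: "complex option topology" where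
  "sphere_topology = Alexandroff_compactification euclidean"

fun sphere_inverse :: "complex option \<Rightarrow> complex option" where
  "sphere_inverse None = Some 0"
| "sphere_inverse (Some z) = (if z = 0 then None else Some (1 / z))"

text \<open>
  A homeomorphism of the sphere is \<open>K\<close>-quasiconformal if it is so in the charts \<open>z\<close> and \<open>1 / z\<close>
  of the source (\<open>\<sigma>\<close>) and of the target (\<open>\<tau>\<close>).
\<close>

definition quasiconformal_sphere_map :: "real \<Rightarrow> (complex option \<Rightarrow> complex option) \<Rightarrow> bool" where
  "quasiconformal_sphere_map K F \<longleftrightarrow>
     homeomorphic_map sphere_topology sphere_topology F \<and>
     (\<forall>\<sigma>\<in>{id, sphere_inverse}. \<forall>\<tau>\<in>{id, sphere_inverse}.
        quasiconformal_on K {z. \<tau> (F (\<sigma> (Some z))) \<noteq> None} (\<lambda>z. the (\<tau> (F (\<sigma> (Some z))))))"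

definition sphere_exterior :: "complex set \<Rightarrow> complex option set" where
  "sphere_exterior G = - (Some ` closure G)"

definition quasiconformal_reflection ::
    "complex set \<Rightarrow> real \<Rightarrow> complex \<Rightarrow> (complex option \<Rightarrow> complex option) \<Rightarrow> bool" where
  "quasiconformal_reflection G K a y \<longleftrightarrow>
     a \<in> G \<and> K \<ge> 1 \<and>
     quasiconformal_sphere_map K (\<lambda>z. map_option cnj (y z)) \<and>
     y ` (Some ` G) = sphere_exterior G \<and> y ` sphere_exterior G = Some ` G \<and>
     y (Some a) = None \<and> y None = Some a \<and>
     (\<forall>z\<in>frontier G. y (Some z) = Some z) \<and>
     (\<forall>z. y (y z) = z)"


section \<open>Exterior conformal map and Bergman polynomials\<close>

text \<open>
  The conformal map of the exterior of \<open>G\<close> (in the sphere) onto the exterior of the closed unit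
  disc is given by its restriction to the finite points; the expansion at infinity says that
  infinity is mapped to infinity, conformally, with derivative \<open>\<gamma> > 0\<close>.
\<close>

definition exterior_conformal_map ::
    "complex set \<Rightarrow> real \<Rightarrow> (complex \<Rightarrow> complex) \<Rightarrow> bool" where
  "exterior_conformal_map G \<gamma> \<Phi> \<longleftrightarrow>
     \<Phi> holomorphic_on (- closure G) \<and>
     bij_betw \<Phi> (- closure G) {w. norm w > 1} \<and>
     \<gamma> > 0 \<and>
     (\<exists>R c. \<forall>z. norm z > R \<longrightarrow> (\<lambda>j. c j / z ^ j) sums (\<Phi> z - of_real \<gamma> * z))"

definition area :: "complex set \<Rightarrow> real" where
  "area G = measure lebesgue G"

definition bergman_inner :: "complex set \<Rightarrow> (complex \<Rightarrow> complex) \<Rightarrow> (complex \<Rightarrow> complex) \<Rightarrow> complex" where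
  "bergman_inner G f g = (LINT z:G|lebesgue. f z * cnj (g z))"

text \<open>The argument \<open>\<lambda>\<close> is the sequence of the leading coefficients.\<close>

definition bergman_polynomials ::
    "complex set \<Rightarrow> (nat \<Rightarrow> complex poly) \<Rightarrow> (nat \<Rightarrow> real) \<Rightarrow> bool" where
  "bergman_polynomials G p lam \<longleftrightarrow>
     (\<forall>n. degree (p n) = n \<and> lead_coeff (p n) = of_real (lam n) \<and> lam n > 0) \<and>
     (\<forall>m n. bergman_inner G (poly (p m)) (poly (p n)) = (if m = n then 1 else 0))"

end

theory Submission
  imports Defs "HOL-Complex_Analysis.Complex_Analysis"
begin

text \<open>
  Write \<open>N = n + 1\<close>, and let \<open>F\<close> be the \<open>N\<close>-th Faber polynomial, so that
  \<open>F (\<Psi> w) = w\<^sup>N + c\<^sub>1 / w + c\<^sub>2 / w\<^sup>2 + \<dots>\<close>. By the extremality of \<open>p\<^sub>n\<close>, \<open>1 - \<alpha>\<^sub>n\<close> is at most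
  \<open>1 / (\<pi> N)\<close> times the integral of \<open>|F'|\<^sup>2\<close> over \<open>G\<close>. Green's formula on the level curves of \<open>\<Phi>\<close>
  and Parseval's identity bound this integral by \<open>\<pi> (N - |c\<^sub>1|\<^sup>2)\<close>, and the symmetry of the
  Grunsky matrix gives \<open>c\<^sub>1 = N \<gamma> b\<^sub>N\<close>; hence \<open>\<alpha>\<^sub>n \<ge> N \<gamma>\<^sup>2 |b\<^sub>N|\<^sup>2\<close>.

  It remains to show \<open>\<pi> (1 - k\<^sup>2) \<le> \<gamma>\<^sup>2 A(G)\<close>. The function \<open>e = y - z\<close> vanishes on \<open>\<Gamma>\<close>, and the
  \<open>\<partial>/\<partial>cnj z\<close>-derivatives of \<open>e\<close> and \<open>y\<close> agree. By Green's formula, its integral over the exterior of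
  \<open>G\<close> against the weight \<open>\<Phi>' / \<Phi>\<^sup>2\<close> is the contribution \<open>- \<pi> / \<gamma>\<close> of the point at infinity. The
  weight has squared norm at most \<open>\<pi>\<close>, as \<open>1 / \<Phi>\<close> maps into the unit disc. The squared norm of the
  derivative is at most \<open>A(G) / (1 - k\<^sup>2)\<close>, since \<open>y\<close> maps the exterior injectively into \<open>G\<close> and
  its Jacobian dominates \<open>1 - k\<^sup>2\<close> times the square of the derivative. Conclude by the
  Cauchy-Schwarz inequality.
\<close>

section \<open>Change of variables in the plane\<close>

text \<open>Nothing is known about \<open>deriv \<Phi>\<close> on the boundary curve, so no integral
  over that curve is formed. Each boundary term becomes an area integral against the gradient of a
  cutoff in ln |\<Phi>|, that is, an average of integrals over level curves in a thin collar; it is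
  estimated, and then the collar shrinks. Green's formula itself is applied to functions on the
  whole plane, over large squares. The reflection offers little regularity: continuity, absolute
  continuity on lines and partial derivatives almost everywhere. Absolute continuity gives
  Newton-Leibniz on almost every line, and Fubini turns this into Green's formula. Injectivity
  bounds the integral of the Jacobian by the area of the image, and the dilatation inequality
  converts this into square integrability of the derivatives. Only an inequality is aimed at there,
  since a priori the image of a null set may have positive area. The constants fit because Green's
  formula yields 2 pi / \<gamma>, of which the weight absorbs exactly one half.\<close>

definition complex_of_vec :: "real^2 \<Rightarrow> complex" where
  "complex_of_vec v = Complex (v $ 1) (v $ 2)"

definition vec_of_complex :: "complex \<Rightarrow> real^2" where
  "vec_of_complex z = vector [Re z, Im z]"

lemma vec_of_complex_nth [simp]: "vec_of_complex z $ 1 = Re z" "vec_of_complex z $ 2 = Im z"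
  by (simp_all add: vec_of_complex_def)

lemma complex_of_vec_inverse [simp]:
  "complex_of_vec (vec_of_complex z) = z" "vec_of_complex (complex_of_vec v) = v"
  by (simp_all add: complex_of_vec_def vec_eq_iff forall_2)

lemma bounded_linear_complex_of_vec: "bounded_linear complex_of_vec"
  unfolding complex_of_vec_def
  by (subst linear_conv_bounded_linear[symmetric]) (auto intro!: linearI simp: complex_eq_iff)

lemma bounded_linear_vec_of_complex: "bounded_linear vec_of_complex"
  by (subst linear_conv_bounded_linear[symmetric]) (auto intro!: linearI simp: vec_eq_iff forall_2)

lemma complex_of_vec_borel [measurable]: "complex_of_vec \<in> borel \<rightarrow>\<^sub>M borel"
  by (intro borel_measurable_continuous_onI linear_continuous_on bounded_linear_complex_of_vec)

lemma vec_of_complex_borel [measurable]: "vec_of_complex \<in> borel \<rightarrow>\<^sub>M borel"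
  by (intro borel_measurable_continuous_onI linear_continuous_on bounded_linear_vec_of_complex)

text \<open>The change of variables theorem concerns maps of \<open>real^2\<close>, whose
  derivatives have a matrix. It is transported along this isometry; on boxes the coordinates match,
  hence so do the volumes.\<close>

lemma lborel_distr_complex_of_vec: "lborel = distr lborel borel complex_of_vec"
proof (rule lborel_eqI)
  fix l u :: complex assume lu: "\<And>b. b \<in> Basis \<Longrightarrow> l \<bullet> b \<le> u \<bullet> b"
  have eq: "complex_of_vec -` box l u = box (vec_of_complex l) (vec_of_complex u)"
    by (auto simp: box_def Basis_complex_def Basis_vec_def complex_of_vec_def inner_axis
        inner_complex_def forall_2)
  have "emeasure (distr lborel borel complex_of_vec) (box l u) = emeasure lborel (complex_of_vec -` box l u)"
    by (subst emeasure_distr) auto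
  also have "\<dots> = (\<Prod>b\<in>Basis. (vec_of_complex u - vec_of_complex l) \<bullet> b)"
    unfolding eq using lu[of 1] lu[of \<i>]
    by (subst emeasure_lborel_box_eq)
      (auto simp: Basis_complex_def Basis_vec_def inner_axis inner_complex_def forall_2)
  also have "(\<Prod>b\<in>Basis. (vec_of_complex u - vec_of_complex l) \<bullet> b) = (Re u - Re l) * (Im u - Im l)"
  proof -
    have B: "(Basis :: (real^2) set) = {axis 1 1, axis 2 1}"
      unfolding Basis_vec_def by (auto simp: UNIV_2)
    have "axis 1 (1::real) \<noteq> (axis 2 1 :: real^2)"
      by (simp add: axis_eq_axis)
    then show ?thesis
      unfolding B by (subst prod.insert) (auto simp: inner_axis)
  qed
  also have "\<dots> = (\<Prod>b\<in>Basis. (u - l) \<bullet> b)"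
    by (simp add: Basis_complex_def inner_complex_def)
  finally show "emeasure (distr lborel borel complex_of_vec) (box l u) = (\<Prod>b\<in>Basis. (u - l) \<bullet> b)" .
qed auto

lemma null_sets_distr_complex_of_vec:
  "null_sets (distr lborel lborel complex_of_vec) = null_sets lborel"
  by (metis distr_cong lborel_distr_complex_of_vec sets_lborel)

text \<open>Continuity gives Borel measurability only. For the completed measures preimages of null
  sets must be null as well, which holds because the map preserves \<open>lborel\<close>.\<close>

lemma complex_of_vec_lebesgue [measurable]: "complex_of_vec \<in> lebesgue \<rightarrow>\<^sub>M lebesgue"
proof -
  have "complex_of_vec \<in> lebesgue \<rightarrow>\<^sub>M lborel"
    by (simp add: measurable_completion)
  moreover have "null_sets lborel \<subseteq> null_sets (distr lebesgue lborel complex_of_vec)"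
  proof -
    have "distr lebesgue lborel complex_of_vec = distr lborel lborel complex_of_vec"
      by (simp add: distr_completion)
    then show ?thesis using null_sets_distr_complex_of_vec by simp
  qed
  ultimately show ?thesis
    by (rule completion.measurable_completion2)
qed

lemma lebesgue_distr_complex_of_vec: "lebesgue = distr lebesgue lebesgue complex_of_vec"
proof -
  have *: "distr lebesgue lborel complex_of_vec = lborel"
  proof -
    have "distr lebesgue lborel complex_of_vec = distr lborel lborel complex_of_vec"
      by (simp add: distr_completion)
    then show ?thesis
      by (metis distr_cong lborel_distr_complex_of_vec sets_lborel)
  qed
  have "lebesgue = completion (distr lebesgue lborel complex_of_vec)"
    by (simp add: *)
  also have "\<dots> = distr lebesgue lebesgue complex_of_vec"
    by (subst completion.completion_distr_eq) (auto simp: * measurable_completion)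
  finally show ?thesis .
qed

lemma vec_of_complex_lebesgue [measurable]: "vec_of_complex \<in> lebesgue \<rightarrow>\<^sub>M lebesgue"
proof -
  have "vec_of_complex \<in> lebesgue \<rightarrow>\<^sub>M lborel"
    by (simp add: measurable_completion)
  moreover have "null_sets lborel \<subseteq> null_sets (distr lebesgue lborel vec_of_complex)"
  proof -
    have "distr lebesgue lborel vec_of_complex = distr lborel lborel vec_of_complex"
      by (simp add: distr_completion)
    also have "\<dots> = distr (distr lborel borel complex_of_vec) lborel vec_of_complex"
      using lborel_distr_complex_of_vec by simp
    also have "\<dots> = distr lborel lborel (vec_of_complex \<circ> complex_of_vec)"
      by (subst distr_distr) simp_all
    also have "\<dots> = distr lborel lborel (\<lambda>x. x)"
      by (simp add: o_def)
    also have "\<dots> = lborel" by simp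
    finally show ?thesis by simp
  qed
  ultimately show ?thesis
    by (rule completion.measurable_completion2)
qed

lemma integrable_lebesgue_complex_of_vec:
  fixes F :: "complex \<Rightarrow> 'b::{banach, second_countable_topology}"
  shows "integrable lebesgue (\<lambda>v. F (complex_of_vec v)) \<longleftrightarrow> integrable lebesgue F"
proof
  assume "integrable lebesgue F"
  then have "integrable (distr lebesgue lebesgue complex_of_vec) F"
    using lebesgue_distr_complex_of_vec by simp
  then show "integrable lebesgue (\<lambda>v. F (complex_of_vec v))"
    by (rule integrable_distr[OF complex_of_vec_lebesgue])
next
  assume int: "integrable lebesgue (\<lambda>v. F (complex_of_vec v))"
  have "(\<lambda>z. F (complex_of_vec (vec_of_complex z))) \<in> borel_measurable lebesgue"
    using borel_measurable_integrable[OF int] vec_of_complex_lebesgue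
    by (rule measurable_compose_rev)
  then have "F \<in> borel_measurable lebesgue" by simp
  then have "integrable (distr lebesgue lebesgue complex_of_vec) F"
    using int by (subst integrable_distr_eq) auto
  then show "integrable lebesgue F"
    using lebesgue_distr_complex_of_vec by simp
qed

lemma integral_lebesgue_complex_of_vec:
  fixes F :: "complex \<Rightarrow> 'b::{banach, second_countable_topology}"
  shows "integral\<^sup>L lebesgue (\<lambda>v. F (complex_of_vec v)) = integral\<^sup>L lebesgue F"
proof (cases "integrable lebesgue F")
  case True
  have "integral\<^sup>L lebesgue F = integral\<^sup>L (distr lebesgue lebesgue complex_of_vec) F"
    using lebesgue_distr_complex_of_vec by simp
  also have "\<dots> = integral\<^sup>L lebesgue (\<lambda>v. F (complex_of_vec v))"
    using True by (subst integral_distr) auto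
  finally show ?thesis by simp
next
  case False
  then show ?thesis
    using integrable_lebesgue_complex_of_vec[of F] by (simp add: not_integrable_integral_eq)
qed

lemma vec_of_complex_image: "vec_of_complex ` S = complex_of_vec -` S"
  by (auto simp: image_iff) (metis complex_of_vec_inverse(2))

lemma absolutely_integrable_on_vec_of_complex:
  fixes f :: "complex \<Rightarrow> 'b::euclidean_space"
  shows "(\<lambda>v. f (complex_of_vec v)) absolutely_integrable_on (vec_of_complex ` S)
          \<longleftrightarrow> f absolutely_integrable_on S"
  using integrable_lebesgue_complex_of_vec[of "\<lambda>z. indicator S z *\<^sub>R f z"]
  unfolding set_integrable_def vec_of_complex_image by (simp add: indicator_def)

lemma integral_vec_of_complex:
  fixes f :: "complex \<Rightarrow> 'b::euclidean_space"
  assumes "f absolutely_integrable_on S"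
  shows "integral (vec_of_complex ` S) (\<lambda>v. f (complex_of_vec v)) = integral S f"
proof -
  have "integral (vec_of_complex ` S) (\<lambda>v. f (complex_of_vec v))
     = (LINT v : vec_of_complex ` S | lebesgue. f (complex_of_vec v))"
    using assms by (subst set_lebesgue_integral_eq_integral) (auto simp: absolutely_integrable_on_vec_of_complex)
  also have "\<dots> = (LINT z : S | lebesgue. f z)"
    using integral_lebesgue_complex_of_vec[of "\<lambda>z. indicator S z *\<^sub>R f z"]
    unfolding set_lebesgue_integral_def vec_of_complex_image by (simp add: indicator_def)
  also have "\<dots> = integral S f"
    by (rule set_lebesgue_integral_eq_integral[OF assms])
  finally show ?thesis .
qed

definition real_jacobian :: "(complex \<Rightarrow> complex) \<Rightarrow> real" where
  "real_jacobian L = Re (L 1) * Im (L \<i>) - Im (L 1) * Re (L \<i>)"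

lemma det_vec_of_complex:
  "det (matrix (\<lambda>v. vec_of_complex (L (complex_of_vec v)))) = real_jacobian L"
proof -
  have "complex_of_vec (axis 1 1) = 1" "complex_of_vec (axis 2 1) = \<i>"
    by (simp_all add: complex_of_vec_def complex_eq_iff axis_def)
  then show ?thesis
    by (simp add: det_2 matrix_def real_jacobian_def)
qed

theorem change_of_variables_complex:
  fixes f :: "complex \<Rightarrow> complex" and g :: "complex \<Rightarrow> complex"
  assumes S: "S \<in> sets lebesgue"
    and der: "\<And>z. z \<in> S \<Longrightarrow> (g has_derivative g' z) (at z within S)"
    and inj: "inj_on g S"
    and f: "f absolutely_integrable_on (g ` S) \<or>
            (\<lambda>z. \<bar>real_jacobian (g' z)\<bar> *\<^sub>R f (g z)) absolutely_integrable_on S"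
  shows "f absolutely_integrable_on (g ` S)"
    and "(\<lambda>z. \<bar>real_jacobian (g' z)\<bar> *\<^sub>R f (g z)) absolutely_integrable_on S"
    and "integral (g ` S) f = integral S (\<lambda>z. \<bar>real_jacobian (g' z)\<bar> *\<^sub>R f (g z))"
proof -
  define S' where "S' = vec_of_complex ` S"
  define G where "G = (\<lambda>v. vec_of_complex (g (complex_of_vec v)))"
  define G' where "G' = (\<lambda>v w. vec_of_complex (g' (complex_of_vec v) (complex_of_vec w)))"
  \<comment> \<open>The integrand of the vector version takes values in a space
    \<open>real^'n\<close>, so the values of \<open>f\<close> are transported along with its
    argument.\<close>
  define f2 where "f2 = (\<lambda>v. vec_of_complex (f (complex_of_vec v)))"
  define J where "J = (\<lambda>z. \<bar>real_jacobian (g' z)\<bar>)"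
  have S': "S' \<in> sets lebesgue"
    unfolding S'_def vec_of_complex_image
    using measurable_sets[OF complex_of_vec_lebesgue S] by simp
  have comp: "complex_of_vec ` S' = S"
    by (force simp: S'_def image_iff)
  have GS: "G ` S' = vec_of_complex ` (g ` S)"
    by (force simp: S'_def G_def image_iff)
  have der': "(G has_derivative G' v) (at v within S')" if "v \<in> S'" for v
  proof -
    have z: "complex_of_vec v \<in> S"
      using that by (auto simp: S'_def)
    have 1: "(complex_of_vec has_derivative complex_of_vec) (at v within S')"
      by (rule bounded_linear_imp_has_derivative[OF bounded_linear_complex_of_vec])
    have 2: "((\<lambda>v. g (complex_of_vec v)) has_derivative (\<lambda>w. g' (complex_of_vec v) (complex_of_vec w)))
        (at v within S')"
      using has_derivative_compose[OF 1] der[OF z]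
      by (metis comp has_derivative_in_compose 1)
    show ?thesis
      unfolding G_def G'_def
      using bounded_linear.has_derivative[OF bounded_linear_vec_of_complex 2] .
  qed
  have inj': "inj_on G S'"
    unfolding inj_on_def G_def S'_def using inj
    by (auto simp: inj_on_def) (metis complex_of_vec_inverse(1))
  have JJ: "\<bar>det (matrix (G' v))\<bar> = J (complex_of_vec v)" for v
    unfolding G'_def J_def det_vec_of_complex ..
  note cv = has_absolute_integral_change_of_variables[OF S' der' inj', of f2]
  have vlin: "vec_of_complex (c *\<^sub>R z) = c *\<^sub>R vec_of_complex z" for c z
    by (simp add: vec_eq_iff forall_2)
  have eq1: "(\<lambda>v. \<bar>det (matrix (G' v))\<bar> *\<^sub>R f2 (G v)) =
      (\<lambda>v. vec_of_complex ((\<lambda>z. J z *\<^sub>R f (g z)) (complex_of_vec v)))"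
    by (simp add: JJ f2_def G_def vlin)
  have vi: "(\<lambda>v. vec_of_complex (h v)) absolutely_integrable_on A \<longleftrightarrow> h absolutely_integrable_on A"
    for h :: "real^2 \<Rightarrow> complex" and A
    using absolutely_integrable_linear[OF _ bounded_linear_vec_of_complex, of A h]
          absolutely_integrable_linear[OF _ bounded_linear_complex_of_vec, of A "\<lambda>v. vec_of_complex (h v)"]
    by (auto simp: o_def)
  have vI: "integral A (\<lambda>v. vec_of_complex (h v)) = vec_of_complex (integral A h)"
    if "h absolutely_integrable_on A" for h :: "real^2 \<Rightarrow> complex" and A
    using integral_linear[OF _ bounded_linear_vec_of_complex, where f=h and S=A] that
    by (auto simp: o_def absolutely_integrable_on_def)
  have A: "f2 absolutely_integrable_on (G ` S') \<longleftrightarrow> f absolutely_integrable_on (g ` S)"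
    unfolding f2_def GS vi absolutely_integrable_on_vec_of_complex ..
  have B: "(\<lambda>v. \<bar>det (matrix (G' v))\<bar> *\<^sub>R f2 (G v)) absolutely_integrable_on S' \<longleftrightarrow>
      (\<lambda>z. J z *\<^sub>R f (g z)) absolutely_integrable_on S"
    unfolding eq1 vi S'_def absolutely_integrable_on_vec_of_complex[where f="\<lambda>z. J z *\<^sub>R f (g z)"] ..
  have AB: "f absolutely_integrable_on (g ` S) \<longleftrightarrow> (\<lambda>z. J z *\<^sub>R f (g z)) absolutely_integrable_on S"
    using A B cv by blast
  show 1: "f absolutely_integrable_on (g ` S)"
    and 2: "(\<lambda>z. \<bar>real_jacobian (g' z)\<bar> *\<^sub>R f (g z)) absolutely_integrable_on S"
    using AB f unfolding J_def by blast+
  have J2: "(\<lambda>z. J z *\<^sub>R f (g z)) absolutely_integrable_on S"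
    using 2 by (simp add: J_def)
  have "vec_of_complex (integral (g ` S) f) = integral (G ` S') f2"
    unfolding GS f2_def using 1
    by (subst vI) (auto simp: absolutely_integrable_on_vec_of_complex integral_vec_of_complex)
  also have "\<dots> = integral S' (\<lambda>v. \<bar>det (matrix (G' v))\<bar> *\<^sub>R f2 (G v))"
    using cv 1 A by blast
  also have "\<dots> = vec_of_complex (integral S (\<lambda>z. J z *\<^sub>R f (g z)))"
    unfolding eq1 S'_def using J2
    by (subst vI) (auto simp: absolutely_integrable_on_vec_of_complex[where f="\<lambda>z. J z *\<^sub>R f (g z)"]
        integral_vec_of_complex[where f="\<lambda>z. J z *\<^sub>R f (g z)"])
  finally show "integral (g ` S) f = integral S (\<lambda>z. \<bar>real_jacobian (g' z)\<bar> *\<^sub>R f (g z))"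
    unfolding J_def by (metis complex_of_vec_inverse(1))
qed

lemma has_measure_differentiable_image_complex:
  fixes g :: "complex \<Rightarrow> complex"
  assumes S: "S \<in> sets lebesgue"
    and der: "\<And>z. z \<in> S \<Longrightarrow> (g has_derivative g' z) (at z within S)"
    and inj: "inj_on g S"
    and lm: "g ` S \<in> lmeasurable"
  shows "(\<lambda>z. \<bar>real_jacobian (g' z)\<bar>) absolutely_integrable_on S"
    and "integral S (\<lambda>z. \<bar>real_jacobian (g' z)\<bar>) = measure lebesgue (g ` S)"
proof -
  let ?J = "\<lambda>z. \<bar>real_jacobian (g' z)\<bar>"
  have 1: "(\<lambda>_. 1::complex) absolutely_integrable_on (g ` S)"
    using lm by (simp add: absolutely_integrable_on_const)
  note cv = change_of_variables_complex[OF S der inj disjI1, OF _ 1]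
  have 2: "(\<lambda>z. ?J z *\<^sub>R (1::complex)) absolutely_integrable_on S"
    by (rule cv(2))
  have J: "Re \<circ> (\<lambda>z. ?J z *\<^sub>R (1::complex)) = ?J"
    by auto
  show a: "?J absolutely_integrable_on S"
    using absolutely_integrable_linear[OF 2 bounded_linear_Re] unfolding J .
  have "integral S ?J = Re (integral S (\<lambda>z. ?J z *\<^sub>R (1::complex)))"
    using integral_linear[OF _ bounded_linear_Re, of "\<lambda>z. ?J z *\<^sub>R (1::complex)" S] 2
    unfolding J by (simp add: absolutely_integrable_on_def)
  also have "\<dots> = Re (integral (g ` S) (\<lambda>_. 1::complex))"
    using cv(3) by simp
  also have "\<dots> = measure lebesgue (g ` S)"
    using lmeasure_integral[OF lm] integral_linear[OF _ bounded_linear_Re, of "\<lambda>_. 1::complex" "g ` S"] 1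
    by (simp add: absolutely_integrable_on_def o_def)
  finally show "integral S ?J = measure lebesgue (g ` S)" .
qed

section \<open>The Jacobian of a homeomorphism with partial derivatives almost everywhere\<close>

lemma norm_diff_add_le:
  fixes a b c :: "'a::real_normed_vector"
  shows "norm (a - b + c) \<le> norm a + norm b + norm c"
  using norm_triangle_ineq[of "a - b" c] norm_triangle_ineq4[of a b] by linarith

lemma has_vector_derivative_at_0_bound:
  fixes f :: "real \<Rightarrow> 'a::real_normed_vector"
  assumes "(f has_vector_derivative D) (at 0)" "e > 0"
  obtains d where "d > 0" "\<And>s. \<bar>s\<bar> < d \<Longrightarrow> norm (f s - f 0 - s *\<^sub>R D) \<le> e * \<bar>s\<bar>"
proof -
  have "\<forall>e>0. \<exists>d>0. \<forall>s. norm (s - 0) < d \<longrightarrow> norm (f s - f 0 - (s - 0) *\<^sub>R D) \<le> e * norm (s - 0)"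
    using assms(1) unfolding has_vector_derivative_def has_derivative_within_alt by blast
  then obtain d where "d > 0" "\<forall>s. norm (s - 0) < d \<longrightarrow> norm (f s - f 0 - (s - 0) *\<^sub>R D) \<le> e * norm (s - 0)"
    using assms(2) by blast
  then show thesis by (intro that[of d]) auto
qed

text \<open>The hypotheses are asymmetric on purpose: the horizontal derivative is used only at
  \<open>z0\<close>, where a pointwise statement suffices, whereas the vertical one is used at the
  moving point \<open>z\<close> and so must be uniform over \<open>S\<close>.\<close>

lemma has_derivative_within_of_partials:
  fixes H Hy :: "complex \<Rightarrow> complex" and z0 a :: complex
  assumes z0: "z0 \<in> S"
    and x: "((\<lambda>s. H (z0 + of_real s)) has_vector_derivative a) (at 0)"
    and y: "\<And>e. e > 0 \<Longrightarrow> \<exists>d>0. \<forall>z\<in>S. \<forall>t. \<bar>t\<bar> < d \<longrightarrow>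
              norm (H (z + \<i> * of_real t) - H z - of_real t * Hy z) \<le> e * \<bar>t\<bar>"
    and cont: "continuous (at z0 within S) Hy"
  shows "(H has_derivative (\<lambda>v. Re v *\<^sub>R a + Im v *\<^sub>R Hy z0)) (at z0 within S)"
  unfolding has_derivative_within_alt
proof (intro conjI allI impI)
  show "bounded_linear (\<lambda>v. Re v *\<^sub>R a + Im v *\<^sub>R Hy z0)"
    by (intro bounded_linear_intros bounded_linear_Re bounded_linear_Im)
next
  fix e :: real assume e: "e > 0"
  have e3: "e / 3 > 0" using e by simp
  obtain d1 where d1: "d1 > 0" "\<And>s. \<bar>s\<bar> < d1 \<Longrightarrow> norm (H (z0 + of_real s) - H z0 - s *\<^sub>R a) \<le> e/3 * \<bar>s\<bar>"
    using has_vector_derivative_at_0_bound[OF x e3] by auto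
  obtain d2 where d2: "d2 > 0" "\<And>z t. z \<in> S \<Longrightarrow> \<bar>t\<bar> < d2 \<Longrightarrow>
              norm (H (z + \<i> * of_real t) - H z - of_real t * Hy z) \<le> e/3 * \<bar>t\<bar>"
    using y[OF e3] by blast
  obtain d3 where d3: "d3 > 0" "\<And>z. z \<in> S \<Longrightarrow> norm (z - z0) < d3 \<Longrightarrow> norm (Hy z - Hy z0) < e/3"
    using cont e3 unfolding continuous_within_eps_delta dist_norm by blast
  show "\<exists>d>0. \<forall>z\<in>S. norm (z - z0) < d \<longrightarrow>
      norm (H z - H z0 - (Re (z - z0) *\<^sub>R a + Im (z - z0) *\<^sub>R Hy z0)) \<le> e * norm (z - z0)"
  proof (intro exI[of _ "min d1 (min d2 d3)"] conjI ballI impI)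
    fix z assume z: "z \<in> S" and lt: "norm (z - z0) < min d1 (min d2 d3)"
    define p q where "p = Re (z - z0)" and "q = Im (z - z0)"
    have pq: "\<bar>p\<bar> \<le> norm (z - z0)" "\<bar>q\<bar> \<le> norm (z - z0)"
      using abs_Re_le_cmod abs_Im_le_cmod unfolding p_def q_def by blast+
    \<comment> \<open>The corner of the path from \<open>z0\<close> to \<open>z\<close>. It is
      approached vertically from \<open>z\<close>, so that the uniform estimate is invoked at a
      point of \<open>S\<close> and not at the corner.\<close>
    have c: "z + \<i> * of_real (-q) = z0 + of_real p"
      by (simp add: p_def q_def complex_eq_iff)
    have 1: "norm (H (z0 + of_real p) - H z0 - p *\<^sub>R a) \<le> e/3 * norm (z - z0)"
      using d1(2)[of p] pq lt e by (smt (verit) mult_left_mono divide_nonneg_nonneg)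
    have 2: "norm (H (z0 + of_real p) - H z + of_real q * Hy z) \<le> e/3 * norm (z - z0)"
    proof -
      have "norm (H (z + \<i> * of_real (-q)) - H z - of_real (-q) * Hy z) \<le> e/3 * \<bar>-q\<bar>"
        using d2(2)[OF z, of "-q"] pq lt by auto
      also have "\<dots> \<le> e/3 * norm (z - z0)"
        using pq e by (intro mult_left_mono) auto
      finally show ?thesis unfolding c by simp
    qed
    have 3: "norm (of_real q * (Hy z - Hy z0)) \<le> e/3 * norm (z - z0)"
    proof -
      have "norm (of_real q * (Hy z - Hy z0)) = norm (Hy z - Hy z0) * \<bar>q\<bar>"
        by (simp add: norm_mult)
      also have "\<dots> \<le> e/3 * norm (z - z0)"
        using pq d3(2)[OF z] lt e by (intro mult_mono) auto
      finally show ?thesis .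
    qed
    have eq: "H z - H z0 - (p *\<^sub>R a + q *\<^sub>R Hy z0) =
      (H (z0 + of_real p) - H z0 - p *\<^sub>R a) - (H (z0 + of_real p) - H z + of_real q * Hy z)
       + of_real q * (Hy z - Hy z0)"
      by (simp add: algebra_simps scaleR_conv_of_real)
    have "norm (H z - H z0 - (p *\<^sub>R a + q *\<^sub>R Hy z0)) \<le>
       e/3 * norm (z - z0) + e/3 * norm (z - z0) + e/3 * norm (z - z0)"
      unfolding eq using 1 2 3
        norm_diff_add_le[of "H (z0 + of_real p) - H z0 - p *\<^sub>R a"
          "H (z0 + of_real p) - H z + of_real q * Hy z" "of_real q * (Hy z - Hy z0)"] by linarith
    then show "norm (H z - H z0 - (Re (z - z0) *\<^sub>R a + Im (z - z0) *\<^sub>R Hy z0)) \<le> e * norm (z - z0)"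
      unfolding p_def q_def by simp
  qed (use d1 d2 d3 in auto)
qed

text \<open>The Cauchy form compares quotients with each other instead of with the derivative. Each
  single condition is then closed by continuity of \<open>H\<close>, and an arbitrary intersection
  stays closed, hence measurable.\<close>

lemma closed_Cauchy_quotient_set:
  fixes H :: "complex \<Rightarrow> complex"
  assumes H: "continuous_on UNIV H"
  shows "closed {z. \<forall>s t. 0 < \<bar>s\<bar> \<and> \<bar>s\<bar> < d \<and> 0 < \<bar>t\<bar> \<and> \<bar>t\<bar> < d \<longrightarrow>
     norm ((H (z + \<i> * of_real s) - H z) / of_real s - (H (z + \<i> * of_real t) - H z) / of_real t) \<le> e}"
proof -
  have "closed {z. norm ((H (z + \<i> * of_real s) - H z) / of_real s - (H (z + \<i> * of_real t) - H z) / of_real t) \<le> e}"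
    if "s \<noteq> 0" "t \<noteq> 0" for s t :: real
    using that by (intro closed_Collect_le continuous_intros continuous_on_compose2[OF H]) auto
  then have "closed (\<Inter>(s,t) \<in> {(s,t). 0 < \<bar>s\<bar> \<and> \<bar>s\<bar> < d \<and> 0 < \<bar>t\<bar> \<and> \<bar>t\<bar> < d}.
     {z. norm ((H (z + \<i> * of_real s) - H z) / of_real s - (H (z + \<i> * of_real t) - H z) / of_real t) \<le> e})"
    by (intro closed_INT) auto
  also have "\<dots> = {z. \<forall>s t. 0 < \<bar>s\<bar> \<and> \<bar>s\<bar> < d \<and> 0 < \<bar>t\<bar> \<and> \<bar>t\<bar> < d \<longrightarrow>
     norm ((H (z + \<i> * of_real s) - H z) / of_real s - (H (z + \<i> * of_real t) - H z) / of_real t) \<le> e}"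
    by auto
  finally show ?thesis .
qed

text \<open>
  On a set where the vertical difference quotients converge uniformly, the vertical partial
  derivative is continuous, so that \<open>H\<close> is differentiable relative to that set: the increment is
  split at the corner that is reached horizontally from the base point and vertically from the
  other point, and the corner itself need not belong to the set.
\<close>

lemma has_derivative_within_uniform_quotients:
  fixes H Hx Hy :: "complex \<Rightarrow> complex" and d :: "nat \<Rightarrow> real"
  assumes H: "continuous_on UNIV H"
    and d: "\<And>j. d j > 0"
    and S: "\<And>z j s t. z \<in> S \<Longrightarrow> 0 < \<bar>s\<bar> \<Longrightarrow> \<bar>s\<bar> < d j \<Longrightarrow> 0 < \<bar>t\<bar> \<Longrightarrow> \<bar>t\<bar> < d j \<Longrightarrow>
        norm ((H (z + \<i> * of_real s) - H z) / of_real s - (H (z + \<i> * of_real t) - H z) / of_real t)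
          \<le> 1 / real (Suc j)"
    and x: "\<And>z. z \<in> S \<Longrightarrow> ((\<lambda>s. H (z + of_real s)) has_vector_derivative Hx z) (at 0)"
    and y: "\<And>z. z \<in> S \<Longrightarrow> ((\<lambda>s. H (z + \<i> * of_real s)) has_vector_derivative Hy z) (at 0)"
    and z0: "z0 \<in> S"
  shows "(H has_derivative (\<lambda>v. Re v *\<^sub>R Hx z0 + Im v *\<^sub>R Hy z0)) (at z0 within S)"
proof -
  define q where "q = (\<lambda>s z. (H (z + \<i> * of_real s) - H z) / of_real s)"
  have lim: "((\<lambda>s. q s z) \<longlongrightarrow> Hy z) (at 0)" if "z \<in> S" for z
  proof -
    have "((\<lambda>s. norm (H (z + \<i> * of_real s) - (H z + s *\<^sub>R Hy z)) / \<bar>s\<bar>) \<longlongrightarrow> 0) (at 0)"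
      using y[OF that] unfolding has_vector_derivative_def has_derivative_at by (simp add: diff_diff_eq)
    moreover have "\<forall>\<^sub>F s in at 0. norm (H (z + \<i> * of_real s) - (H z + s *\<^sub>R Hy z)) / \<bar>s\<bar> = norm (q s z - Hy z)"
    proof (rule eventually_at_topological[THEN iffD2], intro exI[of _ UNIV] conjI ballI impI)
      fix s :: real assume "s \<noteq> 0"
      then have "q s z - Hy z = (H (z + \<i> * of_real s) - (H z + s *\<^sub>R Hy z)) / of_real s"
        by (simp add: q_def field_simps scaleR_conv_of_real)
      then show "norm (H (z + \<i> * of_real s) - (H z + s *\<^sub>R Hy z)) / \<bar>s\<bar> = norm (q s z - Hy z)"
        by (simp add: norm_divide)
    qed auto
    ultimately have "((\<lambda>s. norm (q s z - Hy z)) \<longlongrightarrow> 0) (at 0)"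
      by (simp cong: tendsto_cong)
    then show ?thesis
      by (simp add: LIM_zero_cancel tendsto_norm_zero_iff)
  qed
  \<comment> \<open>Letting \<open>t\<close> tend to 0 in the Cauchy condition bounds the distance
    from the quotient to the derivative, uniformly on \<open>S\<close>.\<close>
  have unif: "norm (q s z - Hy z) \<le> 1 / real (Suc j)" if z: "z \<in> S" and s: "0 < \<bar>s\<bar>" "\<bar>s\<bar> < d j" for s z j
  proof (rule tendsto_upperbound)
    show "((\<lambda>t. norm (q s z - q t z)) \<longlongrightarrow> norm (q s z - Hy z)) (at 0)"
      by (intro tendsto_intros lim z)
    show "\<forall>\<^sub>F t in at 0. norm (q s z - q t z) \<le> 1 / real (Suc j)"
      unfolding eventually_at using S[OF z s] d[of j]
      by (intro exI[of _ "d j"]) (auto simp: q_def dist_norm)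
  qed auto
  have small: "\<exists>j. 1 / real (Suc j) < e" if "e > 0" for e
    using nat_approx_posE[OF that] by metis
  show ?thesis
  proof (rule has_derivative_within_of_partials[OF z0 x[OF z0]])
    fix e :: real assume e: "e > 0"
    obtain j where j: "1 / real (Suc j) < e" using small[OF e] by blast
    show "\<exists>d>0. \<forall>z\<in>S. \<forall>t. \<bar>t\<bar> < d \<longrightarrow> norm (H (z + \<i> * of_real t) - H z - of_real t * Hy z) \<le> e * \<bar>t\<bar>"
    proof (intro exI[of _ "d j"] conjI ballI allI impI d)
      fix z t assume z: "z \<in> S" and t: "\<bar>t\<bar> < d j"
      show "norm (H (z + \<i> * of_real t) - H z - of_real t * Hy z) \<le> e * \<bar>t\<bar>"
      proof (cases "t = 0")
        case False
        then have "H (z + \<i> * of_real t) - H z - of_real t * Hy z = of_real t * (q t z - Hy z)"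
          by (simp add: q_def field_simps)
        then have "norm (H (z + \<i> * of_real t) - H z - of_real t * Hy z) = \<bar>t\<bar> * norm (q t z - Hy z)"
          by (simp add: norm_mult)
        also have "\<dots> \<le> \<bar>t\<bar> * e"
          using unif[OF z _ t] False j by (intro mult_left_mono) auto
        finally show ?thesis by (simp add: mult.commute)
      qed auto
    qed
  next
    show "continuous (at z0 within S) Hy"
      unfolding continuous_within_eps_delta
    proof (intro allI impI)
      fix e :: real assume e: "e > 0"
      obtain j where j: "1 / real (Suc j) < e / 3" using small[of "e/3"] e by auto
      define s where "s = d j / 2"
      have s: "0 < \<bar>s\<bar>" "\<bar>s\<bar> < d j" using d[of j] by (auto simp: s_def)
      \<comment> \<open>For one fixed increment the quotient is continuous on the plane and
        uniformly close to \<open>Hy\<close> on \<open>S\<close>; three errors of e/3 give the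
        continuity of \<open>Hy\<close>.\<close>
      have "continuous_on UNIV (q s)"
        unfolding q_def using s by (intro continuous_intros continuous_on_compose2[OF H]) auto
      then have "isCont (q s) z0"
        by (simp add: continuous_on_eq_continuous_at)
      then obtain r where r: "r > 0" "\<And>z. dist z z0 < r \<Longrightarrow> dist (q s z) (q s z0) < e / 3"
        unfolding continuous_at_eps_delta using e by (meson divide_pos_pos zero_less_numeral)
      show "\<exists>r>0. \<forall>z\<in>S. dist z z0 < r \<longrightarrow> dist (Hy z) (Hy z0) < e"
      proof (intro exI[of _ r] conjI ballI impI r(1))
        fix z assume z: "z \<in> S" and "dist z z0 < r"
        then have "norm (q s z - q s z0) < e / 3" using r by (simp add: dist_norm)
        moreover have "norm (Hy z - Hy z0) \<le> norm (q s z - q s z0) + norm (q s z - Hy z) + norm (q s z0 - Hy z0)"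
          using norm_diff_add_le[of "q s z - q s z0" "q s z - Hy z" "q s z0 - Hy z0"] by simp
        ultimately show "dist (Hy z) (Hy z0) < e"
          using unif[OF z s] unif[OF z0 s] j unfolding dist_norm by linarith
      qed
    qed
  qed
qed

lemma le_0_if_le_inverse_Suc:
  fixes x :: real
  assumes "\<And>n. x \<le> 1 / real (Suc n)"
  shows "x \<le> 0"
proof (rule ccontr)
  assume "\<not> x \<le> 0"
  then obtain n where "1 / real (Suc n) < x"
    using nat_approx_posE[of x] by (metis not_le)
  then show False using assms[of n] by linarith
qed

text \<open>An Egorov argument exhausts \<open>V\<close> up to a null set by sets on which the
  vertical quotients converge uniformly. On disjoint pieces of them the change of variables
  identifies the integral with the measure of the image. The images are disjoint by injectivity and
  lie in \<open>W\<close>, so their measures add up to at most that of \<open>W\<close>.\<close>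

lemma jacobian_integral_le_measure:
  fixes H Hx Hy :: "complex \<Rightarrow> complex"
  assumes H: "continuous_on UNIV H"
    and V: "V \<in> lmeasurable" and inj: "inj_on H V"
    and N: "negligible N"
    and x: "\<And>z. z \<in> V - N \<Longrightarrow> ((\<lambda>s. H (z + of_real s)) has_vector_derivative Hx z) (at 0)"
    and y: "\<And>z. z \<in> V - N \<Longrightarrow> ((\<lambda>s. H (z + \<i> * of_real s)) has_vector_derivative Hy z) (at 0)"
    and meas [measurable]: "Hx \<in> borel_measurable borel" "Hy \<in> borel_measurable borel"
    and W: "H ` V \<subseteq> W" "W \<in> lmeasurable"
  shows "(\<integral>\<^sup>+z. indicator V z * ennreal \<bar>Re (Hx z) * Im (Hy z) - Im (Hx z) * Re (Hy z)\<bar> \<partial>lebesgue)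
           \<le> ennreal (measure lebesgue W)"
proof -
  define J where "J = (\<lambda>z. \<bar>Re (Hx z) * Im (Hy z) - Im (Hx z) * Re (Hy z)\<bar>)"
  have J_meas [measurable]: "J \<in> borel_measurable lebesgue"
    unfolding J_def by (rule measurable_completion) measurable
  define q where "q = (\<lambda>s z. (H (z + \<i> * of_real s) - H z) / of_real s)"
  \<comment> \<open>Points whose vertical quotients at scale 1/(n+1) agree up to 1/(j+1). For fixed
    \<open>j\<close> these sets increase with \<open>n\<close> and cover
    \<open>V - N\<close>.\<close>
  define A where "A = (\<lambda>j n. {z. \<forall>s t. 0 < \<bar>s\<bar> \<and> \<bar>s\<bar> < 1 / real (Suc n) \<and> 0 < \<bar>t\<bar> \<and> \<bar>t\<bar> < 1 / real (Suc n) \<longrightarrow>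
     norm (q s z - q t z) \<le> 1 / real (Suc j)})"
  have A_closed: "closed (A j n)" for j n
    unfolding A_def q_def by (rule closed_Cauchy_quotient_set[OF H])
  then have A_meas: "A j n \<in> sets lebesgue" for j n
    by (intro borel_closed sets_completionI_sets) (simp add: borel_closed)
  have A_mono: "A j n \<subseteq> A j n'" if "n \<le> n'" for j n n'
  proof -
    have "1 / real (Suc n') \<le> 1 / real (Suc n)" using that by (simp add: frac_le)
    then show ?thesis unfolding A_def by fastforce
  qed
  have N_meas: "N \<in> sets lebesgue" using N by (simp add: negligible_iff_null_sets null_setsD2)
  have VN: "V - N \<in> lmeasurable" using V N_meas by (rule fmeasurable_Diff)
  have A_cover: "\<exists>n. z \<in> A j n" if z: "z \<in> V - N" for z j
  proof -
    define e where "e = 1 / real (Suc j) / 2"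
    have e: "e > 0" by (simp add: e_def)
    obtain d where d: "d > 0"
      "\<And>s. \<bar>s\<bar> < d \<Longrightarrow> norm (H (z + \<i> * of_real s) - H z - s *\<^sub>R Hy z) \<le> e * \<bar>s\<bar>"
      using has_vector_derivative_at_0_bound[OF y[OF z] e] by auto
    have qd: "norm (q s z - Hy z) \<le> e" if "0 < \<bar>s\<bar>" "\<bar>s\<bar> < d" for s
    proof -
      have "q s z - Hy z = (H (z + \<i> * of_real s) - H z - s *\<^sub>R Hy z) / of_real s"
        using that by (simp add: q_def field_simps scaleR_conv_of_real)
      then have "norm (q s z - Hy z) = norm (H (z + \<i> * of_real s) - H z - s *\<^sub>R Hy z) / \<bar>s\<bar>"
        by (simp add: norm_divide)
      also have "\<dots> \<le> e" using d(2)[OF that(2)] that by (simp add: divide_le_eq)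
      finally show ?thesis .
    qed
    obtain n where n: "1 / real (Suc n) < d" using nat_approx_posE[OF d(1)] by metis
    have "z \<in> A j n"
      unfolding A_def
    proof (intro CollectI allI impI)
      fix s t :: real
      assume st: "0 < \<bar>s\<bar> \<and> \<bar>s\<bar> < 1 / real (Suc n) \<and> 0 < \<bar>t\<bar> \<and> \<bar>t\<bar> < 1 / real (Suc n)"
      have "norm (q s z - q t z) \<le> norm (q s z - Hy z) + norm (q t z - Hy z)"
        using norm_triangle_ineq4[of "q s z - Hy z" "q t z - Hy z"] by simp
      also have "\<dots> \<le> e + e" using st n by (intro add_mono qd) auto
      finally show "norm (q s z - q t z) \<le> 1 / real (Suc j)" by (simp add: e_def del: of_nat_Suc)
    qed
    then show ?thesis ..
  qed
  have "\<exists>n. measure lebesgue (V - N - A j n) < e" if "e > 0" for e j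
  proof -
    have "(\<lambda>n. measure lebesgue (V - N - A j n)) \<longlonglongrightarrow> measure lebesgue (\<Inter>n. V - N - A j n)"
    proof (rule Lim_measure_decseq)
      show "range (\<lambda>n. V - N - A j n) \<subseteq> sets lebesgue"
        using A_meas VN by auto
      show "decseq (\<lambda>n. V - N - A j n)"
        using A_mono by (auto simp: decseq_def)
      show "emeasure lebesgue (V - N - A j i) \<noteq> \<infinity>" for i
        using fmeasurableD2[OF fmeasurable_Diff[OF VN A_meas]] by simp
    qed
    also have "(\<Inter>n. V - N - A j n) = {}"
      using A_cover by blast
    finally have "(\<lambda>n. measure lebesgue (V - N - A j n)) \<longlonglongrightarrow> 0" by simp
    from order_tendstoD(2)[OF this that] show ?thesis
      by (meson eventually_sequentially order_refl)
  qed
  \<comment> \<open>The scale depends on the accuracy \<open>j\<close> so that the parts lost at all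
    accuracies form a geometric series with sum 1/(m+1).\<close>
  then have "\<exists>nn. \<forall>m j. measure lebesgue (V - N - A j (nn m j)) < 1 / real (Suc m) * (1/2)^Suc j"
    by (intro choice allI) (auto intro!: divide_pos_pos)
  then obtain nn where nn: "\<And>m j. measure lebesgue (V - N - A j (nn m j)) < 1 / real (Suc m) * (1/2)^Suc j"
    by blast
  define S where "S = (\<lambda>m. (V - N) \<inter> (\<Inter>j. A j (nn m j)))"
  have S_meas: "S m \<in> sets lebesgue" for m
    unfolding S_def using VN A_meas by (intro sets.Int sets.countable_INT) auto
  have rest: "measure lebesgue (V - N - S m) \<le> 1 / real (Suc m)" for m
  proof -
    have eq: "V - N - S m = (\<Union>j. V - N - A j (nn m j))"
      unfolding S_def by auto
    have bound: "measure lebesgue (\<Union>j\<le>k. V - N - A j (nn m j)) \<le> 1 / real (Suc m)" for k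
    proof -
      have "measure lebesgue (\<Union>j\<le>k. V - N - A j (nn m j)) \<le> (\<Sum>j\<le>k. measure lebesgue (V - N - A j (nn m j)))"
        by (rule measure_UNION_le) (use fmeasurable_Diff[OF VN A_meas] in auto)
      also have "\<dots> \<le> (\<Sum>j\<le>k. 1 / real (Suc m) * (1/2)^Suc j)"
        using nn by (intro sum_mono less_imp_le)
      also have "\<dots> = 1 / real (Suc m) * (\<Sum>j\<le>k. (1/2)^Suc j)"
        by (simp add: sum_distrib_left)
      also have "\<dots> \<le> 1 / real (Suc m) * 1"
      proof (rule mult_left_mono)
        have "(\<Sum>j\<le>k. (1/2::real)^Suc j) \<le> (\<Sum>j. (1/2::real)^Suc j)"
          by (rule sum_le_suminf) (use power_half_series sums_summable in auto)
        then show "(\<Sum>j\<le>k. (1/2::real)^Suc j) \<le> 1" using power_half_series by (simp add: sums_iff)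
      qed auto
      finally show ?thesis by simp
    qed
    show ?thesis unfolding eq
      by (rule measure_countable_Union_le[OF fmeasurable_Diff[OF VN A_meas] bound])
  qed
  have null: "negligible (V - (\<Union>m. S m))"
  proof -
    have lm: "V - N - (\<Union>m. S m) \<in> lmeasurable"
      using fmeasurable_Diff[OF VN, of "\<Union>m. S m"] S_meas by auto
    have "measure lebesgue (V - N - (\<Union>m. S m)) \<le> 1 / real (Suc m)" for m
    proof -
      have "measure lebesgue (V - N - (\<Union>m. S m)) \<le> measure lebesgue (V - N - S m)"
        using lm fmeasurable_Diff[OF VN S_meas] by (intro measure_mono_fmeasurable) (auto dest: fmeasurableD)
      then show ?thesis using rest[of m] by linarith
    qed
    then have "measure lebesgue (V - N - (\<Union>m. S m)) \<le> 0"
      by (rule le_0_if_le_inverse_Suc)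
    then have "negligible (V - N - (\<Union>m. S m))"
      using lm negligible_iff_measure by (metis measure_nonneg order_antisym)
    then have "negligible ((V - N - (\<Union>m. S m)) \<union> N)"
      using N by (rule negligible_Un)
    then show ?thesis by (rule negligible_subset) auto
  qed
  define D where "D = disjointed S"
  have D_sub: "D m \<subseteq> S m" for m unfolding D_def by (rule disjointed_subset)
  have D_disj: "disjoint_family D" unfolding D_def by (rule disjoint_family_disjointed)
  have D_meas: "D m \<in> sets lebesgue" for m
    unfolding D_def using sets.range_disjointed_sets[of S lebesgue] S_meas by auto
  have D_un: "(\<Union>m. D m) = (\<Union>m. S m)" unfolding D_def by (rule UN_disjointed_eq)
  have S_sub: "S m \<subseteq> V - N" for m unfolding S_def by auto
  have DV: "D m \<subseteq> V" for m using D_sub S_sub by blast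
  have der: "(H has_derivative (\<lambda>v. Re v *\<^sub>R Hx z + Im v *\<^sub>R Hy z)) (at z within D m)" if "z \<in> D m" for z m
  proof (rule has_derivative_subset)
    show "(H has_derivative (\<lambda>v. Re v *\<^sub>R Hx z + Im v *\<^sub>R Hy z)) (at z within S m)"
    proof (rule has_derivative_within_uniform_quotients[where d="\<lambda>j. 1 / real (Suc (nn m j))", OF H])
      fix z j s t assume "z \<in> S m" "0 < \<bar>s\<bar>" "\<bar>s\<bar> < 1 / real (Suc (nn m j))" "0 < \<bar>t\<bar>" "\<bar>t\<bar> < 1 / real (Suc (nn m j))"
      then show "norm ((H (z + \<i> * of_real s) - H z) / of_real s - (H (z + \<i> * of_real t) - H z) / of_real t)
          \<le> 1 / real (Suc j)"
        unfolding S_def A_def q_def by blast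
    qed (use x y subsetD[OF S_sub] that subsetD[OF D_sub] in auto)
  qed (rule D_sub)
  have HD_meas: "H ` D m \<in> sets lebesgue" for m
    by (rule differentiable_image_in_sets_lebesgue[OF D_meas])
       (use der in \<open>auto simp: differentiable_on_def differentiable_def\<close>)
  have HD_lm: "H ` D m \<in> lmeasurable" for m
    by (rule fmeasurableI2[OF W(2) _ HD_meas]) (use DV W(1) in blast)
  have piece: "(\<integral>\<^sup>+z. ennreal (J z) * indicator (D m) z \<partial>lebesgue) = emeasure lebesgue (H ` D m)" for m
  proof -
    have injD: "inj_on H (D m)" using inj DV inj_on_subset by blast
    have jac: "\<bar>real_jacobian (\<lambda>v. Re v *\<^sub>R Hx z + Im v *\<^sub>R Hy z)\<bar> = J z" for z
      by (simp add: real_jacobian_def J_def)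
    note im = has_measure_differentiable_image_complex[OF D_meas der injD HD_lm, unfolded jac]
    have "(\<integral>\<^sup>+z. ennreal (J z) * indicator (D m) z \<partial>lebesgue) = (\<integral>\<^sup>+z. ennreal (indicator (D m) z *\<^sub>R J z) \<partial>lebesgue)"
      by (intro nn_integral_cong) (auto simp: indicator_def)
    also have "\<dots> = ennreal (LINT z:D m|lebesgue. J z)"
      unfolding set_lebesgue_integral_def
      by (rule nn_integral_eq_integral) (use im(1) in \<open>auto simp: set_integrable_def J_def indicator_def\<close>)
    also have "(LINT z:D m|lebesgue. J z) = measure lebesgue (H ` D m)"
      using set_lebesgue_integral_eq_integral(2)[OF im(1)] im(2) by simp
    also have "ennreal \<dots> = emeasure lebesgue (H ` D m)"
      using HD_lm by (simp add: emeasure_eq_measure2)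
    finally show ?thesis .
  qed
  have "(\<integral>\<^sup>+z. indicator V z * ennreal (J z) \<partial>lebesgue) = (\<integral>\<^sup>+z. (\<Sum>m. ennreal (J z) * indicator (D m) z) \<partial>lebesgue)"
  proof (rule nn_integral_cong_AE)
    have "AE z in lebesgue. z \<notin> V - (\<Union>m. S m)"
      using null unfolding negligible_iff_null_sets by (rule AE_not_in)
    then show "AE z in lebesgue. indicator V z * ennreal (J z) = (\<Sum>m. ennreal (J z) * indicator (D m) z)"
    proof (rule AE_mp, intro AE_I2 impI)
      fix z assume "z \<notin> V - (\<Union>m. S m)"
      moreover have "(\<Union>m. S m) \<subseteq> V" using S_sub by blast
      ultimately have "z \<in> V \<longleftrightarrow> z \<in> (\<Union>m. D m)" unfolding D_un by blast
      then have "indicator V z = (indicator (\<Union>m. D m) z :: ennreal)"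
        by (simp add: indicator_def)
      then show "indicator V z * ennreal (J z) = (\<Sum>m. ennreal (J z) * indicator (D m) z)"
        using suminf_indicator[OF D_disj, of z] by (simp add: ennreal_suminf_cmult mult.commute)
    qed
  qed
  also have "\<dots> = (\<Sum>m. \<integral>\<^sup>+z. ennreal (J z) * indicator (D m) z \<partial>lebesgue)"
    by (rule nn_integral_suminf) (use D_meas in measurable)
  also have "\<dots> = (\<Sum>m. emeasure lebesgue (H ` D m))"
    by (simp add: piece)
  also have "\<dots> = emeasure lebesgue (\<Union>m. H ` D m)"
  proof (rule suminf_emeasure)
    show "disjoint_family (\<lambda>m. H ` D m)"
      using D_disj inj DV unfolding disjoint_family_on_def inj_on_def by blast
  qed (use HD_meas in auto)
  also have "\<dots> \<le> emeasure lebesgue W"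
    by (rule emeasure_mono) (use DV W in auto)
  also have "\<dots> = ennreal (measure lebesgue W)"
    using W(2) by (simp add: emeasure_eq_measure2)
  finally show ?thesis unfolding J_def .
qed

section \<open>The fundamental theorem of calculus for absolutely continuous functions\<close>

lemma absolutely_continuous_realD:
  assumes "absolutely_continuous_real a b f" "e > 0"
  shows "\<exists>\<delta>>0. \<forall>n (u :: nat \<Rightarrow> real) (v :: nat \<Rightarrow> real).
        (\<forall>i<n. a \<le> u i \<and> u i \<le> v i \<and> v i \<le> b) \<and>
        (\<forall>i<n. \<forall>j<n. i \<noteq> j \<longrightarrow> {u i<..<v i} \<inter> {u j<..<v j} = {}) \<and>
        (\<Sum>i<n. v i - u i) < \<delta> \<longrightarrow> (\<Sum>i<n. dist (f (u i)) (f (v i))) < e"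
  using assms(1)[unfolded absolutely_continuous_real_def, THEN spec, THEN mp, OF assms(2)] .

text \<open>The definition indexes intervals by initial segments of the naturals; a tagged division
  is a finite set of pairs. Reindexing by a bijection makes the condition applicable to it.\<close>

lemma absolutely_continuous_real_finite_family:
  assumes ac: "absolutely_continuous_real a b f" and e: "e > 0"
  shows "\<exists>\<delta>>0. \<forall>(I :: 'i set) u v. finite I \<and> (\<forall>i\<in>I. a \<le> u i \<and> u i \<le> v i \<and> v i \<le> b) \<and>
       disjoint_family_on (\<lambda>i. {u i<..<v i}) I \<and> (\<Sum>i\<in>I. v i - u i) < \<delta> \<longrightarrow>
       (\<Sum>i\<in>I. dist (f (u i)) (f (v i))) < e"
proof -
  obtain \<delta> where \<delta>: "\<delta> > 0" and AC: "\<forall>n (u :: nat \<Rightarrow> real) (v :: nat \<Rightarrow> real).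
        (\<forall>i<n. a \<le> u i \<and> u i \<le> v i \<and> v i \<le> b) \<and>
        (\<forall>i<n. \<forall>j<n. i \<noteq> j \<longrightarrow> {u i<..<v i} \<inter> {u j<..<v j} = {}) \<and>
        (\<Sum>i<n. v i - u i) < \<delta> \<longrightarrow> (\<Sum>i<n. dist (f (u i)) (f (v i))) < e"
    using absolutely_continuous_realD[OF ac e] by (elim exE conjE)
  have *: "(\<Sum>i\<in>I. dist (f (u i)) (f (v i))) < e"
    if fin: "finite I" and uv: "\<And>i. i \<in> I \<Longrightarrow> a \<le> u i \<and> u i \<le> v i \<and> v i \<le> b"
      and disj: "disjoint_family_on (\<lambda>i. {u i<..<v i}) I" and sm: "(\<Sum>i\<in>I. v i - u i) < \<delta>"
    for I :: "'i set" and u v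
  proof -
    obtain h where h: "bij_betw h {..<card I} I"
      using ex_bij_betw_nat_finite[OF fin] by (auto simp: atLeast0LessThan)
    have hI: "h i \<in> I" if "i < card I" for i
      using h that by (auto simp: bij_betw_def)
    have hne: "h i \<noteq> h j" if "i < card I" "j < card I" "i \<noteq> j" for i j
      using h that by (auto simp: bij_betw_def inj_on_def)
    have "(\<Sum>i<card I. dist (f (u (h i))) (f (v (h i)))) < e"
    proof (rule AC[THEN spec[of _ "card I"], THEN spec[of _ "\<lambda>i. u (h i)"], THEN spec[of _ "\<lambda>i. v (h i)"], THEN mp], intro conjI allI impI)
      show "(\<Sum>i<card I. v (h i) - u (h i)) < \<delta>"
        using sm sum.reindex_bij_betw[OF h, of "\<lambda>i. v i - u i"] by simp
      show "{u (h i)<..<v (h i)} \<inter> {u (h j)<..<v (h j)} = {}"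
        if "i < card I" "j < card I" "i \<noteq> j" for i j
        using disj hI hne that unfolding disjoint_family_on_def by blast
    qed (use uv hI in auto)
    then show ?thesis
      using sum.reindex_bij_betw[OF h, of "\<lambda>i. dist (f (u i)) (f (v i))"] by simp
  qed
  show ?thesis
    by (intro exI[of _ \<delta>] conjI allI impI \<delta>, elim conjE, rule *) auto
qed

text \<open>Made for products: an absolutely continuous factor times a Lipschitz one satisfies such
  a bound on a compact interval.\<close>

lemma absolutely_continuous_real_dominated:
  assumes ac: "absolutely_continuous_real a b f" and M: "M \<ge> 0" and C: "C \<ge> 0"
    and dom: "\<And>u v. a \<le> u \<Longrightarrow> u \<le> v \<Longrightarrow> v \<le> b \<Longrightarrow> dist (g u) (g v) \<le> M * dist (f u) (f v) + C * (v - u)"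
  shows "absolutely_continuous_real a b g"
  unfolding absolutely_continuous_real_def
proof (intro allI impI)
  fix e :: real assume e: "e > 0"
  define e' where "e' = e / (2 * (M + 1))"
  have e': "e' > 0" using e M by (simp add: e'_def)
  obtain \<delta> where \<delta>: "\<delta> > 0" and AC: "\<forall>n (u :: nat \<Rightarrow> real) (v :: nat \<Rightarrow> real).
        (\<forall>i<n. a \<le> u i \<and> u i \<le> v i \<and> v i \<le> b) \<and>
        (\<forall>i<n. \<forall>j<n. i \<noteq> j \<longrightarrow> {u i<..<v i} \<inter> {u j<..<v j} = {}) \<and>
        (\<Sum>i<n. v i - u i) < \<delta> \<longrightarrow> (\<Sum>i<n. dist (f (u i)) (f (v i))) < e'"
    using absolutely_continuous_realD[OF ac e'] by (elim exE conjE)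
  define \<delta>' where "\<delta>' = min \<delta> (e / (2 * (C + 1)))"
  have \<delta>': "\<delta>' > 0" using \<delta> e C by (simp add: \<delta>'_def)
  have *: "(\<Sum>i<n. dist (g (u i)) (g (v i))) < e"
    if H: "(\<forall>i<n. a \<le> u i \<and> u i \<le> v i \<and> v i \<le> b) \<and>
        (\<forall>i<n. \<forall>j<n. i \<noteq> j \<longrightarrow> {u i<..<v i} \<inter> {u j<..<v j} = {}) \<and>
        (\<Sum>i<n. v i - u i) < \<delta>'" for n and u v :: "nat \<Rightarrow> real"
  proof -
    have s0: "0 \<le> (\<Sum>i<n. v i - u i)" using H by (intro sum_nonneg) auto
    have 1: "(\<Sum>i<n. dist (f (u i)) (f (v i))) < e'"
      using H by (intro AC[THEN spec, THEN spec, THEN spec, THEN mp]) (auto simp: \<delta>'_def)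
    have 2: "(\<Sum>i<n. v i - u i) < e / (2 * (C + 1))"
      using H by (auto simp: \<delta>'_def)
    have "(\<Sum>i<n. dist (g (u i)) (g (v i))) \<le> (\<Sum>i<n. M * dist (f (u i)) (f (v i)) + C * (v i - u i))"
      using H by (intro sum_mono dom) auto
    also have "\<dots> = M * (\<Sum>i<n. dist (f (u i)) (f (v i))) + C * (\<Sum>i<n. v i - u i)"
      by (simp only: sum.distrib sum_distrib_left)
    also have "\<dots> \<le> M * e' + C * (\<Sum>i<n. v i - u i)"
      using 1 M by (intro add_right_mono mult_left_mono) auto
    also have "\<dots> \<le> M * e' + C * (e / (2 * (C + 1)))"
      using 2 C by (intro add_left_mono mult_left_mono) auto
    also have "\<dots> < (M + 1) * e' + (C + 1) * (e / (2 * (C + 1)))"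
      using e' C e by (intro add_strict_mono mult_strict_right_mono) auto
    also have "\<dots> = e"
    proof -
      have "M + 1 \<noteq> 0" "C + 1 \<noteq> 0" using M C by auto
      then have "(M + 1) * e' = e / 2" "(C + 1) * (e / (2 * (C + 1))) = e / 2"
        unfolding e'_def by (simp_all only: times_divide_eq_right mult.commute[of 2] mult_divide_mult_cancel_left_if if_False)
      then show ?thesis by (simp only: field_sum_of_halves)
    qed
    finally show ?thesis .
  qed
  show "\<exists>\<delta>>0. \<forall>n (u :: nat \<Rightarrow> real) (v :: nat \<Rightarrow> real).
        (\<forall>i<n. a \<le> u i \<and> u i \<le> v i \<and> v i \<le> b) \<and>
        (\<forall>i<n. \<forall>j<n. i \<noteq> j \<longrightarrow> {u i<..<v i} \<inter> {u j<..<v j} = {}) \<and>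
        (\<Sum>i<n. v i - u i) < \<delta> \<longrightarrow> (\<Sum>i<n. dist (g (u i)) (g (v i))) < e"
  proof (rule exI[of _ \<delta>'], rule conjI[OF \<delta>'], rule allI, rule allI, rule allI, rule impI)
    fix n and u v :: "nat \<Rightarrow> real"
    assume "(\<forall>i<n. a \<le> u i \<and> u i \<le> v i \<and> v i \<le> b) \<and>
        (\<forall>i<n. \<forall>j<n. i \<noteq> j \<longrightarrow> {u i<..<v i} \<inter> {u j<..<v j} = {}) \<and>
        (\<Sum>i<n. v i - u i) < \<delta>'"
    then show "(\<Sum>i<n. dist (g (u i)) (g (v i))) < e" by (rule *)
  qed
qed

text \<open>The gauge integral makes integrability of \<open>f'\<close> part of the conclusion.
  Intervals tagged off \<open>N\<close> are controlled by differentiability at the tag. Those tagged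
  in \<open>N\<close> lie in an open set of small measure, where absolute continuity makes the total
  increment of \<open>f\<close> small.\<close>

theorem fundamental_theorem_of_calculus_absolutely_continuous:
  fixes f :: "real \<Rightarrow> complex"
  assumes ac: "absolutely_continuous_real a b f" and ab: "a \<le> b"
    and N: "negligible N"
    and der: "\<And>x. x \<in> {a..b} - N \<Longrightarrow> (f has_vector_derivative f' x) (at x within {a..b})"
  shows "(f' has_integral (f b - f a)) {a..b}"
proof -
  \<comment> \<open>With value 0 on \<open>N\<close>, the Riemann terms tagged there vanish and only
    the increments of \<open>f\<close> remain to be bounded.\<close>
  define g where "g = (\<lambda>x. if x \<in> N then 0 else f' x)"
  have "(g has_integral (f b - f a)) {a..b}"
    unfolding has_integral_real
  proof (intro allI impI)
    fix e :: real assume e: "e > 0"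
    \<comment> \<open>The summand 1 keeps the denominator positive when
      \<open>a = b\<close>.\<close>
    define e1 where "e1 = e / (2 * (b - a + 1))"
    have e1: "e1 > 0" using e ab by (simp add: e1_def)
    obtain \<delta> where \<delta>: "\<delta> > 0"
      and AC: "\<forall>(I :: (real \<times> real set) set) u v. finite I \<and> (\<forall>i\<in>I. a \<le> u i \<and> u i \<le> v i \<and> v i \<le> b) \<and>
       disjoint_family_on (\<lambda>i. {u i<..<v i}) I \<and> (\<Sum>i\<in>I. v i - u i) < \<delta> \<longrightarrow>
       (\<Sum>i\<in>I. dist (f (u i)) (f (v i))) < e/2"
      using absolutely_continuous_real_finite_family[OF ac half_gt_zero[OF e]] by (elim exE conjE)
    obtain U where U: "open U" "N \<subseteq> U" "U - N \<in> lmeasurable" "emeasure lebesgue (U - N) < ennreal \<delta>"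
      using sets_lebesgue_outer_open[of N \<delta>] N \<delta> negligible_imp_sets by blast
    have U_lm: "U \<in> lmeasurable"
    proof -
      have "(U - N) \<union> N \<in> lmeasurable"
        by (rule fmeasurable.Un[OF U(3) negligible_imp_measurable[OF N]])
      moreover have "(U - N) \<union> N = U" using U by auto
      ultimately show ?thesis by (simp only:)
    qed
    have U_less: "measure lebesgue U < \<delta>"
    proof -
      have "measure lebesgue U = measure lebesgue (U - N)"
        by (rule measure_negligible_symdiff[OF U(3)], rule negligible_subset[OF N]) auto
      also have "\<dots> < \<delta>"
        using U(3,4) \<delta> by (simp add: emeasure_eq_measure2 ennreal_less_iff)
      finally show ?thesis .
    qed
    have "\<forall>x. \<exists>d>0. x \<in> {a..b} - N \<longrightarrow>
         (\<forall>y\<in>{a..b}. norm (y-x) < d \<longrightarrow> norm (f y - f x - (y-x) *\<^sub>R f' x) \<le> e1 * norm (y-x))"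
      using der[unfolded has_vector_derivative_def has_derivative_within_alt] e1 by (meson zero_less_one)
    then obtain d where d: "\<And>x. 0 < d x"
      "\<And>x y. \<lbrakk>x \<in> {a..b} - N; y \<in> {a..b}; norm (y-x) < d x\<rbrakk>
          \<Longrightarrow> norm (f y - f x - (y-x) *\<^sub>R f' x) \<le> e1 * norm (y-x)"
      by metis
    define \<gamma> where "\<gamma> = (\<lambda>x. if x \<in> N then U else ball x (d x))"
    have gauge: "gauge \<gamma>"
      using U d(1) by (auto simp: gauge_def \<gamma>_def)
    show "\<exists>\<gamma>. gauge \<gamma> \<and> (\<forall>\<D>. \<D> tagged_division_of {a..b} \<and> \<gamma> fine \<D> \<longrightarrow>
        norm ((\<Sum>(x,k)\<in>\<D>. measure lborel k *\<^sub>R g x) - (f b - f a)) < e)"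
    proof (intro exI[of _ \<gamma>] conjI gauge allI impI)
      fix p assume p: "p tagged_division_of {a..b} \<and> \<gamma> fine p"
      then have ptag: "p tagged_division_of {a..b}" and fine: "\<gamma> fine p" by auto
      have finp: "finite p" using ptag by blast
      define u v :: "real \<times> real set \<Rightarrow> real" where "u = (\<lambda>i. Inf (snd i))" and "v = (\<lambda>i. Sup (snd i))"
      have pk: "snd i = {u i..v i} \<and> fst i \<in> {u i..v i} \<and> a \<le> u i \<and> u i \<le> v i \<and> v i \<le> b \<and>
          measure lborel (snd i) = v i - u i \<and> {u i..v i} \<subseteq> \<gamma> (fst i)" if i: "i \<in> p" for i
      proof -
        obtain x K where xK: "i = (x, K)" by (cases i)
        have "x \<in> K" "K \<subseteq> {a..b}" using ptag i xK by blast+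
        moreover obtain s t where st: "K = cbox s t" using ptag i xK by blast
        moreover have "K \<subseteq> \<gamma> x" using fine i xK by (auto simp: fine_def)
        ultimately show ?thesis
          by (auto simp: xK u_def v_def)
      qed
      have disj: "disjoint_family_on (\<lambda>i. {u i<..<v i}) p"
        unfolding disjoint_family_on_def
      proof (intro ballI impI)
        fix i j assume ij: "i \<in> p" "j \<in> p" "i \<noteq> j"
        have "interior (snd i) \<inter> interior (snd j) = {}"
          using tagged_division_ofD(5)[OF ptag, of "fst i" "snd i" "fst j" "snd j"] ij by (simp add: prod_eq_iff)
        then show "{u i<..<v i} \<inter> {u j<..<v j} = {}"
          using pk[OF ij(1)] pk[OF ij(2)] by (metis interior_atLeastAtMost_real)
      qed
      define pN where "pN = {i \<in> p. fst i \<in> N}"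
      have pN: "pN \<subseteq> p" "finite pN" using finp by (auto simp: pN_def)
      have uvN: "u i \<le> v i" if "i \<in> pN" for i
        using pk[of i] pN(1) that by auto
      have sumN: "(\<Sum>i\<in>pN. v i - u i) < \<delta>"
      proof -
        have "(\<Sum>i\<in>pN. v i - u i) = (\<Sum>i\<in>pN. measure lebesgue {u i<..<v i})"
          using pk pN by (intro sum.cong) auto
        also have "\<dots> = measure lebesgue (\<Union>i\<in>pN. {u i<..<v i})"
          using disj pN by (intro measure_finite_Union[symmetric] disjoint_family_on_mono[of pN p]) (auto simp: uvN)
        also have "\<dots> \<le> measure lebesgue U"
        proof (rule measure_mono_fmeasurable)
          show "(\<Union>i\<in>pN. {u i<..<v i}) \<subseteq> U"
          proof (rule UN_least)
            fix i assume i: "i \<in> pN"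
            then have "{u i..v i} \<subseteq> U" using pk[of i] by (auto simp: pN_def \<gamma>_def)
            then show "{u i<..<v i} \<subseteq> U" by force
          qed
        qed (use U_lm pN in auto)
        finally show ?thesis using U_less by simp
      qed
      have bN: "(\<Sum>i\<in>pN. dist (f (u i)) (f (v i))) < e/2"
        using pk pN disj sumN by (intro AC[THEN spec, THEN spec, THEN spec, THEN mp]) (auto intro: disjoint_family_on_mono)
      have bR: "norm (measure lborel (snd i) *\<^sub>R g (fst i) - (f (v i) - f (u i))) \<le> e1 * (v i - u i)" if i: "i \<in> p - pN" for i
      proof -
        define x where "x = fst i"
        have x: "x \<in> {a..b} - N" "u i \<in> {a..b}" "v i \<in> {a..b}" "x \<in> {u i..v i}"
          using pk[of i] i by (auto simp: pN_def x_def)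
        have "{u i..v i} \<subseteq> ball x (d x)"
          using pk[of i] i by (auto simp: pN_def x_def \<gamma>_def)
        moreover have "u i \<in> {u i..v i}" "v i \<in> {u i..v i}"
          using x(4) by auto
        ultimately have "u i \<in> ball x (d x)" "v i \<in> ball x (d x)"
          by blast+
        then have lt: "norm (u i - x) < d x" "norm (v i - x) < d x"
          by (auto simp: dist_real_def abs_minus_commute)
        \<comment> \<open>Both endpoints are compared with the tag. As the tag lies between them,
          the two errors add up to a multiple of the length of the interval.\<close>
        have "norm ((v i - u i) *\<^sub>R f' x - (f (v i) - f (u i)))
           = norm ((f (u i) - f x - (u i - x) *\<^sub>R f' x) - (f (v i) - f x - (v i - x) *\<^sub>R f' x))"
          by (simp add: algebra_simps)
        also have "\<dots> \<le> e1 * norm (u i - x) + e1 * norm (v i - x)"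
          by (rule order_trans[OF norm_triangle_ineq4 add_mono[OF d(2)[OF x(1,2) lt(1)] d(2)[OF x(1,3) lt(2)]]])
        also have "\<dots> = e1 * (v i - u i)"
          using x(4) by (simp add: algebra_simps)
        finally show ?thesis
          using pk[of i] i x(1) by (simp add: g_def x_def)
      qed
      have bN': "norm (measure lborel (snd i) *\<^sub>R g (fst i) - (f (v i) - f (u i))) = dist (f (u i)) (f (v i))" if "i \<in> pN" for i
        using that by (simp add: pN_def g_def dist_norm)
      have fsum: "f b - f a = (\<Sum>i\<in>p. f (v i) - f (u i))" "b - a = (\<Sum>i\<in>p. v i - u i)"
        using additive_tagged_division_1[OF ab ptag, of f] additive_tagged_division_1[OF ab ptag, of "\<lambda>x. x"]
        by (simp_all add: u_def v_def case_prod_unfold)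
      have "norm ((\<Sum>(x,k)\<in>p. measure lborel k *\<^sub>R g x) - (f b - f a))
          = norm (\<Sum>i\<in>p. measure lborel (snd i) *\<^sub>R g (fst i) - (f (v i) - f (u i)))"
        unfolding fsum by (simp add: case_prod_unfold sum_subtractf)
      also have "\<dots> \<le> (\<Sum>i\<in>p. norm (measure lborel (snd i) *\<^sub>R g (fst i) - (f (v i) - f (u i))))"
        by (rule norm_sum)
      also have "\<dots> = (\<Sum>i\<in>pN. norm (measure lborel (snd i) *\<^sub>R g (fst i) - (f (v i) - f (u i))))
          + (\<Sum>i\<in>p - pN. norm (measure lborel (snd i) *\<^sub>R g (fst i) - (f (v i) - f (u i))))"
        using sum.subset_diff[OF pN(1) finp] by (simp add: add.commute)
      also have "\<dots> < e/2 + (\<Sum>i\<in>p - pN. e1 * (v i - u i))"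
        using bN bN' bR by (intro add_less_le_mono sum_mono) auto
      also have "\<dots> \<le> e/2 + (\<Sum>i\<in>p. e1 * (v i - u i))"
        using finp pk e1 by (intro add_mono sum_mono2) auto
      also have "\<dots> = e/2 + e1 * (b - a)"
        unfolding fsum by (simp add: sum_distrib_left)
      also have "\<dots> \<le> e/2 + e/2"
        using e ab by (simp add: e1_def field_simps)
      finally show "norm ((\<Sum>(x,k)\<in>p. measure lborel k *\<^sub>R g x) - (f b - f a)) < e" by simp
    qed
  qed
  then show ?thesis
    by (rule has_integral_spike[OF N, rotated]) (auto simp: g_def)
qed

section \<open>Green's formula on squares\<close>

lemma Complex_borel [measurable]: "(\<lambda>(x, y). Complex x y) \<in> borel_measurable (borel \<Otimes>\<^sub>M borel)"
proof -
  have "(\<lambda>(x, y). Complex x y) = (\<lambda>p. of_real (fst p) + \<i> * of_real (snd p))"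
    by (auto simp: fun_eq_iff complex_eq_iff)
  then show ?thesis by simp
qed

lemma lborel_complex_prod: "lborel = distr (lborel \<Otimes>\<^sub>M lborel) borel (\<lambda>(x, y). Complex x y)"
proof (rule lborel_eqI)
  fix l u :: complex assume lu: "\<And>b. b \<in> Basis \<Longrightarrow> l \<bullet> b \<le> u \<bullet> b"
  have re: "Re l \<le> Re u" and im: "Im l \<le> Im u"
    using lu[of 1] lu[of \<i>] by (auto simp: Basis_complex_def)
  have meas: "(\<lambda>(x, y). Complex x y) \<in> measurable (lborel \<Otimes>\<^sub>M lborel) borel"
    by simp
  have eq: "(\<lambda>(x, y). Complex x y) -` box l u \<inter> space (lborel \<Otimes>\<^sub>M lborel)
      = {Re l<..<Re u} \<times> {Im l<..<Im u}"
    by (auto simp: box_def Basis_complex_def space_pair_measure)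
  have "emeasure (distr (lborel \<Otimes>\<^sub>M lborel) borel (\<lambda>(x, y). Complex x y)) (box l u)
      = emeasure (lborel \<Otimes>\<^sub>M lborel) ({Re l<..<Re u} \<times> {Im l<..<Im u})"
    by (subst emeasure_distr[OF meas]) (simp_all only: eq borel_open open_box)
  also have "\<dots> = ennreal (Re u - Re l) * ennreal (Im u - Im l)"
    using re im by (subst lborel.emeasure_pair_measure_Times) auto
  also have "\<dots> = (\<Prod>b\<in>Basis. (u - l) \<bullet> b)"
    using re im by (simp add: Basis_complex_def inner_complex_def ennreal_mult)
  finally show "emeasure (distr (lborel \<Otimes>\<^sub>M lborel) borel (\<lambda>(x, y). Complex x y)) (box l u)
     = (\<Prod>b\<in>Basis. (u - l) \<bullet> b)" .
qed auto

lemma Complex_measurable_lborel: "(\<lambda>(x, y). Complex x y) \<in> measurable (lborel \<Otimes>\<^sub>M lborel) borel"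
  by simp

lemma integrable_lborel_complex_prod:
  fixes f :: "complex \<Rightarrow> complex"
  assumes "integrable lborel f"
  shows "integrable (lborel \<Otimes>\<^sub>M lborel) (\<lambda>(x, y). f (Complex x y))"
    and "integral\<^sup>L lborel f = integral\<^sup>L (lborel \<Otimes>\<^sub>M lborel) (\<lambda>(x, y). f (Complex x y))"
proof -
  have 1: "integrable (distr (lborel \<Otimes>\<^sub>M lborel) borel (\<lambda>(x, y). Complex x y)) f"
    using assms lborel_complex_prod by simp
  show "integrable (lborel \<Otimes>\<^sub>M lborel) (\<lambda>(x, y). f (Complex x y))"
    using integrable_distr[OF Complex_measurable_lborel 1] by (simp add: case_prod_unfold)
  have "integral\<^sup>L lborel f = integral\<^sup>L (distr (lborel \<Otimes>\<^sub>M lborel) borel (\<lambda>(x, y). Complex x y)) f"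
    using lborel_complex_prod by simp
  also have "\<dots> = integral\<^sup>L (lborel \<Otimes>\<^sub>M lborel) (\<lambda>p. f (case p of (x, y) \<Rightarrow> Complex x y))"
    by (rule integral_distr[OF Complex_measurable_lborel]) (use assms in auto)
  finally show "integral\<^sup>L lborel f = integral\<^sup>L (lborel \<Otimes>\<^sub>M lborel) (\<lambda>(x, y). f (Complex x y))"
    by (simp add: case_prod_unfold)
qed

lemma AE_lborel_complex_lines:
  assumes "AE z in lebesgue. P z"
  shows "AE t in lborel. AE s in lborel. P (Complex s t)"
    and "AE s in lborel. AE t in lborel. P (Complex s t)"
proof -
  have "AE z in lborel. P z" using assms by (simp add: AE_completion_iff)
  then obtain N where N: "{z. \<not> P z} \<subseteq> N" "N \<in> sets borel" "emeasure lborel N = 0"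
    by (auto elim!: AE_E)
  define N' where "N' = (\<lambda>(x, y). Complex x y) -` N \<inter> space (lborel \<Otimes>\<^sub>M lborel :: (real \<times> real) measure)"
  have N'_sets: "N' \<in> sets (lborel \<Otimes>\<^sub>M lborel)"
    unfolding N'_def by (rule measurable_sets[OF Complex_measurable_lborel N(2)])
  have "emeasure (lborel \<Otimes>\<^sub>M lborel) N' = emeasure (distr (lborel \<Otimes>\<^sub>M lborel) borel (\<lambda>(x, y). Complex x y)) N"
    unfolding N'_def by (rule emeasure_distr[OF Complex_measurable_lborel N(2), symmetric])
  also have "\<dots> = 0" using N(3) lborel_complex_prod by simp
  finally have null: "N' \<in> null_sets (lborel \<Otimes>\<^sub>M lborel)"
    using N'_sets by auto
  then have AE: "AE p in lborel \<Otimes>\<^sub>M lborel. p \<notin> N'" by (rule AE_not_in)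
  have sub: "P (Complex s t)" if "(s, t) \<notin> N'" for s t
    using that N(1) by (auto simp: N'_def space_pair_measure)
  show "AE s in lborel. AE t in lborel. P (Complex s t)"
    using lborel_pair.AE_pair[OF AE] by eventually_elim (auto elim!: eventually_mono intro: sub)
  have "AE p in distr (lborel \<Otimes>\<^sub>M lborel) (lborel \<Otimes>\<^sub>M lborel) (\<lambda>(x, y). (y, x)). p \<notin> N'"
    by (subst lborel_pair.distr_pair_swap[symmetric]) (rule AE)
  note this = AE_distrD[OF measurable_pair_swap' this]
  from lborel_pair.AE_pair[OF this]
  show "AE t in lborel. AE s in lborel. P (Complex s t)"
    by eventually_elim (auto elim!: eventually_mono intro: sub)
qed

lemma mem_cbox_Complex:
  "Complex s t \<in> cbox (Complex a c) (Complex b d) \<longleftrightarrow> s \<in> {a..b} \<and> t \<in> {c..d}"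
  by (auto simp: cbox_def Basis_complex_def)

text \<open>The inner integral is prescribed on almost every line only, by a continuous function
  \<open>F\<close>. The map \<open>l\<close> is \<open>Complex\<close> with its arguments in either
  order, so that both orders of integration are served.\<close>

lemma iterated_integral_box:
  fixes f g :: "complex \<Rightarrow> complex" and l :: "real \<Rightarrow> real \<Rightarrow> complex"
  assumes g: "\<And>s t. g (l s t) = (if s \<in> {a..b} \<and> t \<in> {c..d} then f (l s t) else 0)"
    and inner: "AE t in lborel. integrable lborel (\<lambda>s. g (l s t))"
    and outer: "integrable lborel (\<lambda>t. LINT s|lborel. g (l s t))"
    and F: "AE t in lborel. t \<in> {c..d} \<longrightarrow> ((\<lambda>s. f (l s t)) has_integral F t) {a..b}"
    and cont: "continuous_on {c..d} F"
  shows "(LINT t|lborel. LINT s|lborel. g (l s t)) = integral {c..d} F"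
proof -
  have "(LINT t|lborel. LINT s|lborel. g (l s t)) = (LINT t|lborel. indicator {c..d} t *\<^sub>R F t)"
  proof (rule integral_cong_AE)
    show "(\<lambda>t. LINT s|lborel. g (l s t)) \<in> borel_measurable lborel"
      using outer by simp
    show "(\<lambda>t. indicator {c..d} t *\<^sub>R F t) \<in> borel_measurable lborel"
      using borel_measurable_continuous_on_indicator[OF _ cont] by simp
    show "AE t in lborel. (LINT s|lborel. g (l s t)) = indicator {c..d} t *\<^sub>R F t"
      using F inner
    proof eventually_elim
      fix t assume F: "t \<in> {c..d} \<longrightarrow> ((\<lambda>s. f (l s t)) has_integral F t) {a..b}"
        and i: "integrable lborel (\<lambda>s. g (l s t))"
      show "(LINT s|lborel. g (l s t)) = indicator {c..d} t *\<^sub>R F t"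
      proof (cases "t \<in> {c..d}")
        case True
        then have eq: "g (l s t) = indicator {a..b} s *\<^sub>R f (l s t)" for s
          by (simp add: g indicator_def)
        have "set_integrable lborel {a..b} (\<lambda>s. f (l s t))"
          using i unfolding eq set_integrable_def .
        from set_borel_integral_eq_integral(2)[OF this] F True show ?thesis
          by (simp add: eq set_lebesgue_integral_def integral_unique)
      next
        case False
        then have "g (l s t) = 0" for s unfolding g by (subst if_not_P) auto
        then show ?thesis using False by simp
      qed
    qed
  qed
  also have "\<dots> = integral {c..d} F"
  proof -
    have "set_integrable lborel {c..d} F"
      by (rule borel_integrable_atLeastAtMost') (rule cont)
    from set_borel_integral_eq_integral(2)[OF this] show ?thesis
      by (simp add: set_lebesgue_integral_def)
  qed
  finally show ?thesis .
qed

lemma integral_box_complex: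
  fixes f :: "complex \<Rightarrow> complex"
  assumes int: "set_integrable lborel (cbox (Complex a c) (Complex b d)) f"
  shows "AE t in lborel. t \<in> {c..d} \<longrightarrow> ((\<lambda>s. f (Complex s t)) has_integral F t) {a..b} \<Longrightarrow>
      continuous_on {c..d} F \<Longrightarrow> (LINT z:cbox (Complex a c) (Complex b d)|lborel. f z) = integral {c..d} F"
    and "AE s in lborel. s \<in> {a..b} \<longrightarrow> ((\<lambda>t. f (Complex s t)) has_integral F s) {c..d} \<Longrightarrow>
      continuous_on {a..b} F \<Longrightarrow> (LINT z:cbox (Complex a c) (Complex b d)|lborel. f z) = integral {a..b} F"
proof -
  let ?Q = "cbox (Complex a c) (Complex b d)"
  define g where "g = (\<lambda>z. indicator ?Q z *\<^sub>R f z)"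
  have g: "integrable lborel g" using int by (simp add: set_integrable_def g_def)
  note g2 = integrable_lborel_complex_prod(1)[OF g]
  have eq: "(LINT z:?Q|lborel. f z) = integral\<^sup>L (lborel \<Otimes>\<^sub>M lborel) (\<lambda>(x, y). g (Complex x y))"
    using integrable_lborel_complex_prod(2)[OF g] by (simp add: g_def set_lebesgue_integral_def)
  show "(LINT z:?Q|lborel. f z) = integral {c..d} F"
    if F: "AE t in lborel. t \<in> {c..d} \<longrightarrow> ((\<lambda>s. f (Complex s t)) has_integral F t) {a..b}" "continuous_on {c..d} F"
    unfolding eq lborel_pair.integral_snd[OF g2, symmetric]
    by (rule iterated_integral_box[OF _ lborel_pair.AE_integrable_snd[OF g2] lborel_pair.integrable_snd[OF g2] F])
      (auto simp: g_def mem_cbox_Complex)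
  show "(LINT z:?Q|lborel. f z) = integral {a..b} F"
    if F: "AE s in lborel. s \<in> {a..b} \<longrightarrow> ((\<lambda>t. f (Complex s t)) has_integral F s) {c..d}" "continuous_on {a..b} F"
    unfolding eq lborel_pair.integral_fst[OF g2, symmetric]
    by (rule iterated_integral_box[where l="\<lambda>t s. Complex s t",
          OF _ lborel_pair.AE_integrable_fst[OF g2] lborel_pair.integrable_fst[OF g2] F])
      (auto simp: g_def mem_cbox_Complex)
qed

text \<open>This is -i times the contour integral of \<open>u\<close> dz, taken counterclockwise
  around the square with half side \<open>R\<close>.\<close>

definition box_boundary_integral :: "real \<Rightarrow> (complex \<Rightarrow> complex) \<Rightarrow> complex" where
  "box_boundary_integral R u =
     integral {-R..R} (\<lambda>t. u (Complex R t) - u (Complex (-R) t))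
     + \<i> * integral {-R..R} (\<lambda>s. u (Complex s R) - u (Complex s (-R)))"

lemma continuous_on_Complex [continuous_intros]:
  "continuous_on S f \<Longrightarrow> continuous_on S g \<Longrightarrow> continuous_on S (\<lambda>x. Complex (f x) (g x))"
  by (simp add: Complex_eq continuous_intros)

text \<open>The integrand \<open>ux + \<i> * uy\<close> is twice the derivative with respect to cnj
  z. Newton-Leibniz is assumed on almost every line only, so the theorem covers both C1 functions
  and functions absolutely continuous on lines.\<close>

theorem Green_square:
  fixes u ux uy :: "complex \<Rightarrow> complex"
  assumes int: "set_integrable lborel (cbox (Complex (-R) (-R)) (Complex R R)) ux"
      "set_integrable lborel (cbox (Complex (-R) (-R)) (Complex R R)) uy"
    and x: "AE t in lborel. t \<in> {-R..R} \<longrightarrow>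
       ((\<lambda>s. ux (Complex s t)) has_integral (u (Complex R t) - u (Complex (-R) t))) {-R..R}"
    and y: "AE s in lborel. s \<in> {-R..R} \<longrightarrow>
       ((\<lambda>t. uy (Complex s t)) has_integral (u (Complex s R) - u (Complex s (-R)))) {-R..R}"
    and cont: "continuous_on UNIV u"
  shows "(LINT z:cbox (Complex (-R) (-R)) (Complex R R)|lborel. ux z + \<i> * uy z) = box_boundary_integral R u"
proof -
  have c: "continuous_on {-R..R} (\<lambda>t. u (Complex R t) - u (Complex (-R) t))"
     "continuous_on {-R..R} (\<lambda>s. u (Complex s R) - u (Complex s (-R)))"
    by (intro continuous_intros continuous_on_compose2[OF cont]; simp)+
  have "(LINT z:cbox (Complex (-R) (-R)) (Complex R R)|lborel. ux z + \<i> * uy z)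
    = (LINT z:cbox (Complex (-R) (-R)) (Complex R R)|lborel. ux z)
      + (LINT z:cbox (Complex (-R) (-R)) (Complex R R)|lborel. \<i> * uy z)"
    by (rule set_integral_add) (use int in auto)
  then show ?thesis
    unfolding box_boundary_integral_def
    using integral_box_complex(1)[OF int(1) x c(1)] integral_box_complex(2)[OF int(2) y c(2)] by simp
qed

section \<open>The exterior conformal map\<close>

lemma power_series_at_0:
  fixes f :: "complex \<Rightarrow> complex"
  assumes "r > 0" and sums: "\<And>w. norm w < r \<Longrightarrow> (\<lambda>n. c n * w ^ n) sums f w"
  shows "f holomorphic_on ball 0 r" and "(deriv ^^ n) f 0 / fact n = c n"
proof -
  show "f holomorphic_on ball 0 r"
    by (rule power_series_holomorphic[of 0 r c]) (use sums in simp)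
  have "f has_fps_expansion Abs_fps c"
  proof (rule has_fps_expansionI)
    have "eventually (\<lambda>u. u \<in> ball 0 r) (nhds (0::complex))"
      using \<open>r > 0\<close> by (intro eventually_nhds_in_open) auto
    then show "\<forall>\<^sub>F u in nhds 0. (\<lambda>n. fps_nth (Abs_fps c) n * u ^ n) sums f u"
      by eventually_elim (use sums in simp)
  qed
  from fps_nth_fps_expansion[OF this, of n] show "(deriv ^^ n) f 0 / fact n = c n"
    by simp
qed

locale exterior_map =
  fixes G :: "complex set" and \<gamma> :: real and \<Phi> \<Psi> :: "complex \<Rightarrow> complex" and b :: "nat \<Rightarrow> complex"
  assumes bounded_G: "bounded G"
    and ext: "exterior_conformal_map G \<gamma> \<Phi>"
    and Psi: "\<And>w. norm w > 1 \<Longrightarrow> \<Psi> w = inv_into (- closure G) \<Phi> w"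
    and Laurent: "\<And>w. norm w > 1 \<Longrightarrow> (\<lambda>j. b j / w ^ j) sums (\<Psi> w - of_real (1 / \<gamma>) * w)"
begin

definition "Om = - closure G"

lemma open_Om: "open Om" unfolding Om_def by (rule open_Compl) simp

lemma gamma_pos: "\<gamma> > 0" and holo_Phi: "\<Phi> holomorphic_on Om"
  and bij_Phi: "bij_betw \<Phi> Om {w. norm w > 1}"
  using ext by (auto simp: exterior_conformal_map_def Om_def)

lemma inj_Phi: "inj_on \<Phi> Om" and Phi_gt_1: "z \<in> Om \<Longrightarrow> norm (\<Phi> z) > 1"
  using bij_Phi by (auto simp: bij_betw_def)

lemma Psi_in_Om: "norm w > 1 \<Longrightarrow> \<Psi> w \<in> Om" and Phi_Psi: "norm w > 1 \<Longrightarrow> \<Phi> (\<Psi> w) = w"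
proof -
  assume w: "norm w > 1"
  then have "w \<in> \<Phi> ` Om" using bij_Phi by (auto simp: bij_betw_def)
  then show "\<Psi> w \<in> Om" "\<Phi> (\<Psi> w) = w"
    unfolding Psi[OF w] Om_def[symmetric] by (auto intro: inv_into_into f_inv_into_f)
qed

lemma Psi_Phi: "z \<in> Om \<Longrightarrow> \<Psi> (\<Phi> z) = z"
  using Psi[OF Phi_gt_1] inv_into_f_f[OF inj_Phi] unfolding Om_def by simp

lemma open_outer_disc: "open {w::complex. norm w > r}"
  by (intro open_Collect_less continuous_intros)

lemma holo_Psi: "\<Psi> holomorphic_on {w. norm w > 1}"
proof -
  obtain g where g: "g holomorphic_on (\<Phi> ` Om)" "\<And>z. z \<in> Om \<Longrightarrow> g (\<Phi> z) = z"
    using holomorphic_has_inverse[OF holo_Phi open_Om inj_Phi] by metis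
  have im: "\<Phi> ` Om = {w. norm w > 1}" using bij_Phi by (simp add: bij_betw_def)
  have "g w = \<Psi> w" if "w \<in> {w. norm w > 1}" for w
    using g(2)[OF Psi_in_Om] Phi_Psi that by auto
  with g(1) show ?thesis unfolding im by (rule holomorphic_transform)
qed

text \<open>The part of \<open>\<Psi>\<close> that is regular at infinity, in the coordinate 1/w.
  The value \<open>b 0\<close> at the origin fills the removable singularity.\<close>

definition "B \<zeta> = (if \<zeta> = 0 then b 0 else \<Psi> (1 / \<zeta>) - of_real (1 / \<gamma>) / \<zeta>)"

lemma B_sums: assumes "norm \<zeta> < 1" shows "(\<lambda>j. b j * \<zeta> ^ j) sums B \<zeta>"
proof (cases "\<zeta> = 0")
  case True
  then show ?thesis using powser_sums_zero[of b] by (simp add: B_def)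
next
  case False
  then have "norm (1 / \<zeta>) > 1" using assms by (simp add: norm_divide)
  from Laurent[OF this] False show ?thesis
    by (simp add: B_def power_divide)
qed

lemma holo_B: "B holomorphic_on ball 0 1" and B_coeff: "(deriv ^^ n) B 0 / fact n = b n"
  using power_series_at_0[OF zero_less_one B_sums] by simp_all

lemma Psi_conv_B: "norm w > 1 \<Longrightarrow> \<Psi> w = w / of_real \<gamma> + B (1 / w)"
  by (auto simp: B_def)

lemma B_bounded: obtains C where "C > 0" "\<And>\<zeta>. norm \<zeta> \<le> 1/2 \<Longrightarrow> norm (B \<zeta>) \<le> C"
proof -
  have "continuous_on (cball 0 (1/2)) B"
    by (rule holomorphic_on_imp_continuous_on[OF holomorphic_on_subset[OF holo_B]]) auto
  then have "compact (B ` cball 0 (1/2))" by (rule compact_continuous_image) simp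
  then obtain C where "C > 0" "\<forall>x\<in>B ` cball 0 (1/2). norm x \<le> C"
    using compact_imp_bounded bounded_pos by metis
  then show thesis by (intro that[of C]) auto
qed

lemma Psi_growth: obtains C where "C > 0" "\<And>w. norm w \<ge> 2 \<Longrightarrow> norm (\<Psi> w - w / of_real \<gamma>) \<le> C"
proof -
  obtain C where C: "C > 0" "\<And>\<zeta>. norm \<zeta> \<le> 1/2 \<Longrightarrow> norm (B \<zeta>) \<le> C" using B_bounded by blast
  show thesis
  proof (rule that[OF C(1)])
    fix w :: complex assume w: "norm w \<ge> 2"
    then have "1 / norm w \<le> 1/2" by (intro frac_le) auto
    then have "norm (1 / w) \<le> 1/2" by (simp add: norm_divide)
    from C(2)[OF this] show "norm (\<Psi> w - w / of_real \<gamma>) \<le> C"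
      using Psi_conv_B[of w] w by simp
  qed
qed

lemma expansion_at_infinity:
  obtains h R where "R > 1" "h holomorphic_on ball 0 (1 / R)"
    "\<And>z. norm z > R \<Longrightarrow> z \<in> Om \<and> \<Phi> z = of_real \<gamma> * z + h (1 / z)"
proof -
  obtain R0 c where c: "\<And>z. norm z > R0 \<Longrightarrow> (\<lambda>j. c j / z ^ j) sums (\<Phi> z - of_real \<gamma> * z)"
    using ext unfolding exterior_conformal_map_def by blast
  obtain R1 where R1: "\<And>z. z \<in> closure G \<Longrightarrow> norm z \<le> R1"
    using bounded_closure[OF bounded_G] by (meson bounded_iff)
  define R where "R = max (max R0 R1) 2"
  have R: "R > 1" "R \<ge> R0" "R \<ge> R1" by (auto simp: R_def)
  define h where "h \<zeta> = (if \<zeta> = 0 then c 0 else \<Phi> (1 / \<zeta>) - of_real \<gamma> / \<zeta>)" for \<zeta>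
  have sums: "(\<lambda>j. c j * \<zeta> ^ j) sums h \<zeta>" if "norm \<zeta> < 1 / R" for \<zeta>
  proof (cases "\<zeta> = 0")
    case True
    then show ?thesis using powser_sums_zero[of c] by (simp add: h_def)
  next
    case False
    then have "R < 1 / norm \<zeta>"
      using that R by (simp add: field_simps)
    then have "norm (1 / \<zeta>) > R0"
      using R(2) by (simp add: norm_divide)
    from c[OF this] False show ?thesis
      by (simp add: h_def power_divide)
  qed
  have "h holomorphic_on ball 0 (1 / R)"
    using power_series_at_0(1)[OF _ sums] R by simp
  moreover have "z \<in> Om \<and> \<Phi> z = of_real \<gamma> * z + h (1 / z)" if "norm z > R" for z
  proof -
    have "z \<noteq> 0" using that R by auto
    then show ?thesis using R1[of z] that R by (auto simp: Om_def h_def)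
  qed
  ultimately show thesis using R(1) by (intro that[of R h])
qed

text \<open>Near infinity \<open>\<Phi>\<close> differs from \<gamma> z by a bounded amount, so a
  bound on |\<Phi>| bounds |z|.\<close>

lemma bounded_inner: "bounded {z \<in> Om. norm (\<Phi> z) \<le> r}"
proof -
  obtain h R where h: "R > 1" "h holomorphic_on ball 0 (1 / R)"
    "\<And>z. norm z > R \<Longrightarrow> z \<in> Om \<and> \<Phi> z = of_real \<gamma> * z + h (1 / z)"
    using expansion_at_infinity by blast
  have "continuous_on (cball 0 (1 / (2 * R))) h"
    by (rule holomorphic_on_imp_continuous_on[OF holomorphic_on_subset[OF h(2)]]) (use h(1) in \<open>auto simp: field_simps\<close>)
  then have "compact (h ` cball 0 (1 / (2 * R)))" by (rule compact_continuous_image) simp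
  then obtain D where D: "\<And>\<zeta>. norm \<zeta> \<le> 1 / (2 * R) \<Longrightarrow> norm (h \<zeta>) \<le> D"
    by (metis (no_types, lifting) bounded_pos compact_imp_bounded imageI mem_cball_0)
  have "norm z \<le> max (2 * R) ((r + D) / \<gamma>)" if z: "z \<in> Om" "norm (\<Phi> z) \<le> r" for z
  proof (cases "norm z \<le> 2 * R")
    case False
    then have zR: "norm z > R" "norm (1 / z) \<le> 1 / (2 * R)" using h(1)
      by (auto simp: norm_divide frac_le)
    have "\<gamma> * norm z = norm (\<Phi> z - h (1 / z))"
      using h(3)[OF zR(1)] gamma_pos by (simp add: norm_mult)
    also have "\<dots> \<le> r + D"
      using D[OF zR(2)] z(2) norm_triangle_ineq4[of "\<Phi> z" "h (1 / z)"] by linarith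
    finally have "norm z \<le> (r + D) / \<gamma>" using gamma_pos by (simp add: field_simps)
    then show ?thesis by simp
  qed simp
  then show ?thesis unfolding bounded_iff by blast
qed

text \<open>Closed in the whole plane, not merely relative to \<open>Om\<close>: a convergent
  sequence in the set lies in the image under \<open>\<Psi>\<close> of a compact annulus. Hence the
  set keeps away from the boundary of \<open>G\<close>, and functions supported in it extend by
  zero.\<close>

lemma closed_outer: assumes r: "r > 1" shows "closed {z \<in> Om. norm (\<Phi> z) \<ge> r}"
  unfolding closed_sequential_limits
proof (intro allI impI)
  fix x l assume x: "(\<forall>n. x n \<in> {z \<in> Om. norm (\<Phi> z) \<ge> r}) \<and> x \<longlonglongrightarrow> l"
  obtain C where C: "C > 0" "\<And>w. norm w \<ge> 2 \<Longrightarrow> norm (\<Psi> w - w / of_real \<gamma>) \<le> C"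
    using Psi_growth by blast
  have "bounded (range x)" using x convergent_imp_bounded by blast
  then obtain D where D: "\<And>n. norm (x n) \<le> D" by (meson bounded_iff rangeI)
  \<comment> \<open>Since \<open>\<Psi> w\<close> stays within \<open>C\<close> of w / \<gamma> for
    large w, a bound on the points \<open>x n\<close> forces a bound on their images under
    \<open>\<Phi>\<close>.\<close>
  define M where "M = max 2 (\<gamma> * (D + C))"
  have M: "norm (\<Phi> (x n)) \<le> M" for n
  proof (rule ccontr)
    assume "\<not> ?thesis"
    then have gt: "norm (\<Phi> (x n)) > 2" "norm (\<Phi> (x n)) > \<gamma> * (D + C)" by (auto simp: M_def)
    have "norm (\<Phi> (x n)) / \<gamma> = norm (x n - (x n - \<Phi> (x n) / of_real \<gamma>))"
      using gamma_pos by (simp add: norm_divide)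
    also have "\<dots> \<le> D + C"
      using D[of n] C(2)[of "\<Phi> (x n)"] gt(1) Psi_Phi[of "x n"] x
        norm_triangle_ineq4[of "x n" "x n - \<Phi> (x n) / of_real \<gamma>"] by auto
    finally show False using gt(2) gamma_pos by (simp add: field_simps)
  qed
  define A where "A = cball 0 M - ball (0::complex) r"
  have A: "compact A" unfolding A_def by (intro compact_diff) auto
  have A1: "w \<in> A \<Longrightarrow> norm w > 1" for w using r by (auto simp: A_def)
  have "continuous_on A \<Psi>"
    by (rule holomorphic_on_imp_continuous_on[OF holomorphic_on_subset[OF holo_Psi]]) (use A1 in auto)
  then have "compact (\<Psi> ` A)" using A by (rule compact_continuous_image)
  then have "closed (\<Psi> ` A)" by (rule compact_imp_closed)
  moreover have "x n \<in> \<Psi> ` A" for n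
  proof (rule image_eqI[of _ _ "\<Phi> (x n)"])
    have xn: "x n \<in> Om" "norm (\<Phi> (x n)) \<ge> r" using x by auto
    show "x n = \<Psi> (\<Phi> (x n))" using Psi_Phi[OF xn(1)] by simp
    show "\<Phi> (x n) \<in> A" using xn(2) M[of n] by (simp add: A_def)
  qed
  ultimately have "l \<in> \<Psi> ` A"
    using x closed_sequentially by blast
  then show "l \<in> {z \<in> Om. norm (\<Phi> z) \<ge> r}"
    using A1 Psi_in_Om Phi_Psi by (auto simp: A_def)
qed

end

section \<open>A cutoff along the level curves of the conformal map\<close>

lemma has_real_derivative_square_pos_part:
  "((\<lambda>t::real. (max 0 t)\<^sup>2) has_real_derivative 2 * max 0 t) (at t)"
proof -
  consider "t < 0" | "t > 0" | "t = 0" by linarith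
  then show ?thesis
  proof cases
    case 1
    have "((\<lambda>t::real. 0) has_real_derivative 2 * max 0 t) (at t)" using 1 by simp
    then show ?thesis
      by (rule has_field_derivative_transform_within_open[where S="{..<0}"]) (use 1 in auto)
  next
    case 2
    have "((\<lambda>t::real. t\<^sup>2) has_real_derivative 2 * max 0 t) (at t)"
      using 2 by (auto intro!: derivative_eq_intros)
    then show ?thesis
      by (rule has_field_derivative_transform_within_open[where S="{0<..}"]) (use 2 in auto)
  next
    case 3
    have "((\<lambda>h::real. max 0 h * max 0 h / h) \<longlongrightarrow> 0) (at 0)"
    proof (rule Lim_null_comparison)
      show "\<forall>\<^sub>F h in at (0::real). norm (max 0 h * max 0 h / h) \<le> \<bar>h\<bar>"
        by (intro always_eventually allI) (auto simp: max_def)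
      show "((\<lambda>h::real. \<bar>h\<bar>) \<longlongrightarrow> 0) (at 0)"
        by (rule tendsto_rabs_zero) simp
    qed
    then show ?thesis using 3 by (simp add: has_field_derivative_iff power2_eq_square)
  qed
qed

text \<open>A quadratic spline with knots \<sigma>, 3\<sigma>/2 and 2\<sigma>, rising from 0 to 1.
  Its derivative is a tent function, so it is continuously differentiable, which is the smoothness
  that Green's formula asks of the cutoff.\<close>

definition smooth_step :: "real \<Rightarrow> real \<Rightarrow> real" where
  "smooth_step \<sigma> s = (let t = (s - \<sigma>) / \<sigma> in
     2 * ((max 0 t)\<^sup>2 - 2 * (max 0 (t - 1/2))\<^sup>2 + (max 0 (t - 1))\<^sup>2))"

definition smooth_step' :: "real \<Rightarrow> real \<Rightarrow> real" where
  "smooth_step' \<sigma> s = (let t = (s - \<sigma>) / \<sigma> in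
     4 * (max 0 t - 2 * max 0 (t - 1/2) + max 0 (t - 1)) / \<sigma>)"

lemma smooth_step_deriv:
  assumes "\<sigma> > 0"
  shows "(smooth_step \<sigma> has_real_derivative smooth_step' \<sigma> s) (at s)"
proof -
  have q: "((\<lambda>s. (max 0 ((s - \<sigma>) / \<sigma> - c))\<^sup>2) has_real_derivative
      2 * max 0 ((s - \<sigma>) / \<sigma> - c) * (1 / \<sigma>)) (at s)" for c
    by (rule DERIV_chain2[OF has_real_derivative_square_pos_part])
      (use assms in \<open>auto intro!: derivative_eq_intros\<close>)
  have "((\<lambda>s. 2 * ((max 0 ((s - \<sigma>) / \<sigma> - 0))\<^sup>2 - 2 * (max 0 ((s - \<sigma>) / \<sigma> - 1/2))\<^sup>2
        + (max 0 ((s - \<sigma>) / \<sigma> - 1))\<^sup>2)) has_real_derivative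
      2 * (2 * max 0 ((s - \<sigma>) / \<sigma> - 0) * (1 / \<sigma>) - 2 * (2 * max 0 ((s - \<sigma>) / \<sigma> - 1/2) * (1 / \<sigma>))
        + 2 * max 0 ((s - \<sigma>) / \<sigma> - 1) * (1 / \<sigma>))) (at s)"
    by (intro DERIV_cmult DERIV_add DERIV_diff q)
  moreover have "2 * (2 * max 0 ((s - \<sigma>) / \<sigma> - 0) * (1 / \<sigma>) - 2 * (2 * max 0 ((s - \<sigma>) / \<sigma> - 1/2) * (1 / \<sigma>))
        + 2 * max 0 ((s - \<sigma>) / \<sigma> - 1) * (1 / \<sigma>)) = smooth_step' \<sigma> s"
    unfolding smooth_step'_def Let_def diff_0_right by (simp add: algebra_simps add_divide_distrib diff_divide_distrib)
  ultimately show ?thesis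
    unfolding smooth_step_def Let_def diff_0_right by simp
qed

lemma smooth_step'_cont: "continuous_on A (smooth_step' \<sigma>)"
proof (cases "\<sigma> = 0")
  case True
  then show ?thesis by (simp add: smooth_step'_def Let_def)
next
  case False
  then show ?thesis
    unfolding smooth_step'_def Let_def by (intro continuous_intros) auto
qed

lemma smooth_step'_nonneg: "\<sigma> > 0 \<Longrightarrow> smooth_step' \<sigma> s \<ge> 0"
proof -
  assume "\<sigma> > 0"
  moreover have "max 0 t - 2 * max 0 (t - 1/2) + max 0 (t - 1) \<ge> 0" for t :: real
    by (simp add: max_def)
  ultimately show ?thesis
    unfolding smooth_step'_def Let_def by (intro divide_nonneg_pos mult_nonneg_nonneg) auto
qed

lemma smooth_step'_zero:
  assumes "\<sigma> > 0" "s \<le> \<sigma> \<or> s \<ge> 2 * \<sigma>" shows "smooth_step' \<sigma> s = 0"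
proof -
  have "(s - \<sigma>) / \<sigma> \<le> 0 \<or> (s - \<sigma>) / \<sigma> \<ge> 1" using assms by (auto simp: field_simps)
  moreover have "max 0 t - 2 * max 0 (t - 1/2) + max 0 (t - 1) = 0" if "t \<le> 0 \<or> t \<ge> 1" for t :: real
    using that by (auto simp: max_def)
  ultimately show ?thesis unfolding smooth_step'_def Let_def by simp
qed

lemma smooth_step_0: assumes "\<sigma> > 0" "s \<le> \<sigma>" shows "smooth_step \<sigma> s = 0"
proof -
  have "(s - \<sigma>) / \<sigma> \<le> 0" using assms by (auto simp: field_simps)
  moreover have "(max 0 t)\<^sup>2 - 2 * (max 0 (t - 1/2))\<^sup>2 + (max 0 (t - 1))\<^sup>2 = 0" if "t \<le> 0" for t :: real
    using that by (auto simp: max_def)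
  ultimately show ?thesis unfolding smooth_step_def Let_def by simp
qed

lemma smooth_step_1: assumes "\<sigma> > 0" "s \<ge> 2 * \<sigma>" shows "smooth_step \<sigma> s = 1"
proof -
  have "(s - \<sigma>) / \<sigma> \<ge> 1" using assms by (auto simp: field_simps)
  moreover have "2 * ((max 0 t)\<^sup>2 - 2 * (max 0 (t - 1/2))\<^sup>2 + (max 0 (t - 1))\<^sup>2) = 1" if "t \<ge> 1" for t :: real
    using that by (simp add: max_def power2_eq_square algebra_simps)
  ultimately show ?thesis unfolding smooth_step_def Let_def by blast
qed

lemma smooth_step_mono: "\<sigma> > 0 \<Longrightarrow> s \<le> t \<Longrightarrow> smooth_step \<sigma> s \<le> smooth_step \<sigma> t"
  by (rule DERIV_nonneg_imp_nondecreasing[of s t]) (auto intro: smooth_step_deriv smooth_step'_nonneg)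

lemma smooth_step_range: assumes "\<sigma> > 0" shows "smooth_step \<sigma> s \<in> {0..1}"
  using smooth_step_mono[OF assms, of "min s \<sigma>" s] smooth_step_0[OF assms, of "min s \<sigma>"]
    smooth_step_mono[OF assms, of s "max s (2 * \<sigma>)"] smooth_step_1[OF assms, of "max s (2 * \<sigma>)"] by auto

lemma smooth_step'_integral:
  assumes "\<sigma> > 0" shows "(smooth_step' \<sigma> has_integral 1) {\<sigma>..2 * \<sigma>}"
proof -
  have "(smooth_step' \<sigma> has_integral smooth_step \<sigma> (2 * \<sigma>) - smooth_step \<sigma> \<sigma>) {\<sigma>..2 * \<sigma>}"
    by (rule fundamental_theorem_of_calculus)
      (use assms smooth_step_deriv in \<open>auto simp flip: has_real_derivative_iff_has_vector_derivative
         intro: has_field_derivative_at_within\<close>)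
  then show ?thesis using assms by (simp add: smooth_step_0 smooth_step_1)
qed

text \<open>\<open>smooth_step'\<close> is a probability density on [\<sigma>, 2\<sigma>], so the
  integral is an average and inherits uniform bounds.\<close>

lemma smooth_step_average_bound:
  fixes I :: "real \<Rightarrow> complex"
  assumes \<sigma>: "\<sigma> > 0" and I: "continuous_on {\<sigma>..2 * \<sigma>} I"
  shows "(\<And>s. s \<in> {\<sigma>..2 * \<sigma>} \<Longrightarrow> norm (I s) \<le> M) \<Longrightarrow>
           norm (integral {\<sigma>..2 * \<sigma>} (\<lambda>s. smooth_step' \<sigma> s *\<^sub>R I s)) \<le> M"
    and "(\<And>s. s \<in> {\<sigma>..2 * \<sigma>} \<Longrightarrow> Re (I s) \<le> M) \<Longrightarrow>
           Re (integral {\<sigma>..2 * \<sigma>} (\<lambda>s. smooth_step' \<sigma> s *\<^sub>R I s)) \<le> M"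
proof -
  have int: "(\<lambda>s. smooth_step' \<sigma> s *\<^sub>R I s) integrable_on {\<sigma>..2 * \<sigma>}"
    by (intro integrable_continuous_real continuous_intros smooth_step'_cont I)
  have M: "((\<lambda>s. smooth_step' \<sigma> s * M) has_integral M) {\<sigma>..2 * \<sigma>}"
    using has_integral_mult_left[OF smooth_step'_integral[OF \<sigma>], of M] by simp
  show "norm (integral {\<sigma>..2 * \<sigma>} (\<lambda>s. smooth_step' \<sigma> s *\<^sub>R I s)) \<le> M"
    if "\<And>s. s \<in> {\<sigma>..2 * \<sigma>} \<Longrightarrow> norm (I s) \<le> M"
  proof -
    have "norm (integral {\<sigma>..2 * \<sigma>} (\<lambda>s. smooth_step' \<sigma> s *\<^sub>R I s))
        \<le> integral {\<sigma>..2 * \<sigma>} (\<lambda>s. smooth_step' \<sigma> s * M)"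
      by (rule integral_norm_bound_integral[OF int has_integral_integrable[OF M]])
        (use that smooth_step'_nonneg[OF \<sigma>] in \<open>auto intro!: mult_left_mono\<close>)
    then show ?thesis unfolding integral_unique[OF M] .
  qed
  show "Re (integral {\<sigma>..2 * \<sigma>} (\<lambda>s. smooth_step' \<sigma> s *\<^sub>R I s)) \<le> M"
    if "\<And>s. s \<in> {\<sigma>..2 * \<sigma>} \<Longrightarrow> Re (I s) \<le> M"
  proof -
    have R: "((\<lambda>s. smooth_step' \<sigma> s * Re (I s)) has_integral
        Re (integral {\<sigma>..2 * \<sigma>} (\<lambda>s. smooth_step' \<sigma> s *\<^sub>R I s))) {\<sigma>..2 * \<sigma>}"
      using has_integral_linear[OF integrable_integral[OF int] bounded_linear_Re] by (simp add: o_def)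
    show ?thesis
      by (rule has_integral_le[OF R M]) (use that smooth_step'_nonneg[OF \<sigma>] in \<open>auto intro!: mult_left_mono\<close>)
  qed
qed

section \<open>The cutoff as a function of ln |\<Phi>| and its gradient\<close>

context exterior_map
begin

definition "cutoff \<sigma> z = (if z \<in> Om then smooth_step \<sigma> (ln (norm (\<Phi> z))) else 0)"

text \<open>The gradient written as a complex number, which is also twice the derivative of the real
  function with respect to cnj z. The gradient of ln |\<Phi>| is the conjugate of the logarithmic
  derivative of \<open>\<Phi>\<close>.\<close>

definition "cutoff_grad \<sigma> z =
  (if z \<in> Om then smooth_step' \<sigma> (ln (norm (\<Phi> z))) *\<^sub>R cnj (deriv \<Phi> z / \<Phi> z) else 0)"

lemma Phi_field_derivative: "z \<in> Om \<Longrightarrow> (\<Phi> has_field_derivative deriv \<Phi> z) (at z)"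
  using holo_Phi open_Om by (rule holomorphic_derivI)

lemma Phi_nonzero: "z \<in> Om \<Longrightarrow> \<Phi> z \<noteq> 0"
  using Phi_gt_1 by fastforce

lemma collar_zero:
  assumes \<sigma>: "\<sigma> > 0" and z: "z \<notin> {z \<in> Om. norm (\<Phi> z) \<ge> exp \<sigma>}"
  shows "cutoff \<sigma> z = 0" "cutoff_grad \<sigma> z = 0"
proof -
  have "ln (norm (\<Phi> z)) \<le> \<sigma>" if "z \<in> Om"
  proof -
    have "norm (\<Phi> z) < exp \<sigma>" "norm (\<Phi> z) > 0" using z that Phi_gt_1[of z] by auto
    then show ?thesis by (metis ln_exp ln_le_cancel_iff exp_gt_zero less_imp_le)
  qed
  then show "cutoff \<sigma> z = 0" "cutoff_grad \<sigma> z = 0"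
    by (auto simp: cutoff_def cutoff_grad_def smooth_step_0[OF \<sigma>] smooth_step'_zero[OF \<sigma>])
qed

lemma cutoff_one:
  assumes \<sigma>: "\<sigma> > 0" and z: "z \<in> Om" "norm (\<Phi> z) \<ge> exp (2 * \<sigma>)"
  shows "cutoff \<sigma> z = 1" "cutoff_grad \<sigma> z = 0"
proof -
  have "ln (norm (\<Phi> z)) \<ge> 2 * \<sigma>" using z(2) Phi_gt_1[OF z(1)]
    by (metis ln_exp ln_le_cancel_iff exp_gt_zero less_trans zero_less_one)
  then show "cutoff \<sigma> z = 1" "cutoff_grad \<sigma> z = 0"
    using z by (auto simp: cutoff_def cutoff_grad_def smooth_step_1[OF \<sigma>] smooth_step'_zero[OF \<sigma>])
qed

lemma cutoff_range: "\<sigma> > 0 \<Longrightarrow> cutoff \<sigma> z \<in> {0..1}"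
  using smooth_step_range by (auto simp: cutoff_def)

lemma cutoff_derivative:
  assumes \<sigma>: "\<sigma> > 0"
  shows "(cutoff \<sigma> has_derivative (\<lambda>v. Re (cnj (cutoff_grad \<sigma> z) * v))) (at z)"
proof (cases "z \<in> Om")
  case True
  note nz = Phi_nonzero[OF True]
  have 1: "(\<Phi> has_derivative (\<lambda>v. deriv \<Phi> z * v)) (at z)"
    using Phi_field_derivative[OF True] by (simp add: has_field_derivative_def)
  have 2: "((\<lambda>z. norm (\<Phi> z)) has_derivative (\<lambda>v. (deriv \<Phi> z * v) \<bullet> sgn (\<Phi> z))) (at z)"
    by (rule has_derivative_compose[OF 1 has_derivative_norm[OF nz]])
  have 3: "((\<lambda>z. ln (norm (\<Phi> z))) has_derivative
      (\<lambda>v. (deriv \<Phi> z * v) \<bullet> sgn (\<Phi> z) * inverse (norm (\<Phi> z)))) (at z)"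
    using has_derivative_ln[OF _ 2] nz by simp
  have 4: "((\<lambda>z. smooth_step \<sigma> (ln (norm (\<Phi> z)))) has_derivative
      (\<lambda>v. smooth_step' \<sigma> (ln (norm (\<Phi> z))) * ((deriv \<Phi> z * v) \<bullet> sgn (\<Phi> z) * inverse (norm (\<Phi> z))))) (at z)"
    by (rule has_derivative_compose[OF 3 smooth_step_deriv[OF \<sigma>, unfolded has_field_derivative_def]])
  have eq: "(deriv \<Phi> z * v) \<bullet> sgn (\<Phi> z) * inverse (norm (\<Phi> z)) = Re (deriv \<Phi> z / \<Phi> z * v)" for v
  proof -
    have "deriv \<Phi> z / \<Phi> z * v = (deriv \<Phi> z * v) * cnj (\<Phi> z) / of_real ((norm (\<Phi> z))\<^sup>2)"
      using nz by (simp add: complex_norm_square field_simps del: of_real_power)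
    then have "Re (deriv \<Phi> z / \<Phi> z * v) = Re ((deriv \<Phi> z * v) * cnj (\<Phi> z)) / (norm (\<Phi> z))\<^sup>2"
      by (simp only: Re_divide_of_real)
    also have "\<dots> = (deriv \<Phi> z * v) \<bullet> sgn (\<Phi> z) * inverse (norm (\<Phi> z))"
      by (simp add: inner_complex_def sgn_div_norm divide_inverse power2_eq_square algebra_simps)
    finally show ?thesis by simp
  qed
  have "(\<lambda>v. Re (cnj (cutoff_grad \<sigma> z) * v)) =
      (\<lambda>v. smooth_step' \<sigma> (ln (norm (\<Phi> z))) * ((deriv \<Phi> z * v) \<bullet> sgn (\<Phi> z) * inverse (norm (\<Phi> z))))"
    unfolding eq using True by (simp add: cutoff_grad_def fun_eq_iff)
  then show ?thesis
    using has_derivative_transform_within_open[OF 4 open_Om True, of "cutoff \<sigma>"] by (simp add: cutoff_def)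
next
  case False
  \<comment> \<open>Outside \<open>Om\<close>, also at frontier points of \<open>G\<close>, the
    complement of this closed set is a neighbourhood on which the cutoff is identically 0.\<close>
  have c: "closed {z \<in> Om. norm (\<Phi> z) \<ge> exp \<sigma>}" using \<sigma> by (intro closed_outer) simp
  have "((\<lambda>_. 0) has_derivative (\<lambda>v. Re (cnj (cutoff_grad \<sigma> z) * v))) (at z)"
    using False by (simp add: cutoff_grad_def)
  then show ?thesis
    by (rule has_derivative_transform_within_open[where s="- {z \<in> Om. norm (\<Phi> z) \<ge> exp \<sigma>}"])
      (use c collar_zero[OF \<sigma>] False in auto)
qed

text \<open>\<open>Om\<close> and the complement of the closed outer set are open and together cover
  the plane; the function is continuous on each.\<close>

lemma continuous_on_UNIV_by_collar:
  fixes f :: "complex \<Rightarrow> 'a::real_normed_vector"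
  assumes \<sigma>: "\<sigma> > 0" and Om: "continuous_on Om f"
    and z: "\<And>z. z \<notin> {z \<in> Om. norm (\<Phi> z) \<ge> exp \<sigma>} \<Longrightarrow> f z = 0"
  shows "continuous_on UNIV f"
proof -
  have c: "open (- {z \<in> Om. norm (\<Phi> z) \<ge> exp \<sigma>})" using \<sigma> by (intro open_Compl closed_outer) simp
  have "continuous_on (- {z \<in> Om. norm (\<Phi> z) \<ge> exp \<sigma>}) f"
    using z by (subst continuous_on_cong[OF refl, of _ f "\<lambda>_. 0"]) auto
  from continuous_on_open_Un[OF open_Om c Om this] show ?thesis
    by (rule continuous_on_subset) auto
qed

lemma continuous_on_deriv_Phi: "continuous_on Om (deriv \<Phi>)" and continuous_on_Phi: "continuous_on Om \<Phi>"
  using holo_Phi holomorphic_deriv[OF holo_Phi open_Om] by (auto intro: holomorphic_on_imp_continuous_on)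

lemma continuous_on_cutoff_grad_Om: "continuous_on Om (cutoff_grad \<sigma>)"
proof -
  have "continuous_on Om (\<lambda>z. smooth_step' \<sigma> (ln (norm (\<Phi> z))) *\<^sub>R cnj (deriv \<Phi> z / \<Phi> z))"
    by (intro continuous_intros continuous_on_compose2[OF smooth_step'_cont[of UNIV]]
        continuous_on_deriv_Phi continuous_on_Phi) (auto simp: Phi_nonzero)
  then show ?thesis by (subst continuous_on_cong[OF refl]) (auto simp: cutoff_grad_def)
qed

lemma continuous_on_cutoff_grad: "\<sigma> > 0 \<Longrightarrow> continuous_on UNIV (cutoff_grad \<sigma>)"
  using continuous_on_UNIV_by_collar[OF _ continuous_on_cutoff_grad_Om] collar_zero(2) by blast

lemma continuous_on_cutoff: "\<sigma> > 0 \<Longrightarrow> continuous_on UNIV (cutoff \<sigma>)"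
  by (rule has_derivative_continuous_on[OF has_derivative_at_withinI[OF cutoff_derivative]])

section \<open>Logarithmic coordinates on the exterior and integration over level curves\<close>

definition "collar \<sigma> = {z \<in> Om. exp \<sigma> \<le> norm (\<Phi> z) \<and> norm (\<Phi> z) \<le> exp (2 * \<sigma>)}"

text \<open>In the coordinate ln \<Phi>, level curves of |\<Phi>| become vertical lines and ln
  |\<Phi>| becomes the real part.\<close>

definition "strip \<zeta> = \<Psi> (exp \<zeta>)"

definition "strip' \<zeta> = deriv \<Psi> (exp \<zeta>) * exp \<zeta>"

lemma strip_facts:
  assumes "Re \<zeta> > 0"
  shows "norm (exp \<zeta>) > 1" "strip \<zeta> \<in> Om" "\<Phi> (strip \<zeta>) = exp \<zeta>"
    "(strip has_field_derivative strip' \<zeta>) (at \<zeta>)"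
    "deriv \<Phi> (strip \<zeta>) / \<Phi> (strip \<zeta>) * strip' \<zeta> = 1"
proof -
  show 1: "norm (exp \<zeta>) > 1" using assms by simp
  show Om: "strip \<zeta> \<in> Om" unfolding strip_def by (rule Psi_in_Om[OF 1])
  show 2: "\<Phi> (strip \<zeta>) = exp \<zeta>" unfolding strip_def by (rule Phi_Psi[OF 1])
  have dPsi: "(\<Psi> has_field_derivative deriv \<Psi> (exp \<zeta>)) (at (exp \<zeta>))"
    by (rule holomorphic_derivI[OF holo_Psi open_outer_disc]) (use 1 in simp)
  show d: "(strip has_field_derivative strip' \<zeta>) (at \<zeta>)"
    unfolding strip_def strip'_def by (rule DERIV_chain2[OF dPsi DERIV_exp])
  have "((\<lambda>\<zeta>. \<Phi> (strip \<zeta>)) has_field_derivative deriv \<Phi> (strip \<zeta>) * strip' \<zeta>) (at \<zeta>)"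
    by (rule DERIV_chain2[OF Phi_field_derivative[OF Om] d])
  moreover have "((\<lambda>\<zeta>. \<Phi> (strip \<zeta>)) has_field_derivative exp \<zeta>) (at \<zeta>)"
  proof (rule has_field_derivative_transform_within_open[OF DERIV_exp])
    show "open {\<zeta>. Re \<zeta> > 0}" by (intro open_Collect_less continuous_intros)
    show "exp x = \<Phi> (strip x)" if "x \<in> {\<zeta>. Re \<zeta> > 0}" for x
      using that unfolding strip_def by (subst Phi_Psi) auto
  qed (use assms in simp)
  ultimately have "deriv \<Phi> (strip \<zeta>) * strip' \<zeta> = exp \<zeta>" by (rule DERIV_unique)
  then show "deriv \<Phi> (strip \<zeta>) / \<Phi> (strip \<zeta>) * strip' \<zeta> = 1"
    unfolding 2 by (simp add: field_simps)
qed

text \<open>Half-open in the imaginary part: one full period of the exponential, so that every point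
  of the collar is hit exactly once.\<close>

definition "period_strip \<sigma> = {\<zeta>. \<sigma> \<le> Re \<zeta> \<and> Re \<zeta> \<le> 2 * \<sigma> \<and> 0 \<le> Im \<zeta> \<and> Im \<zeta> < 2 * pi}"

lemma strip_image: assumes \<sigma>: "\<sigma> > 0" shows "strip ` period_strip \<sigma> = collar \<sigma>"
proof (intro subset_antisym subsetI)
  fix z assume "z \<in> strip ` period_strip \<sigma>"
  then obtain \<zeta> where \<zeta>: "z = strip \<zeta>" "\<zeta> \<in> period_strip \<sigma>" by blast
  then have "Re \<zeta> > 0" using \<sigma> by (auto simp: period_strip_def)
  from strip_facts[OF this] show "z \<in> collar \<sigma>"
    using \<zeta> by (auto simp: collar_def period_strip_def)
next
  fix z assume z: "z \<in> collar \<sigma>"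
  then have zO: "z \<in> Om" by (simp add: collar_def)
  define \<zeta> where "\<zeta> = Complex (ln (norm (\<Phi> z))) (Arg2pi (\<Phi> z))"
  have pos: "norm (\<Phi> z) > 0" using Phi_nonzero[OF zO] by simp
  have "exp \<zeta> = of_real (norm (\<Phi> z)) * exp (\<i> * of_real (Arg2pi (\<Phi> z)))"
    unfolding \<zeta>_def Complex_eq exp_add using pos by (simp add: exp_of_real)
  also have "\<dots> = \<Phi> z" using Arg2pi[of "\<Phi> z"] unfolding is_Arg_def by simp
  finally have "strip \<zeta> = z" unfolding strip_def using Psi_Phi[OF zO] by simp
  moreover have "\<zeta> \<in> period_strip \<sigma>"
  proof -
    have "exp \<sigma> \<le> norm (\<Phi> z)" "norm (\<Phi> z) \<le> exp (2 * \<sigma>)" using z by (auto simp: collar_def)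
    then have "ln (exp \<sigma>) \<le> ln (norm (\<Phi> z))" "ln (norm (\<Phi> z)) \<le> ln (exp (2 * \<sigma>))"
      using pos by (auto simp: ln_le_cancel_iff simp del: ln_exp)
    then show ?thesis
      using Arg2pi[of "\<Phi> z"] by (simp add: period_strip_def \<zeta>_def)
  qed
  ultimately show "z \<in> strip ` period_strip \<sigma>" by blast
qed

lemma strip_inj: assumes \<sigma>: "\<sigma> > 0" shows "inj_on strip (period_strip \<sigma>)"
proof (rule inj_onI)
  fix x y assume x: "x \<in> period_strip \<sigma>" and y: "y \<in> period_strip \<sigma>" and eq: "strip x = strip y"
  have "Re x > 0" "Re y > 0" using x y \<sigma> by (auto simp: period_strip_def)
  then have "exp x = exp y" using eq strip_facts(3) by metis
  then show "x = y"
    by (rule exp_complex_eqI[rotated]) (use x y in \<open>auto simp: period_strip_def abs_if\<close>)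
qed

lemma continuous_on_strip: "continuous_on {\<zeta>. Re \<zeta> > 0} strip"
  and continuous_on_strip': "continuous_on {\<zeta>. Re \<zeta> > 0} strip'"
proof -
  have o: "open {\<zeta>. Re \<zeta> > 0}" by (intro open_Collect_less continuous_intros)
  show "continuous_on {\<zeta>. Re \<zeta> > 0} strip"
    by (rule DERIV_continuous_on, rule has_field_derivative_at_within, rule strip_facts(4)) simp
  have "continuous_on {w. norm w > 1} (deriv \<Psi>)"
    by (intro holomorphic_on_imp_continuous_on holomorphic_deriv holo_Psi open_outer_disc)
  moreover have "continuous_on {\<zeta>. Re \<zeta> > 0} exp" by (intro continuous_intros)
  moreover have "exp ` {\<zeta>. Re \<zeta> > 0} \<subseteq> {w. norm w > 1}" by auto
  ultimately have "continuous_on {\<zeta>. Re \<zeta> > 0} (\<lambda>\<zeta>. deriv \<Psi> (exp \<zeta>))"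
    by (rule continuous_on_compose2)
  then show "continuous_on {\<zeta>. Re \<zeta> > 0} strip'"
    unfolding strip'_def by (intro continuous_on_mult continuous_on_exp continuous_on_id)
qed

lemma continuous_on_strip_integrand:
  assumes v: "continuous_on Om v"
  shows "continuous_on {\<zeta>. Re \<zeta> > 0} (\<lambda>\<zeta>. v (strip \<zeta>) * strip' \<zeta>)"
proof (rule continuous_on_mult[OF _ continuous_on_strip'])
  show "continuous_on {\<zeta>. Re \<zeta> > 0} (\<lambda>\<zeta>. v (strip \<zeta>))"
    by (rule continuous_on_compose2[OF v continuous_on_strip]) (use strip_facts(2) in auto)
qed

text \<open>Without normalisation: -i times the contour integral of \<open>v\<close> dz over the
  level curve |\<Phi>| = e^s, because dz is \<open>strip'\<close> times i d\<theta> there.\<close>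

definition "circle_mean v s = integral {0..2 * pi} (\<lambda>\<theta>. v (strip (Complex s \<theta>)) * strip' (Complex s \<theta>))"

lemma circle_mean_cont:
  assumes v: "continuous_on Om v" and \<sigma>: "\<sigma> > 0"
  shows "continuous_on {\<sigma>..2 * \<sigma>} (circle_mean v)"
  unfolding circle_mean_def box_real[symmetric]
proof (rule integral_continuous_on_param)
  note continuous_on_strip_integrand[OF v]
  then have "continuous_on (cbox \<sigma> (2 * \<sigma>) \<times> cbox 0 (2 * pi))
      (\<lambda>p. (\<lambda>\<zeta>. v (strip \<zeta>) * strip' \<zeta>) (Complex (fst p) (snd p)))"
    by (rule continuous_on_compose2) (use \<sigma> in \<open>auto intro!: continuous_intros\<close>)
  then show "continuous_on (cbox \<sigma> (2 * \<sigma>) \<times> cbox 0 (2 * pi))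
      (\<lambda>(x, t). v (strip (Complex x t)) * strip' (Complex x t))"
    by (simp add: case_prod_unfold)
qed

text \<open>The coarea formula for ln |\<Phi>|. The Jacobian of \<open>strip\<close> is |strip'|^2,
  and the conjugate logarithmic derivative in the cutoff gradient cancels the conjugate of
  \<open>strip'\<close>. One factor \<open>strip'\<close> is left, which makes the inner integral a
  contour integral.\<close>

theorem integral_collar:
  assumes v: "continuous_on Om v" and \<sigma>: "\<sigma> > 0"
  shows "(\<lambda>z. cutoff_grad \<sigma> z * v z) absolutely_integrable_on collar \<sigma>"
    and "integral (collar \<sigma>) (\<lambda>z. cutoff_grad \<sigma> z * v z)
           = integral {\<sigma>..2 * \<sigma>} (\<lambda>s. smooth_step' \<sigma> s *\<^sub>R circle_mean v s)"
proof -
  let ?S = "period_strip \<sigma>" and ?Q = "cbox (Complex \<sigma> 0) (Complex (2 * \<sigma>) (2 * pi))"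
  define k where "k = (\<lambda>\<zeta>. smooth_step' \<sigma> (Re \<zeta>) *\<^sub>R (v (strip \<zeta>) * strip' \<zeta>))"
  define f where "f = (\<lambda>z. cutoff_grad \<sigma> z * v z)"
  have Q: "?Q = {\<zeta>. \<sigma> \<le> Re \<zeta> \<and> Re \<zeta> \<le> 2 * \<sigma> \<and> 0 \<le> Im \<zeta> \<and> Im \<zeta> \<le> 2 * pi}"
    by (auto simp: cbox_def Basis_complex_def)
  have pos: "Re \<zeta> > 0" if "\<zeta> \<in> ?Q" for \<zeta> using that \<sigma> by (auto simp: Q)
  have SQ: "?S \<subseteq> ?Q" by (auto simp: Q period_strip_def)
  \<comment> \<open>The closed box, on which Fubini is applied, differs from the half-open strip by
    one horizontal edge.\<close>
  have neg: "negligible (?Q - ?S)"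
  proof (rule negligible_subset)
    show "negligible {\<zeta>::complex. \<zeta> \<bullet> \<i> = 2 * pi}"
      by (rule negligible_standard_hyperplane) (simp add: Basis_complex_def)
    show "?Q - ?S \<subseteq> {\<zeta>. \<zeta> \<bullet> \<i> = 2 * pi}"
      by (auto simp: Q period_strip_def inner_complex_def)
  qed
  have S_meas: "?S \<in> sets lebesgue"
  proof -
    have "?S = ?Q - (?Q - ?S)" using SQ by auto
    then show ?thesis using negligible_imp_sets[OF neg] by (metis lmeasurable_cbox fmeasurableD sets.Diff)
  qed
  have k_cont: "continuous_on ?Q k"
    unfolding k_def
    by (intro continuous_on_scaleR continuous_on_compose2[OF smooth_step'_cont[of UNIV]] continuous_intros
        continuous_on_subset[OF continuous_on_strip_integrand[OF v]])
      (use pos in auto)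
  have kQ: "k absolutely_integrable_on ?Q" by (rule absolutely_integrable_continuous[OF k_cont])
  have kS: "k absolutely_integrable_on ?S"
    using absolutely_integrable_on_subinterval kQ SQ S_meas
    by (meson absolutely_integrable_spike_set_eq[THEN iffD1] set_integrable_subset)
  have jac: "\<bar>real_jacobian ((*) (strip' \<zeta>))\<bar> *\<^sub>R f (strip \<zeta>) = k \<zeta>" if "\<zeta> \<in> ?S" for \<zeta>
  proof -
    have p: "Re \<zeta> > 0" using pos SQ that by blast
    have J: "\<bar>real_jacobian ((*) (strip' \<zeta>))\<bar> = (norm (strip' \<zeta>))\<^sup>2"
      unfolding real_jacobian_def cmod_power2 by (simp add: power2_eq_square)
    have L: "cnj (deriv \<Phi> (strip \<zeta>) / \<Phi> (strip \<zeta>)) * cnj (strip' \<zeta>) = 1"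
      using strip_facts(5)[OF p] by (metis complex_cnj_mult complex_cnj_one)
    have "of_real ((norm (strip' \<zeta>))\<^sup>2) * cnj (deriv \<Phi> (strip \<zeta>) / \<Phi> (strip \<zeta>))
        = strip' \<zeta> * (cnj (deriv \<Phi> (strip \<zeta>) / \<Phi> (strip \<zeta>)) * cnj (strip' \<zeta>))"
      unfolding complex_norm_square by (simp only: mult_ac)
    also have "\<dots> = strip' \<zeta>" unfolding L by simp
    finally have E: "of_real ((norm (strip' \<zeta>))\<^sup>2) * cnj (deriv \<Phi> (strip \<zeta>) / \<Phi> (strip \<zeta>)) = strip' \<zeta>" .
    have ln: "ln (norm (\<Phi> (strip \<zeta>))) = Re \<zeta>" using strip_facts(3)[OF p] by simp
    have "\<bar>real_jacobian ((*) (strip' \<zeta>))\<bar> *\<^sub>R f (strip \<zeta>) =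
       smooth_step' \<sigma> (Re \<zeta>) *\<^sub>R (v (strip \<zeta>) *
         (of_real ((norm (strip' \<zeta>))\<^sup>2) * cnj (deriv \<Phi> (strip \<zeta>) / \<Phi> (strip \<zeta>))))"
      unfolding J f_def cutoff_grad_def using strip_facts(2)[OF p]
      by (simp only: ln if_True scaleR_conv_of_real mult_ac)
    then show ?thesis unfolding E k_def .
  qed
  have der: "(strip has_derivative (*) (strip' \<zeta>)) (at \<zeta> within ?S)" if "\<zeta> \<in> ?S" for \<zeta>
    using strip_facts(4)[of \<zeta>] pos[of \<zeta>] SQ that
    by (auto simp: has_field_derivative_def intro: has_derivative_at_withinI)
  have kS': "(\<lambda>\<zeta>. \<bar>real_jacobian ((*) (strip' \<zeta>))\<bar> *\<^sub>R f (strip \<zeta>)) absolutely_integrable_on ?S"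
    using kS jac by (simp cong: set_integrable_cong)
  note cv = change_of_variables_complex[OF S_meas der strip_inj[OF \<sigma>] disjI2[OF kS'], unfolded strip_image[OF \<sigma>]]
  show "(\<lambda>z. cutoff_grad \<sigma> z * v z) absolutely_integrable_on collar \<sigma>"
    using cv(1) unfolding f_def .
  have "integral (collar \<sigma>) f = integral ?S (\<lambda>\<zeta>. \<bar>real_jacobian ((*) (strip' \<zeta>))\<bar> *\<^sub>R f (strip \<zeta>))"
    by (rule cv(3))
  also have "\<dots> = integral ?S k" by (rule integral_cong) (rule jac)
  also have "\<dots> = integral ?Q k"
    by (rule integral_spike_set) (use neg SQ in \<open>auto intro: negligible_subset[of _ "{}"] negligible_subset[OF neg]\<close>)
  also have "\<dots> = (LINT z:?Q|lborel. k z)"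
  proof -
    have "set_integrable lborel ?Q k"
      unfolding set_integrable_def by (rule borel_integrable_compact[OF compact_cbox k_cont])
    from set_borel_integral_eq_integral(2)[OF this] show ?thesis by simp
  qed
  also have "\<dots> = integral {\<sigma>..2 * \<sigma>} (\<lambda>s. smooth_step' \<sigma> s *\<^sub>R circle_mean v s)"
  proof (rule integral_box_complex(2))
    show "set_integrable lborel ?Q k"
      unfolding set_integrable_def by (rule borel_integrable_compact[OF compact_cbox k_cont])
    show "continuous_on {\<sigma>..2 * \<sigma>} (\<lambda>s. smooth_step' \<sigma> s *\<^sub>R circle_mean v s)"
      by (intro continuous_intros smooth_step'_cont circle_mean_cont v \<sigma>)
    show "AE s in lborel. s \<in> {\<sigma>..2 * \<sigma>} \<longrightarrow>
      ((\<lambda>t. k (Complex s t)) has_integral smooth_step' \<sigma> s *\<^sub>R circle_mean v s) {0..2 * pi}"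
    proof (intro always_eventually allI impI)
      fix s assume s: "s \<in> {\<sigma>..2 * \<sigma>}"
      have "continuous_on {0..2 * pi} (\<lambda>t. v (strip (Complex s t)) * strip' (Complex s t))"
        by (rule continuous_on_compose2[OF continuous_on_strip_integrand[OF v]])
          (use s \<sigma> in \<open>auto intro!: continuous_intros\<close>)
      then have "(\<lambda>t. v (strip (Complex s t)) * strip' (Complex s t)) integrable_on {0..2 * pi}"
        by (rule integrable_continuous_real)
      from has_integral_cmul[OF integrable_integral[OF this], of "smooth_step' \<sigma> s"]
      show "((\<lambda>t. k (Complex s t)) has_integral smooth_step' \<sigma> s *\<^sub>R circle_mean v s) {0..2 * pi}"
        by (simp add: k_def circle_mean_def)
    qed
  qed
  finally show "integral (collar \<sigma>) (\<lambda>z. cutoff_grad \<sigma> z * v z)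
           = integral {\<sigma>..2 * \<sigma>} (\<lambda>s. smooth_step' \<sigma> s *\<^sub>R circle_mean v s)"
    unfolding f_def .
qed

end

section \<open>The energy of a polynomial\<close>

abbreviation square :: "real \<Rightarrow> complex set" where
  "square R \<equiv> cbox (Complex (-R) (-R)) (Complex R R)"

lemma has_vector_derivative_horizontal:
  assumes "(u has_derivative u') (at (Complex s t))"
  shows "((\<lambda>s. u (Complex s t)) has_vector_derivative u' 1) (at s within A)"
proof -
  have "((\<lambda>s. Complex s t) has_vector_derivative 1) (at s)"
    unfolding Complex_eq by (auto intro!: derivative_eq_intros)
  then have "((\<lambda>s. Complex s t) has_derivative (\<lambda>x. x *\<^sub>R 1)) (at s)"
    by (simp add: has_vector_derivative_def)
  from has_derivative_compose[OF this assms]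
  have "((\<lambda>s. u (Complex s t)) has_derivative (\<lambda>x. u' (x *\<^sub>R 1))) (at s)" .
  then have "((\<lambda>s. u (Complex s t)) has_vector_derivative u' 1) (at s)"
    unfolding has_vector_derivative_def linear_scale[OF has_derivative_linear[OF assms]] .
  then show ?thesis by (rule has_vector_derivative_at_within)
qed

lemma has_vector_derivative_vertical:
  assumes "(u has_derivative u') (at (Complex s t))"
  shows "((\<lambda>t. u (Complex s t)) has_vector_derivative u' \<i>) (at t within A)"
proof -
  have "((\<lambda>t. Complex s t) has_vector_derivative \<i>) (at t)"
    unfolding Complex_eq by (auto intro!: derivative_eq_intros)
  then have "((\<lambda>t. Complex s t) has_derivative (\<lambda>x. x *\<^sub>R \<i>)) (at t)"
    by (simp add: has_vector_derivative_def)
  from has_derivative_compose[OF this assms]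
  have "((\<lambda>t. u (Complex s t)) has_derivative (\<lambda>x. u' (x *\<^sub>R \<i>))) (at t)" .
  then have "((\<lambda>t. u (Complex s t)) has_vector_derivative u' \<i>) (at t)"
    unfolding has_vector_derivative_def linear_scale[OF has_derivative_linear[OF assms]] .
  then show ?thesis by (rule has_vector_derivative_at_within)
qed

lemma continuous_set_integrable_square:
  fixes f :: "complex \<Rightarrow> 'a::euclidean_space"
  assumes "continuous_on UNIV f"
  shows "set_integrable lborel (square R) f"
  unfolding set_integrable_def
  by (rule borel_integrable_compact[OF compact_cbox continuous_on_subset[OF assms]]) simp

lemma Green_square_C1:
  fixes u :: "complex \<Rightarrow> complex"
  assumes der: "\<And>z. (u has_derivative u' z) (at z)"
    and cont: "continuous_on UNIV (\<lambda>z. u' z 1)" "continuous_on UNIV (\<lambda>z. u' z \<i>)"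
    and R: "R \<ge> 0"
  shows "(LINT z:square R|lborel. u' z 1 + \<i> * u' z \<i>) = box_boundary_integral R u"
proof (rule Green_square)
  show "continuous_on UNIV u"
    by (rule has_derivative_continuous_on[OF has_derivative_at_withinI[OF der]])
  show "AE t in lborel. t \<in> {-R..R} \<longrightarrow>
       ((\<lambda>s. u' (Complex s t) 1) has_integral u (Complex R t) - u (Complex (-R) t)) {-R..R}"
    using R by (intro always_eventually allI impI fundamental_theorem_of_calculus
        has_vector_derivative_horizontal der) auto
  show "AE s in lborel. s \<in> {-R..R} \<longrightarrow>
       ((\<lambda>t. u' (Complex s t) \<i>) has_integral u (Complex s R) - u (Complex s (-R))) {-R..R}"
    using R by (intro always_eventually allI impI fundamental_theorem_of_calculus
        has_vector_derivative_vertical der) auto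
qed (intro continuous_set_integrable_square cont)+

lemma square_boundary_norm:
  "\<bar>s\<bar> = R \<or> \<bar>t\<bar> = R \<Longrightarrow> R \<le> norm (Complex s t)"
  using abs_Re_le_cmod[of "Complex s t"] abs_Im_le_cmod[of "Complex s t"] by auto

lemma cball_subset_square: "cball 0 R \<subseteq> square R"
proof
  fix z :: complex assume "z \<in> cball 0 R"
  then have "\<bar>Re z\<bar> \<le> R" "\<bar>Im z\<bar> \<le> R"
    using abs_Re_le_cmod[of z] abs_Im_le_cmod[of z] by auto
  then show "z \<in> square R"
    by (auto simp: cbox_def Basis_complex_def)
qed

lemma box_boundary_integral_eq_0:
  assumes "\<And>z. norm z \<ge> R \<Longrightarrow> u z = 0" "R \<ge> 0"
  shows "box_boundary_integral R u = 0"
proof -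
  have "u (Complex R t) = 0" "u (Complex (-R) t) = 0" "u (Complex t R) = 0" "u (Complex t (-R)) = 0" for t
    using assms by (auto intro!: assms(1) square_boundary_norm)
  then show ?thesis by (simp add: box_boundary_integral_def)
qed

lemma integral_square_eq_subset:
  fixes f :: "complex \<Rightarrow> complex"
  assumes f: "continuous_on UNIV f" and K: "K \<subseteq> square R" and z: "\<And>z. z \<notin> K \<Longrightarrow> f z = 0"
  shows "(LINT z:square R|lborel. f z) = integral K f"
proof -
  have "(LINT z:square R|lborel. f z) = integral (square R) f"
    by (rule set_borel_integral_eq_integral(2)[OF continuous_set_integrable_square[OF f]])
  also have "\<dots> = integral (square R) (\<lambda>z. if z \<in> K then f z else 0)"
    by (rule integral_cong) (use z in auto)
  also have "\<dots> = integral K f"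
    by (simp add: integral_def K integrable_on_def)
  finally show ?thesis .
qed

lemma set_lebesgue_integral_lborel_eq:
  fixes f :: "complex \<Rightarrow> 'a::euclidean_space"
  assumes "A \<in> sets borel" "f \<in> borel_measurable borel"
  shows "(LINT z:A|lebesgue. f z) = (LINT z:A|lborel. f z)"
    and "set_integrable lebesgue A f \<longleftrightarrow> set_integrable lborel A f"
  using assms by (auto simp: set_lebesgue_integral_def set_integrable_def integral_completion integrable_completion)

context exterior_map
begin

lemma poly_real_derivative:
  fixes F :: "complex poly"
  shows "(poly F has_derivative (\<lambda>v. poly (pderiv F) z * v)) (at z)"
  using poly_DERIV[of F z] by (simp add: has_field_derivative_def)

text \<open>Green's formula for \<open>(1 - cutoff) * cnj F * F'\<close>, which vanishes off a large
  disc. Twice its derivative with respect to cnj z is 2 |F'|^2 times \<open>1 - cutoff\<close>,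
  minus the collar term. Since \<open>1 - cutoff\<close> is 1 on \<open>G\<close> and nonnegative
  elsewhere, the energy over \<open>G\<close> is at most half the averaged level-curve
  integral.\<close>

theorem energy_le:
  fixes F :: "complex poly"
  assumes G: "open G" and \<sigma>: "\<sigma> > 0"
    and M: "\<And>s. s \<in> {\<sigma>..2 * \<sigma>} \<Longrightarrow> Re (circle_mean (\<lambda>z. cnj (poly F z) * poly (pderiv F) z) s) \<le> M"
  shows "(LINT z:G|lebesgue. (norm (poly (pderiv F) z))\<^sup>2) \<le> M / 2"
proof -
  define v where "v = (\<lambda>z. cnj (poly F z) * poly (pderiv F) z)"
  define f where "f = (\<lambda>z. cutoff_grad \<sigma> z * v z)"
  define D where "D = (\<lambda>z. complex_of_real (1 - cutoff \<sigma> z))"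
  define u where "u = (\<lambda>z. D z * v z)"
  define v' where "v' = (\<lambda>z x. cnj (poly F z) * (poly (pderiv (pderiv F)) z * x)
       + cnj (poly (pderiv F) z * x) * poly (pderiv F) z)"
  define u' where "u' = (\<lambda>z x. D z * v' z x + of_real (- Re (cnj (cutoff_grad \<sigma> z) * x)) * v z)"
  have v_cont: "continuous_on A v" for A
    unfolding v_def by (intro continuous_intros)
  have f_cont: "continuous_on UNIV f"
    unfolding f_def by (intro continuous_intros continuous_on_cutoff_grad[OF \<sigma>] v_cont)
  have D_cont: "continuous_on UNIV D"
    unfolding D_def by (intro continuous_intros continuous_on_cutoff[OF \<sigma>])
  have v_der: "(v has_derivative v' z) (at z)" for z
    unfolding v_def v'_def
    by (rule has_derivative_mult[OF bounded_linear.has_derivative[OF bounded_linear_cnj poly_real_derivative]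
          poly_real_derivative])
  have D_der: "(D has_derivative (\<lambda>x. of_real (- Re (cnj (cutoff_grad \<sigma> z) * x)))) (at z)" for z
  proof -
    have "((\<lambda>z. 1 - cutoff \<sigma> z) has_derivative (\<lambda>x. 0 - Re (cnj (cutoff_grad \<sigma> z) * x))) (at z)"
      by (intro has_derivative_diff has_derivative_const cutoff_derivative[OF \<sigma>])
    from bounded_linear.has_derivative[OF bounded_linear_of_real this] show ?thesis
      unfolding D_def by simp
  qed
  have u_der: "(u has_derivative u' z) (at z)" for z
    unfolding u_def u'_def by (rule has_derivative_mult[OF D_der v_der])
  have u'_cont: "continuous_on UNIV (\<lambda>z. u' z x)" for x
    unfolding u'_def v'_def
    by (intro continuous_intros D_cont v_cont continuous_on_cutoff_grad[OF \<sigma>])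
  have u'_eq: "u' z 1 + \<i> * u' z \<i> = 2 * D z * of_real ((norm (poly (pderiv F) z))\<^sup>2) - f z" for z
  proof -
    have 1: "v' z 1 + \<i> * v' z \<i> = 2 * of_real ((norm (poly (pderiv F) z))\<^sup>2)"
      unfolding v'_def complex_norm_square by (simp add: algebra_simps)
    have 2: "of_real (Re (cnj (cutoff_grad \<sigma> z) * 1)) + \<i> * of_real (Re (cnj (cutoff_grad \<sigma> z) * \<i>)) = cutoff_grad \<sigma> z"
      by (simp add: complex_eq_iff)
    have "u' z 1 + \<i> * u' z \<i> = D z * (v' z 1 + \<i> * v' z \<i>)
       - (of_real (Re (cnj (cutoff_grad \<sigma> z) * 1)) + \<i> * of_real (Re (cnj (cutoff_grad \<sigma> z) * \<i>))) * v z"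
      unfolding u'_def by (simp add: algebra_simps)
    then show ?thesis unfolding 1 2 f_def by (simp add: algebra_simps)
  qed
  have "bounded (closure G \<union> {z \<in> Om. norm (\<Phi> z) \<le> exp (2 * \<sigma>)})"
    using bounded_closure[OF bounded_G] bounded_inner by simp
  then obtain R where R: "R > 0" "closure G \<union> {z \<in> Om. norm (\<Phi> z) \<le> exp (2 * \<sigma>)} \<subseteq> ball 0 R"
    using bounded_subset_ballD by blast
  \<comment> \<open>Beyond \<open>R\<close> the cutoff equals 1, so the boundary integral over the
    square disappears.\<close>
  have u0: "u z = 0" if "norm z \<ge> R" for z
  proof -
    have "z \<notin> closure G" "\<not> (z \<in> Om \<and> norm (\<Phi> z) \<le> exp (2 * \<sigma>))" using R(2) that by auto
    then have "z \<in> Om" "norm (\<Phi> z) \<ge> exp (2 * \<sigma>)" by (auto simp: Om_def)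
    then show ?thesis using cutoff_one[OF \<sigma>] by (simp add: u_def D_def)
  qed
  have "(LINT z:square R|lborel. 2 * D z * of_real ((norm (poly (pderiv F) z))\<^sup>2) - f z) = 0"
    using Green_square_C1[OF u_der u'_cont u'_cont, of R] box_boundary_integral_eq_0[OF u0, of R] R(1)
    unfolding u'_eq by simp
  moreover have "continuous_on UNIV (\<lambda>z. 2 * D z * of_real ((norm (poly (pderiv F) z))\<^sup>2))"
    by (intro continuous_intros D_cont)
  ultimately have eq1: "(LINT z:square R|lborel. 2 * D z * of_real ((norm (poly (pderiv F) z))\<^sup>2))
      = (LINT z:square R|lborel. f z)"
    by (subst (asm) set_integral_diff) (auto intro: continuous_set_integrable_square f_cont)
  have col: "collar \<sigma> \<subseteq> square R"
    using R(2) cball_subset_square[of R] ball_subset_cball[of 0 R] unfolding collar_def by blast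
  have eq2: "(LINT z:square R|lborel. f z) = integral {\<sigma>..2 * \<sigma>} (\<lambda>s. smooth_step' \<sigma> s *\<^sub>R circle_mean v s)"
  proof -
    have "(LINT z:square R|lborel. f z) = integral (collar \<sigma>) f"
    proof (rule integral_square_eq_subset[OF f_cont col])
      fix z assume z: "z \<notin> collar \<sigma>"
      have "cutoff_grad \<sigma> z = 0"
      proof (cases "z \<in> Om \<and> norm (\<Phi> z) \<ge> exp \<sigma>")
        case True
        then show ?thesis using z cutoff_one(2)[OF \<sigma>, of z] by (auto simp: collar_def)
      next
        case False
        then show ?thesis using collar_zero(2)[OF \<sigma>] by blast
      qed
      then show "f z = 0" by (simp add: f_def)
    qed
    then show ?thesis using integral_collar(2)[OF v_cont \<sigma>] by (simp add: f_def)
  qed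
  define g where "g = (\<lambda>z. (1 - cutoff \<sigma> z) * (norm (poly (pderiv F) z))\<^sup>2)"
  have g_cont: "continuous_on UNIV g"
    unfolding g_def by (intro continuous_intros continuous_on_cutoff[OF \<sigma>])
  have "2 * D z * of_real ((norm (poly (pderiv F) z))\<^sup>2) = complex_of_real (2 * g z)" for z
    by (simp add: D_def g_def)
  then have "(LINT z:square R|lborel. 2 * D z * of_real ((norm (poly (pderiv F) z))\<^sup>2))
      = (LINT z:square R|lborel. complex_of_real (2 * g z))"
    by (simp only:)
  also have "\<dots> = of_real (LINT z:square R|lborel. 2 * g z)"
    by (rule set_integral_complex_of_real)
  finally have eq3: "complex_of_real (LINT z:square R|lborel. 2 * g z)
      = integral {\<sigma>..2 * \<sigma>} (\<lambda>s. smooth_step' \<sigma> s *\<^sub>R circle_mean v s)"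
    using eq1 eq2 by (simp only:)
  have "Re (integral {\<sigma>..2 * \<sigma>} (\<lambda>s. smooth_step' \<sigma> s *\<^sub>R circle_mean v s)) \<le> M"
    by (rule smooth_step_average_bound(2)[OF \<sigma> circle_mean_cont[OF v_cont \<sigma>] M[folded v_def]])
  then have "(LINT z:square R|lborel. 2 * g z) \<le> M"
    unfolding eq3[symmetric] by (simp only: Re_complex_of_real)
  then have gM: "(LINT z:square R|lborel. g z) \<le> M / 2" by simp
  have GR: "G \<subseteq> square R"
    using R(2) cball_subset_square[of R] ball_subset_cball[of 0 R] closure_subset[of G] by blast
  have nc: "continuous_on UNIV (\<lambda>z. (norm (poly (pderiv F) z))\<^sup>2)" by (intro continuous_intros)
  have "(LINT z:G|lebesgue. (norm (poly (pderiv F) z))\<^sup>2) = (LINT z:G|lborel. (norm (poly (pderiv F) z))\<^sup>2)"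
    by (rule set_lebesgue_integral_lborel_eq) (use G nc in \<open>auto intro: borel_measurable_continuous_onI\<close>)
  also have "\<dots> \<le> (LINT z:square R|lborel. g z)"
    unfolding set_lebesgue_integral_def
  proof (rule integral_mono)
    show "integrable lborel (\<lambda>z. indicator G z *\<^sub>R (norm (poly (pderiv F) z))\<^sup>2)"
      using set_integrable_subset[OF continuous_set_integrable_square[OF nc] _ GR] G
      by (simp add: set_integrable_def)
    show "integrable lborel (\<lambda>z. indicator (square R) z *\<^sub>R g z)"
      using continuous_set_integrable_square[OF g_cont] by (simp add: set_integrable_def)
    fix z
    show "indicator G z *\<^sub>R (norm (poly (pderiv F) z))\<^sup>2 \<le> indicator (square R) z *\<^sub>R g z"
    proof (cases "z \<in> G")
      case True
      then have "z \<notin> Om" using closure_subset by (auto simp: Om_def)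
      then show ?thesis using True GR by (auto simp: g_def cutoff_def)
    next
      case False
      then show ?thesis using cutoff_range[OF \<sigma>, of z] by (simp add: g_def)
    qed
  qed
  finally show ?thesis using gM by simp
qed

end

section \<open>Fourier series on level curves\<close>

lemma has_integral_exp_int:
  "((\<lambda>\<theta>. exp (of_int m * \<i> * of_real \<theta>)) has_integral (if m = 0 then 2 * pi else 0)) {0..2 * pi}"
proof (cases "m = 0")
  case True
  then show ?thesis using has_integral_const_real[of "1::complex" 0 "2 * pi"]
    by (simp add: scaleR_conv_of_real)
next
  case False
  let ?c = "of_int m * \<i>"
  have "((\<lambda>\<theta>. exp (?c * of_real \<theta>)) has_integral
      exp (?c * of_real (2 * pi)) / ?c - exp (?c * of_real 0) / ?c) {0..2 * pi}"
  proof (rule fundamental_theorem_of_calculus)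
    fix x :: real
    have "((\<lambda>z. exp (?c * z) / ?c) has_field_derivative exp (?c * of_real x)) (at (of_real x))"
      using False by (auto intro!: derivative_eq_intros)
    from has_vector_derivative_real_field[OF this]
    show "((\<lambda>\<theta>. exp (?c * of_real \<theta>) / ?c) has_vector_derivative exp (?c * of_real x)) (at x within {0..2 * pi})"
      by (rule has_vector_derivative_at_within)
  qed simp
  moreover have "exp (?c * of_real (2 * pi)) = 1"
    using exp_integer_2pi[of "of_int m"] by (simp add: mult_ac)
  ultimately show ?thesis using False by simp
qed

text \<open>Parseval's identity for an exponential sum against its derivative. The derivative
  contributes the exponents as weights, so negative exponents enter with a negative sign.\<close>

lemma circle_orthogonality:
  fixes a :: "'i \<Rightarrow> complex" and e :: "'i \<Rightarrow> int"
  assumes fin: "finite I" and inj: "inj_on e I"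
  shows "((\<lambda>\<theta>. cnj (\<Sum>n\<in>I. a n * exp (of_int (e n) * Complex s \<theta>)) *
            (\<Sum>n\<in>I. of_int (e n) * a n * exp (of_int (e n) * Complex s \<theta>)))
     has_integral of_real (2 * pi * (\<Sum>n\<in>I. of_int (e n) * (norm (a n))\<^sup>2 * exp (2 * of_int (e n) * s)))) {0..2 * pi}"
proof -
  let ?K = "\<lambda>n m. cnj (a n) * (of_int (e m) * a m) * of_real (exp (of_int (e n + e m) * s))"
  have E: "cnj (exp (of_int (e n) * Complex s \<theta>)) * exp (of_int (e m) * Complex s \<theta>)
      = of_real (exp (of_int (e n + e m) * s)) * exp (of_int (e m - e n) * \<i> * of_real \<theta>)" for n m \<theta>
  proof -
    have "cnj (exp (of_int (e n) * Complex s \<theta>)) * exp (of_int (e m) * Complex s \<theta>)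
        = exp (of_int (e n) * Complex s (-\<theta>) + of_int (e m) * Complex s \<theta>)"
      by (simp add: exp_cnj exp_add complex_cnj)
    also have "of_int (e n) * Complex s (-\<theta>) + of_int (e m) * Complex s \<theta>
       = of_real (of_int (e n + e m) * s) + of_int (e m - e n) * \<i> * of_real \<theta>"
      by (simp add: complex_eq_iff algebra_simps)
    finally show ?thesis by (simp only: exp_add exp_of_real)
  qed
  have "((\<lambda>\<theta>. \<Sum>n\<in>I. \<Sum>m\<in>I. ?K n m * exp (of_int (e m - e n) * \<i> * of_real \<theta>)) has_integral
     (\<Sum>n\<in>I. \<Sum>m\<in>I. ?K n m * (if e m - e n = 0 then 2 * pi else 0))) {0..2 * pi}"
    by (intro has_integral_sum has_integral_mult_right has_integral_exp_int fin)
  also have "(\<lambda>\<theta>. \<Sum>n\<in>I. \<Sum>m\<in>I. ?K n m * exp (of_int (e m - e n) * \<i> * of_real \<theta>)) =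
     (\<lambda>\<theta>. cnj (\<Sum>n\<in>I. a n * exp (of_int (e n) * Complex s \<theta>)) *
            (\<Sum>n\<in>I. of_int (e n) * a n * exp (of_int (e n) * Complex s \<theta>)))"
  proof
    fix \<theta>
    have "?K n m * exp (of_int (e m - e n) * \<i> * of_real \<theta>) =
        cnj (a n * exp (of_int (e n) * Complex s \<theta>)) * (of_int (e m) * a m * exp (of_int (e m) * Complex s \<theta>))" for n m
    proof -
      have "cnj (a n * exp (of_int (e n) * Complex s \<theta>)) * (of_int (e m) * a m * exp (of_int (e m) * Complex s \<theta>))
         = cnj (a n) * (of_int (e m) * a m) * (cnj (exp (of_int (e n) * Complex s \<theta>)) * exp (of_int (e m) * Complex s \<theta>))"
        by simp
      then show ?thesis unfolding E by (simp only: mult.assoc)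
    qed
    then show "(\<Sum>n\<in>I. \<Sum>m\<in>I. ?K n m * exp (of_int (e m - e n) * \<i> * of_real \<theta>)) =
      cnj (\<Sum>n\<in>I. a n * exp (of_int (e n) * Complex s \<theta>)) *
            (\<Sum>n\<in>I. of_int (e n) * a n * exp (of_int (e n) * Complex s \<theta>))"
      by (simp only: cnj_sum sum_product)
  qed
  also have "(\<Sum>n\<in>I. \<Sum>m\<in>I. ?K n m * (if e m - e n = 0 then 2 * pi else 0)) =
      (\<Sum>n\<in>I. of_real (2 * pi * (of_int (e n) * (norm (a n))\<^sup>2 * exp (2 * of_int (e n) * s))))"
  proof (rule sum.cong[OF refl])
    fix n assume n: "n \<in> I"
    have "(\<Sum>m\<in>I. ?K n m * (if e m - e n = 0 then 2 * pi else 0)) = (\<Sum>m\<in>I. if m = n then ?K n n * (2 * pi) else 0)"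
      using inj n by (intro sum.cong) (auto simp: inj_on_def)
    also have "\<dots> = ?K n n * (2 * pi)" using n fin by simp
    also have "\<dots> = of_real (2 * pi * (of_int (e n) * (norm (a n))\<^sup>2 * exp (2 * of_int (e n) * s)))"
      using complex_norm_square[of "a n"] by (simp add: algebra_simps)
    finally show "(\<Sum>m\<in>I. ?K n m * (if e m - e n = 0 then 2 * pi else 0)) =
      of_real (2 * pi * (of_int (e n) * (norm (a n))\<^sup>2 * exp (2 * of_int (e n) * s)))" .
  qed
  finally show ?thesis by (simp add: sum_distrib_left)
qed

lemma summable_norm_power_series_inside:
  fixes c :: "nat \<Rightarrow> complex"
  assumes conv: "\<And>w. norm w < 1 \<Longrightarrow> summable (\<lambda>n. c n * w ^ n)" and q: "0 \<le> q" "q < 1"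
  shows "summable (\<lambda>n. norm (c n) * q ^ n)"
proof -
  define r where "r = (q + 1) / 2"
  have r: "q < r" "r < 1" using q by (auto simp: r_def)
  have "summable (\<lambda>n. c n * of_real r ^ n)" using r q by (intro conv) simp
  then have "summable (\<lambda>n. norm (c n * of_real q ^ n))"
    by (rule powser_insidea) (use r q in simp)
  then show ?thesis using q by (simp add: norm_mult norm_power)
qed

text \<open>By Parseval the left side is 2 pi times N e^(2Ns) minus the sum of n |c_n|^2 e^(-2ns),
  where c_n are the Taylor coefficients of \<open>k\<close>. All terms with n > 1 have the
  favourable sign and are dropped. The identity is applied to partial sums and carried to the limit
  by dominated convergence.\<close>

lemma circle_energy_le:
  fixes k :: "complex \<Rightarrow> complex" and N :: nat
  assumes k: "k holomorphic_on ball 0 1" "k 0 = 0" and s: "s > 0"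
  shows "Re (integral {0..2 * pi} (\<lambda>\<theta>. cnj (exp (of_nat N * Complex s \<theta>) + k (exp (- Complex s \<theta>))) *
           (of_nat N * exp (of_nat N * Complex s \<theta>) - deriv k (exp (- Complex s \<theta>)) * exp (- Complex s \<theta>))))
         \<le> 2 * pi * (real N * exp (2 * real N * s) - (norm (deriv k 0))\<^sup>2 * exp (- 2 * s))"
proof -
  define c where "c = (\<lambda>n. (deriv ^^ n) k 0 / fact n)"
  \<comment> \<open>Since \<open>k 0 = 0\<close>, index 0 is free and carries the leading
    exponential with exponent \<open>N\<close>; an index n > 0 carries the exponent -n. The
    exponents are thus distinct.\<close>
  define a where "a = (\<lambda>n::nat. if n = 0 then 1 else c n)"
  define e where "e = (\<lambda>n::nat. if n = 0 then int N else - int n)"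
  define q where "q = exp (- s)"
  have q: "0 \<le> q" "q < 1" using s by (auto simp: q_def)
  have c0: "c 0 = 0" and c1: "c 1 = deriv k 0" using k(2) by (simp_all add: c_def)
  have k_sums: "(\<lambda>n. c n * w ^ n) sums k w" if "norm w < 1" for w
    using holomorphic_power_series[OF k(1), of w] that by (simp add: c_def)
  have k'_sums: "(\<lambda>n. of_nat n * c n * w ^ n) sums (deriv k w * w)" if "norm w < 1" for w
  proof -
    have "(\<lambda>n. (deriv ^^ n) (deriv k) 0 / fact n * w ^ n) sums deriv k w"
      using holomorphic_power_series[OF holomorphic_deriv[OF k(1)], of w] that by simp
    moreover have "(deriv ^^ n) (deriv k) 0 / fact n = of_nat (Suc n) * c (Suc n)" for n
    proof -
      have "(deriv ^^ n) (deriv k) = (deriv ^^ Suc n) k" by (simp only: funpow_Suc_right o_def)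
      then show ?thesis by (simp add: c_def field_simps del: of_nat_Suc funpow.simps)
    qed
    ultimately have "(\<lambda>n. of_nat (Suc n) * c (Suc n) * w ^ n) sums deriv k w" by simp
    then have "(\<lambda>n. of_nat (Suc n) * c (Suc n) * w ^ n * w) sums (deriv k w * w)" by (rule sums_mult2)
    then have "(\<lambda>n. of_nat (Suc n) * c (Suc n) * w ^ Suc n) sums (deriv k w * w)"
      by (simp add: mult_ac del: of_nat_Suc)
    then show ?thesis by (subst (asm) sums_Suc_iff) simp
  qed
  define S1 where "S1 = (\<Sum>n. norm (c n) * q ^ n)"
  define S2 where "S2 = (\<Sum>n. norm (of_nat n * c n) * q ^ n)"
  have sum1: "summable (\<lambda>n. norm (c n) * q ^ n)"
    by (rule summable_norm_power_series_inside[OF _ q]) (use k_sums sums_summable in blast)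
  have sum2: "summable (\<lambda>n. norm (of_nat n * c n) * q ^ n)"
    by (rule summable_norm_power_series_inside[OF _ q]) (use k'_sums sums_summable in blast)
  define U where "U = (\<lambda>M \<theta>. \<Sum>n\<le>M. a n * exp (of_int (e n) * Complex s \<theta>))"
  define V where "V = (\<lambda>M \<theta>. \<Sum>n\<le>M. of_int (e n) * a n * exp (of_int (e n) * Complex s \<theta>))"
  define u where "u = (\<lambda>\<theta>. exp (of_nat N * Complex s \<theta>) + k (exp (- Complex s \<theta>)))"
  define v where "v = (\<lambda>\<theta>. of_nat N * exp (of_nat N * Complex s \<theta>)
      - deriv k (exp (- Complex s \<theta>)) * exp (- Complex s \<theta>))"
  have w: "norm (exp (- Complex s \<theta>)) = q" "norm (exp (- Complex s \<theta>)) < 1" for \<theta>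
    using q by (simp_all add: q_def)
  have wn: "exp (- Complex s \<theta>) ^ n = exp (- (of_nat n * Complex s \<theta>))" for n \<theta>
    by (simp add: exp_of_nat_mult[symmetric])
  have tU: "a n * exp (of_int (e n) * Complex s \<theta>) =
      (if n = 0 then exp (of_nat N * Complex s \<theta>) else 0) + c n * exp (- Complex s \<theta>) ^ n" for n \<theta>
    unfolding wn using c0 by (simp add: a_def e_def)
  have tV: "of_int (e n) * a n * exp (of_int (e n) * Complex s \<theta>) =
      (if n = 0 then of_nat N * exp (of_nat N * Complex s \<theta>) else 0)
        - of_nat n * c n * exp (- Complex s \<theta>) ^ n" for n \<theta>
    unfolding wn using c0 by (simp add: a_def e_def)
  have U_lim: "(\<lambda>M. U M \<theta>) \<longlonglongrightarrow> u \<theta>" for \<theta>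
  proof -
    have "(\<lambda>n. a n * exp (of_int (e n) * Complex s \<theta>)) sums u \<theta>"
      unfolding tU u_def by (intro sums_add k_sums w(2)) (rule sums_single)
    then show ?thesis unfolding U_def sums_def_le .
  qed
  have V_lim: "(\<lambda>M. V M \<theta>) \<longlonglongrightarrow> v \<theta>" for \<theta>
  proof -
    have "(\<lambda>n. of_int (e n) * a n * exp (of_int (e n) * Complex s \<theta>)) sums v \<theta>"
      unfolding tV v_def by (intro sums_diff k'_sums w(2)) (rule sums_single)
    then show ?thesis unfolding V_def sums_def_le .
  qed
  have Nn: "norm (exp (of_nat N * Complex s \<theta>)) = exp (real N * s)" for \<theta>
    by simp
  have U_bd: "norm (U M \<theta>) \<le> exp (real N * s) + S1" for M \<theta>
  proof -
    have "U M \<theta> = exp (of_nat N * Complex s \<theta>) + (\<Sum>n\<le>M. c n * exp (- Complex s \<theta>) ^ n)"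
      unfolding U_def tU sum.distrib by simp
    also have "norm \<dots> \<le> exp (real N * s) + (\<Sum>n\<le>M. norm (c n) * q ^ n)"
      by (rule order_trans[OF norm_triangle_ineq add_mono])
        (use Nn w(1) in \<open>auto intro!: order_trans[OF norm_sum] sum_mono simp: norm_mult norm_power\<close>)
    also have "(\<Sum>n\<le>M. norm (c n) * q ^ n) \<le> S1"
      unfolding S1_def by (rule sum_le_suminf[OF sum1]) (use q in auto)
    finally show ?thesis by simp
  qed
  have V_bd: "norm (V M \<theta>) \<le> real N * exp (real N * s) + S2" for M \<theta>
  proof -
    have "V M \<theta> = of_nat N * exp (of_nat N * Complex s \<theta>) - (\<Sum>n\<le>M. of_nat n * c n * exp (- Complex s \<theta>) ^ n)"
      unfolding V_def tV sum_subtractf by simp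
    also have "norm \<dots> \<le> real N * exp (real N * s) + (\<Sum>n\<le>M. norm (of_nat n * c n) * q ^ n)"
      by (rule order_trans[OF norm_triangle_ineq4 add_mono])
        (use Nn w(1) in \<open>auto intro!: order_trans[OF norm_sum] sum_mono simp: norm_mult norm_power\<close>)
    also have "(\<Sum>n\<le>M. norm (of_nat n * c n) * q ^ n) \<le> S2"
      unfolding S2_def by (rule sum_le_suminf[OF sum2]) (use q in auto)
    finally show ?thesis by simp
  qed
  have inj: "inj_on e {..M}" for M
    by (auto simp: inj_on_def e_def split: if_splits)
  define val where "val = (\<lambda>M. 2 * pi * (\<Sum>n\<le>M. of_int (e n) * (norm (a n))\<^sup>2 * exp (2 * of_int (e n) * s)))"
  have int: "((\<lambda>\<theta>. cnj (U M \<theta>) * V M \<theta>) has_integral of_real (val M)) {0..2 * pi}" for M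
    unfolding U_def V_def val_def by (rule circle_orthogonality[OF _ inj]) simp
  have "(\<lambda>M. integral {0..2 * pi} (\<lambda>\<theta>. cnj (U M \<theta>) * V M \<theta>)) \<longlonglongrightarrow> integral {0..2 * pi} (\<lambda>\<theta>. cnj (u \<theta>) * v \<theta>)"
  proof (rule dominated_convergence(2))
    show "(\<lambda>\<theta>. cnj (U M \<theta>) * V M \<theta>) integrable_on {0..2 * pi}" for M
      using int by blast
    show "(\<lambda>_. (exp (real N * s) + S1) * (real N * exp (real N * s) + S2)) integrable_on {0..2 * pi}"
      by (intro integrable_continuous_real continuous_intros)
    show "norm (cnj (U M \<theta>) * V M \<theta>) \<le> (exp (real N * s) + S1) * (real N * exp (real N * s) + S2)" for M \<theta>
      unfolding norm_mult complex_mod_cnj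
      by (intro mult_mono U_bd V_bd) (use order_trans[OF norm_ge_zero U_bd] in auto)
    show "(\<lambda>M. cnj (U M \<theta>) * V M \<theta>) \<longlonglongrightarrow> cnj (u \<theta>) * v \<theta>" for \<theta>
      by (intro tendsto_mult tendsto_cnj U_lim V_lim)
  qed
  then have "(\<lambda>M. val M) \<longlonglongrightarrow> Re (integral {0..2 * pi} (\<lambda>\<theta>. cnj (u \<theta>) * v \<theta>))"
    unfolding integral_unique[OF int] using tendsto_Re by fastforce
  moreover have "val M \<le> 2 * pi * (real N * exp (2 * real N * s) - (norm (deriv k 0))\<^sup>2 * exp (- 2 * s))" if M1: "M \<ge> 1" for M
  proof -
    obtain M' where M': "M = Suc M'" using M1 by (cases M) auto
    let ?t = "\<lambda>n. of_int (e n) * (norm (a n))\<^sup>2 * exp (2 * of_int (e n) * s)"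
    \<comment> \<open>Split off the leading term and the one with exponent -1; every later summand
      is nonpositive.\<close>
    have "(\<Sum>n\<le>M. ?t n) = ?t 0 + (\<Sum>n\<le>M'. ?t (Suc n))"
      unfolding M' by (rule sum.atMost_Suc_shift)
    also have "(\<Sum>n\<le>M'. ?t (Suc n)) = ?t 1 + (\<Sum>n\<in>{..M'} - {0}. ?t (Suc n))"
      by (subst sum.remove[of _ 0]) auto
    also have "(\<Sum>n\<in>{..M'} - {0}. ?t (Suc n)) \<le> 0"
      by (intro sum_nonpos) (simp add: e_def mult_nonneg_nonneg mult_nonpos_nonneg)
    finally have "(\<Sum>n\<le>M. ?t n) \<le> ?t 0 + ?t 1" by simp
    also have "\<dots> = real N * exp (2 * real N * s) - (norm (deriv k 0))\<^sup>2 * exp (- 2 * s)"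
      using c1 by (simp add: e_def a_def)
    finally show ?thesis unfolding val_def by (intro mult_left_mono) auto
  qed
  ultimately have "Re (integral {0..2 * pi} (\<lambda>\<theta>. cnj (u \<theta>) * v \<theta>))
      \<le> 2 * pi * (real N * exp (2 * real N * s) - (norm (deriv k 0))\<^sup>2 * exp (- 2 * s))"
    by (intro LIMSEQ_le_const2) auto
  then show ?thesis unfolding u_def v_def .
qed

section \<open>Faber polynomials\<close>

text \<open>In the coordinate \<zeta> = 1/z the polynomial collects the powers \<zeta>^(j-N) with j
  \<le> N from the Laurent series of H(\<zeta>)/\<zeta>^N. The constant term is included, so the
  remainder is \<zeta> times a holomorphic function.\<close>

lemma polynomial_part_at_infinity:
  fixes H :: "complex \<Rightarrow> complex"
  assumes H: "H holomorphic_on ball 0 r" and r: "r > 0"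
  obtains F where "degree F \<le> N" "coeff F N = H 0"
    "((\<lambda>\<zeta>. poly F (inverse \<zeta>) - H \<zeta> / \<zeta> ^ N) \<longlongrightarrow> 0) (at 0)"
proof -
  define a where "a = (\<lambda>n. (deriv ^^ n) H 0 / fact n)"
  have H_sums: "(\<lambda>n. a n * \<zeta> ^ n) sums H \<zeta>" if "norm \<zeta> < r" for \<zeta>
    using holomorphic_power_series[OF H, of \<zeta>] that by (simp add: a_def)
  define F where "F = (\<Sum>j\<le>N. monom (a j) (N - j))"
  define m where "m = (\<lambda>\<zeta>. if \<zeta> = 0 then a (Suc N) else (H \<zeta> - (\<Sum>i<Suc N. a i * \<zeta> ^ i)) / \<zeta> ^ Suc N)"
  have m_sums: "(\<lambda>n. a (n + Suc N) * \<zeta> ^ n) sums m \<zeta>" if \<zeta>: "norm \<zeta> < r" for \<zeta>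
  proof (cases "\<zeta> = 0")
    case True
    then show ?thesis using powser_sums_zero[of "\<lambda>n. a (n + Suc N)"] by (simp add: m_def)
  next
    case False
    have "(\<lambda>n. a (n + Suc N) * \<zeta> ^ (n + Suc N)) sums (H \<zeta> - (\<Sum>i<Suc N. a i * \<zeta> ^ i))"
      by (rule sums_split_initial_segment[OF H_sums[OF \<zeta>]])
    then have "(\<lambda>n. a (n + Suc N) * \<zeta> ^ (n + Suc N) / \<zeta> ^ Suc N) sums m \<zeta>"
      unfolding m_def using False by (auto dest: sums_divide[where c="\<zeta> ^ Suc N"] simp del: power_Suc)
    moreover have "a (n + Suc N) * \<zeta> ^ (n + Suc N) / \<zeta> ^ Suc N = a (n + Suc N) * \<zeta> ^ n" for n
      using False by (simp add: power_add)
    ultimately show ?thesis by simp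
  qed
  have "m holomorphic_on ball 0 r" by (rule power_series_at_0(1)[OF r m_sums])
  then have "continuous (at 0) m"
    using r by (metis holomorphic_on_imp_continuous_on continuous_on_eq_continuous_at open_ball centre_in_ball)
  then have "(m \<longlongrightarrow> m 0) (at 0)" by (simp add: isCont_def)
  then have lim: "((\<lambda>\<zeta>. - (\<zeta> * m \<zeta>)) \<longlongrightarrow> - (0 * m 0)) (at 0)"
    by (intro tendsto_intros)
  have polyF: "poly F (inverse \<zeta>) - H \<zeta> / \<zeta> ^ N = - (\<zeta> * m \<zeta>)" if "\<zeta> \<noteq> 0" for \<zeta>
  proof -
    have "poly F (inverse \<zeta>) = (\<Sum>j\<le>N. a j * \<zeta> ^ j / \<zeta> ^ N)"
      unfolding F_def poly_sum poly_monom
    proof (rule sum.cong[OF refl])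
      fix j assume "j \<in> {..N}"
      then have "\<zeta> ^ N = \<zeta> ^ j * \<zeta> ^ (N - j)" by (simp flip: power_add)
      then show "a j * inverse \<zeta> ^ (N - j) = a j * \<zeta> ^ j / \<zeta> ^ N"
        using that by (simp add: field_simps power_inverse)
    qed
    also have "\<dots> = (\<Sum>i<Suc N. a i * \<zeta> ^ i) / \<zeta> ^ N"
      by (simp only: sum_divide_distrib lessThan_Suc_atMost)
    finally have P: "poly F (inverse \<zeta>) = (\<Sum>i<Suc N. a i * \<zeta> ^ i) / \<zeta> ^ N" .
    have "\<zeta> * m \<zeta> = (H \<zeta> - (\<Sum>i<Suc N. a i * \<zeta> ^ i)) / \<zeta> ^ N"
      using that by (simp add: m_def)
    then show ?thesis unfolding P by (simp add: diff_divide_distrib)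
  qed
  show thesis
  proof (rule that)
    show "degree F \<le> N"
      unfolding F_def by (intro degree_sum_le) (auto intro: order_trans[OF degree_monom_le])
    have "coeff F N = (\<Sum>j\<le>N. if j = 0 then a 0 else 0)"
      unfolding F_def coeff_sum by (intro sum.cong) auto
    then show "coeff F N = H 0" by (simp add: a_def)
    show "((\<lambda>\<zeta>. poly F (inverse \<zeta>) - H \<zeta> / \<zeta> ^ N) \<longlongrightarrow> 0) (at 0)"
    proof (rule Lim_transform_eventually)
      show "((\<lambda>\<zeta>. - (\<zeta> * m \<zeta>)) \<longlongrightarrow> 0) (at 0)" using lim by simp
      show "\<forall>\<^sub>F \<zeta> in at 0. - (\<zeta> * m \<zeta>) = poly F (inverse \<zeta>) - H \<zeta> / \<zeta> ^ N"
        unfolding eventually_at_filter by (intro always_eventually allI impI polyF[symmetric])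
    qed
  qed
qed

lemma poly_antiderivative:
  fixes F :: "complex poly"
  obtains P where "pderiv P = F"
proof
  let ?P = "\<Sum>i\<le>degree F. monom (coeff F i / of_nat (Suc i)) (Suc i)"
  have "pderiv ?P = (\<Sum>i\<le>degree F. monom (coeff F i) i)"
    unfolding higher_pderiv_sum[where n=1, simplified] by (intro sum.cong) (auto simp: pderiv_monom simp del: of_nat_Suc)
  then show "pderiv ?P = F" by (simp add: poly_as_sum_of_monoms)
qed

context exterior_map
begin

lemma B_tendsto: "(B \<longlongrightarrow> B 0) (at 0)"
proof -
  have "continuous (at 0) B"
    using holo_B by (metis holomorphic_on_imp_continuous_on continuous_on_eq_continuous_at open_ball centre_in_ball zero_less_one)
  then show ?thesis by (simp add: isCont_def)
qed

lemma Psi_inverse_at_infinity: "filterlim (\<lambda>\<zeta>. \<Psi> (inverse \<zeta>)) at_infinity (at 0)"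
proof -
  have 1: "filterlim (\<lambda>\<zeta>. of_real (1 / \<gamma>) * inverse \<zeta>) at_infinity (at (0::complex))"
    by (rule tendsto_mult_filterlim_at_infinity[OF tendsto_const _ filterlim_inverse_at_infinity])
      (use gamma_pos in simp)
  have "filterlim (\<lambda>\<zeta>. B \<zeta> + of_real (1 / \<gamma>) * inverse \<zeta>) at_infinity (at 0)"
    by (rule tendsto_add_filterlim_at_infinity[OF B_tendsto 1])
  moreover have "\<forall>\<^sub>F \<zeta> in at 0. B \<zeta> + of_real (1 / \<gamma>) * inverse \<zeta> = \<Psi> (inverse \<zeta>)"
    unfolding eventually_at_filter by (intro always_eventually allI impI) (simp add: B_def divide_inverse)
  ultimately show ?thesis
    using filterlim_cong[OF refl refl] by metis
qed

lemma holo_Psi_inverse: "(\<lambda>\<zeta>. \<Psi> (inverse \<zeta>)) holomorphic_on ball 0 1 - {0}"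
proof -
  have "(\<Psi> \<circ> inverse) holomorphic_on ball 0 1 - {0}"
  proof (rule holomorphic_on_compose_gen[OF _ holo_Psi])
    show "inverse holomorphic_on ball 0 1 - {0::complex}" by (intro holomorphic_intros) auto
    show "inverse ` (ball 0 1 - {0::complex}) \<subseteq> {w. norm w > 1}"
      by (auto simp: norm_inverse one_less_inverse_iff)
  qed
  then show ?thesis by (simp add: o_def)
qed

text \<open>\<open>F\<close> is the polynomial part of \<Phi>^N at infinity, so F - \<Phi>^N
  vanishes there. Composed with \<open>\<Psi>\<close>, the difference is holomorphic in the
  punctured disc of \<zeta> = 1/w and tends to 0 at the puncture, which is therefore
  removable.\<close>

lemma faber_polynomial_exists:
  obtains F k where "degree F \<le> N" "coeff F N = of_real (\<gamma> ^ N)"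
    "k holomorphic_on ball 0 1" "k 0 = 0"
    "\<And>w. norm w > 1 \<Longrightarrow> poly F (\<Psi> w) = w ^ N + k (inverse w)"
proof -
  obtain h R where h: "R > 1" "h holomorphic_on ball 0 (1 / R)"
    "\<And>z. norm z > R \<Longrightarrow> z \<in> Om \<and> \<Phi> z = of_real \<gamma> * z + h (1 / z)"
    using expansion_at_infinity by blast
  define H where "H = (\<lambda>\<zeta>. (of_real \<gamma> + \<zeta> * h \<zeta>) ^ N)"
  have H: "H holomorphic_on ball 0 (1 / R)"
    unfolding H_def by (intro holomorphic_intros h(2))
  have "1 / R > 0" using h(1) by simp
  then obtain F where F: "degree F \<le> N" "coeff F N = H 0"
    "((\<lambda>\<zeta>. poly F (inverse \<zeta>) - H \<zeta> / \<zeta> ^ N) \<longlongrightarrow> 0) (at 0)"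
    using polynomial_part_at_infinity[OF H] by blast
  have Phi_inv: "\<Phi> (inverse \<zeta>) ^ N = H \<zeta> / \<zeta> ^ N" if "\<zeta> \<noteq> 0" "norm \<zeta> < 1 / R" for \<zeta>
  proof -
    have "R < inverse (norm \<zeta>)" using that h(1) by (simp add: field_simps)
    then have "norm (inverse \<zeta>) > R" by (simp add: norm_inverse)
    then have "\<Phi> (inverse \<zeta>) = (of_real \<gamma> + \<zeta> * h \<zeta>) / \<zeta>"
      using h(3)[of "inverse \<zeta>"] that by (simp add: field_simps)
    then show ?thesis by (simp add: H_def power_divide)
  qed
  have "((\<lambda>\<zeta>. poly F (inverse \<zeta>) - \<Phi> (inverse \<zeta>) ^ N) \<longlongrightarrow> 0) (at 0)"
  proof (rule Lim_transform_eventually[OF F(3)])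
    have "\<forall>\<^sub>F \<zeta> in at 0. norm \<zeta> < 1 / R"
      using h(1) by (intro order_tendstoD(2)[OF tendsto_norm_zero]) (auto intro: tendsto_ident_at)
    moreover have "\<forall>\<^sub>F \<zeta> in at (0::complex). \<zeta> \<noteq> 0"
      by (simp add: eventually_at_filter)
    ultimately show "\<forall>\<^sub>F \<zeta> in at 0. poly F (inverse \<zeta>) - H \<zeta> / \<zeta> ^ N = poly F (inverse \<zeta>) - \<Phi> (inverse \<zeta>) ^ N"
      by eventually_elim (simp add: Phi_inv)
  qed
  then have lim: "((\<lambda>z. poly F z - \<Phi> z ^ N) \<longlongrightarrow> 0) at_infinity"
    by (subst lim_at_infinity_0) (simp add: o_def)
  define k0 where "k0 = (\<lambda>\<zeta>. poly F (\<Psi> (inverse \<zeta>)) - inverse \<zeta> ^ N)"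
  have k0_holo: "k0 holomorphic_on ball 0 1 - {0}"
    unfolding k0_def
    by (intro holomorphic_intros holo_Psi_inverse) auto
  have "((\<lambda>\<zeta>. poly F (\<Psi> (inverse \<zeta>)) - \<Phi> (\<Psi> (inverse \<zeta>)) ^ N) \<longlongrightarrow> 0) (at 0)"
    by (rule filterlim_compose[OF lim Psi_inverse_at_infinity])
  then have k0_lim: "(k0 \<longlongrightarrow> 0) (at 0)"
  proof (rule Lim_transform_eventually)
    have "\<forall>\<^sub>F \<zeta> in at 0. norm \<zeta> < (1::real)"
      by (intro order_tendstoD(2)[OF tendsto_norm_zero]) (auto intro: tendsto_ident_at)
    moreover have "\<forall>\<^sub>F \<zeta> in at (0::complex). \<zeta> \<noteq> 0"
      by (simp add: eventually_at_filter)
    ultimately show "\<forall>\<^sub>F \<zeta> in at 0. poly F (\<Psi> (inverse \<zeta>)) - \<Phi> (\<Psi> (inverse \<zeta>)) ^ N = k0 \<zeta>"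
      by eventually_elim (simp add: k0_def Phi_Psi norm_inverse one_less_inverse_iff)
  qed
  define k where "k = (\<lambda>\<zeta>. if \<zeta> = 0 then 0 else k0 \<zeta>)"
  show thesis
  proof (rule that)
    show "degree F \<le> N" "coeff F N = of_real (\<gamma> ^ N)"
      using F by (simp_all add: H_def)
    show "k holomorphic_on ball 0 1"
      unfolding k_def by (rule removable_singularity[OF k0_holo open_ball k0_lim])
    show "k 0 = 0" by (simp add: k_def)
    show "poly F (\<Psi> w) = w ^ N + k (inverse w)" if "norm w > 1" for w
      using that by (auto simp: k_def k0_def)
  qed
qed

text \<open>
  The residue at \<open>0\<close> of the derivative of \<open>\<Psi> (1 / \<zeta>) \<zeta>\<^sup>-\<^sup>N - P (\<Psi> (1 / \<zeta>))\<close>, where \<open>P' = F\<close>,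
  vanishes. This is the symmetry of the Grunsky matrix in its first column.
\<close>

lemma faber_first_coefficient:
  fixes F :: "complex poly"
  assumes k: "k holomorphic_on ball 0 1" "k 0 = 0"
    and F: "\<And>w. norm w > 1 \<Longrightarrow> poly F (\<Psi> w) = w ^ N + k (inverse w)"
  shows "deriv k 0 = of_nat N * of_real \<gamma> * b N"
proof -
  obtain P where P: "pderiv P = F" by (rule poly_antiderivative)
  define S where "S = ball (0::complex) 1 - {0}"
  define psi where "psi = (\<lambda>\<zeta>. inverse \<zeta> / of_real \<gamma> + B \<zeta>)"
  define psi' where "psi' = (\<lambda>\<zeta>. - (inverse \<zeta> ^ 2) / of_real \<gamma> + deriv B \<zeta>)"
  define W where "W = (\<lambda>\<zeta>. psi \<zeta> * inverse \<zeta> ^ N - poly P (psi \<zeta>))"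
  have S1: "norm (inverse \<zeta>) > 1" "\<zeta> \<noteq> 0" "\<zeta> \<in> ball 0 1" if "\<zeta> \<in> S" for \<zeta>
    using that by (auto simp: S_def norm_inverse one_less_inverse_iff)
  have psi: "psi \<zeta> = \<Psi> (inverse \<zeta>)" if "\<zeta> \<in> S" for \<zeta>
    using Psi_conv_B[OF S1(1)[OF that]] by (simp add: psi_def divide_inverse)
  have F_psi: "poly F (psi \<zeta>) = inverse \<zeta> ^ N + k \<zeta>" if "\<zeta> \<in> S" for \<zeta>
    using F[OF S1(1)[OF that]] psi[OF that] by simp
  have dB: "(B has_field_derivative deriv B \<zeta>) (at \<zeta>)" if "\<zeta> \<in> ball 0 1" for \<zeta>
    using holo_B open_ball that by (rule holomorphic_derivI)
  have dpsi: "(psi has_field_derivative psi' \<zeta>) (at \<zeta>)" if "\<zeta> \<in> S" for \<zeta>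
    unfolding psi_def psi'_def using S1[OF that] gamma_pos
    by (auto intro!: derivative_eq_intros dB simp: power2_eq_square divide_inverse)
  \<comment> \<open>In the derivative of \<open>W\<close> the term
    \<open>psi' * inverse \<zeta> ^ N\<close> cancels against the same term in
    \<open>poly F (psi \<zeta>) * psi'\<close>, leaving only \<open>k\<close>.\<close>
  have dW: "(W has_field_derivative
      - (of_nat N * inverse \<zeta> ^ Suc N) * psi \<zeta> - k \<zeta> * psi' \<zeta>) (at \<zeta>)" if "\<zeta> \<in> S" for \<zeta>
  proof -
    have inv: "((\<lambda>\<zeta>. inverse \<zeta> ^ N) has_field_derivative - (of_nat N * inverse \<zeta> ^ Suc N)) (at \<zeta>)"
    proof (cases N)
      case 0
      then show ?thesis by simp
    next
      case (Suc M)
      show ?thesis unfolding Suc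
        by (rule DERIV_cong[OF DERIV_power_Suc[OF DERIV_inverse[OF S1(2)[OF that]]]]) (simp add: algebra_simps)
    qed
    have "(W has_field_derivative psi' \<zeta> * inverse \<zeta> ^ N + - (of_nat N * inverse \<zeta> ^ Suc N) * psi \<zeta>
        - poly F (psi \<zeta>) * psi' \<zeta>) (at \<zeta>)"
      unfolding W_def
      by (intro DERIV_diff DERIV_mult[OF dpsi[OF that] inv, THEN DERIV_cong]
          DERIV_chain2[OF poly_DERIV[of P, unfolded P] dpsi[OF that]]) simp
    then show ?thesis unfolding F_psi[OF that]
      by (rule DERIV_cong) (simp add: algebra_simps)
  qed
  let ?C = "circlepath (0::complex) (1/2)"
  have C_sub: "path_image ?C \<subseteq> S" by (auto simp: S_def)
  have zero: "((\<lambda>\<zeta>. - (of_nat N * inverse \<zeta> ^ Suc N) * psi \<zeta> - k \<zeta> * psi' \<zeta>) has_contour_integral 0) ?C"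
    by (rule Cauchy_theorem_primitive[OF has_field_derivative_at_within[OF dW] _ C_sub]) auto
  have disc: "ball 0 (1/2) \<subseteq> ball (0::complex) 1" "cball 0 (1/2) \<subseteq> ball (0::complex) 1" by auto
  note cont = holomorphic_on_imp_continuous_on[OF holomorphic_on_subset[OF _ disc(2)]]
  note holo = holomorphic_on_subset[OF _ disc(1)]
  \<comment> \<open>Inserting psi = 1/(\<gamma> \<zeta>) + B splits the derivative of
    \<open>W\<close> into four terms. Only B/\<zeta>^(N+1) and k/\<zeta>^2 can have a residue,
    namely \<open>b N\<close> and \<open>deriv k 0\<close>; the other two are a pure higher pole and
    a holomorphic function.\<close>
  have I1: "((\<lambda>\<zeta>. of_nat N / of_real \<gamma> / (\<zeta> - 0) ^ Suc (Suc N)) has_contour_integral 0) ?C"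
    using Cauchy_has_contour_integral_higher_derivative_circlepath
      [of 0 "1/2" "\<lambda>_. of_nat N / of_real \<gamma>" 0 "Suc N"] by (simp add: higher_deriv_const)
  have I2: "((\<lambda>\<zeta>. B \<zeta> / (\<zeta> - 0) ^ Suc N) has_contour_integral (2 * pi * \<i>) * b N) ?C"
    using Cauchy_has_contour_integral_higher_derivative_circlepath[OF cont[OF holo_B] holo[OF holo_B], of 0 N]
      B_coeff[of N] by (simp add: field_simps)
  have I3: "((\<lambda>\<zeta>. k \<zeta> / (\<zeta> - 0) ^ Suc 1) has_contour_integral (2 * pi * \<i>) * deriv k 0) ?C"
    using Cauchy_has_contour_integral_higher_derivative_circlepath[OF cont[OF k(1)] holo[OF k(1)], of 0 1]
    by simp
  have kB: "(\<lambda>\<zeta>. k \<zeta> * deriv B \<zeta>) holomorphic_on ball 0 1"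
    by (intro holomorphic_intros k(1) holomorphic_deriv[OF holo_B]) auto
  have I4: "((\<lambda>\<zeta>. k \<zeta> * deriv B \<zeta>) has_contour_integral 0) ?C"
    by (rule Cauchy_theorem_convex_simple[OF kB]) auto
  have "((\<lambda>\<zeta>. - (of_nat N / of_real \<gamma> / (\<zeta> - 0) ^ Suc (Suc N)) - of_nat N * (B \<zeta> / (\<zeta> - 0) ^ Suc N)
        + of_real (1 / \<gamma>) * (k \<zeta> / (\<zeta> - 0) ^ Suc 1) - k \<zeta> * deriv B \<zeta>) has_contour_integral
      - 0 - of_nat N * ((2 * pi * \<i>) * b N) + of_real (1 / \<gamma>) * ((2 * pi * \<i>) * deriv k 0) - 0) ?C"
    by (intro has_contour_integral_diff has_contour_integral_add has_contour_integral_neg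
        has_contour_integral_lmul I1 I2 I3 I4)
  moreover have "- (of_nat N / of_real \<gamma> / (\<zeta> - 0) ^ Suc (Suc N)) - of_nat N * (B \<zeta> / (\<zeta> - 0) ^ Suc N)
        + of_real (1 / \<gamma>) * (k \<zeta> / (\<zeta> - 0) ^ Suc 1) - k \<zeta> * deriv B \<zeta>
      = - (of_nat N * inverse \<zeta> ^ Suc N) * psi \<zeta> - k \<zeta> * psi' \<zeta>" if "\<zeta> \<in> path_image ?C" for \<zeta>
    unfolding psi_def psi'_def by (simp add: divide_inverse power_inverse algebra_simps power2_eq_square)
  ultimately have "((\<lambda>\<zeta>. - (of_nat N * inverse \<zeta> ^ Suc N) * psi \<zeta> - k \<zeta> * psi' \<zeta>) has_contour_integral
      - 0 - of_nat N * ((2 * pi * \<i>) * b N) + of_real (1 / \<gamma>) * ((2 * pi * \<i>) * deriv k 0) - 0) ?C"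
    by (rule has_contour_integral_eq)
  from has_contour_integral_unique[OF this zero]
  have "(2 * pi * \<i>) * (of_real (1 / \<gamma>) * deriv k 0) = (2 * pi * \<i>) * (of_nat N * b N)"
    by (simp add: algebra_simps)
  then have "of_real (1 / \<gamma>) * deriv k 0 = of_nat N * b N"
    by (subst (asm) mult_cancel_left) simp
  then show ?thesis using gamma_pos by (simp add: field_simps)
qed

text \<open>The collar bound holds for every \<sigma> > 0; \<sigma> then tends to 0 from the right.
  The exponents 4 N \<sigma> and -4 \<sigma> come from s \<le> 2\<sigma> on the collar.\<close>

lemma faber_energy_le:
  fixes F :: "complex poly"
  assumes G: "open G"
    and k: "k holomorphic_on ball 0 1" "k 0 = 0"
    and F: "\<And>w. norm w > 1 \<Longrightarrow> poly F (\<Psi> w) = w ^ N + k (inverse w)"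
  shows "(LINT z:G|lebesgue. (norm (poly (pderiv F) z))\<^sup>2) \<le> pi * (real N - (norm (deriv k 0))\<^sup>2)"
proof -
  let ?E = "(LINT z:G|lebesgue. (norm (poly (pderiv F) z))\<^sup>2)"
  have F_strip: "poly F (strip \<zeta>) = exp (of_nat N * \<zeta>) + k (exp (- \<zeta>))" if "Re \<zeta> > 0" for \<zeta>
    using F[OF strip_facts(1)[OF that]] by (simp add: strip_def exp_of_nat_mult exp_minus)
  have dF: "poly (pderiv F) (strip \<zeta>) * strip' \<zeta> = of_nat N * exp (of_nat N * \<zeta>) - deriv k (exp (- \<zeta>)) * exp (- \<zeta>)"
    if "Re \<zeta> > 0" for \<zeta>
  proof -
    have 1: "((\<lambda>\<zeta>. poly F (strip \<zeta>)) has_field_derivative poly (pderiv F) (strip \<zeta>) * strip' \<zeta>) (at \<zeta>)"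
      by (rule DERIV_chain2[OF poly_DERIV strip_facts(4)[OF that]])
    have dk: "(k has_field_derivative deriv k (exp (- \<zeta>))) (at (exp (- \<zeta>)))"
      by (rule holomorphic_derivI[OF k(1) open_ball]) (use that in simp)
    have "((\<lambda>\<zeta>. exp (of_nat N * \<zeta>) + k (exp (- \<zeta>))) has_field_derivative
        of_nat N * exp (of_nat N * \<zeta>) + deriv k (exp (- \<zeta>)) * (- exp (- \<zeta>))) (at \<zeta>)"
      by (intro DERIV_add DERIV_chain2[where f=k and g="\<lambda>\<zeta>. exp (- \<zeta>)", OF dk]) (auto intro!: derivative_eq_intros)
    then have "((\<lambda>\<zeta>. poly F (strip \<zeta>)) has_field_derivative
        of_nat N * exp (of_nat N * \<zeta>) + deriv k (exp (- \<zeta>)) * (- exp (- \<zeta>))) (at \<zeta>)"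
    proof (rule has_field_derivative_transform_within_open)
      show "open {\<zeta>. Re \<zeta> > 0}" by (intro open_Collect_less continuous_intros)
    qed (use that F_strip in auto)
    from DERIV_unique[OF 1 this] show ?thesis by simp
  qed
  have bound: "?E \<le> pi * (real N * exp (4 * real N * \<sigma>) - (norm (deriv k 0))\<^sup>2 * exp (- 4 * \<sigma>))" if \<sigma>: "\<sigma> > 0" for \<sigma>
  proof -
    have "?E \<le> (2 * pi * (real N * exp (4 * real N * \<sigma>) - (norm (deriv k 0))\<^sup>2 * exp (- 4 * \<sigma>))) / 2"
    proof (rule energy_le[OF G \<sigma>])
      fix s assume s: "s \<in> {\<sigma>..2 * \<sigma>}"
      then have s0: "s > 0" using \<sigma> by auto
      have "circle_mean (\<lambda>z. cnj (poly F z) * poly (pderiv F) z) s =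
        integral {0..2 * pi} (\<lambda>\<theta>. cnj (exp (of_nat N * Complex s \<theta>) + k (exp (- Complex s \<theta>))) *
           (of_nat N * exp (of_nat N * Complex s \<theta>) - deriv k (exp (- Complex s \<theta>)) * exp (- Complex s \<theta>)))"
        unfolding circle_mean_def mult.assoc using F_strip dF s0 by simp
      then have "Re (circle_mean (\<lambda>z. cnj (poly F z) * poly (pderiv F) z) s)
         \<le> 2 * pi * (real N * exp (2 * real N * s) - (norm (deriv k 0))\<^sup>2 * exp (- 2 * s))"
        using circle_energy_le[OF k s0, of N] by simp
      also have "\<dots> \<le> 2 * pi * (real N * exp (4 * real N * \<sigma>) - (norm (deriv k 0))\<^sup>2 * exp (- 4 * \<sigma>))"
      proof -
        have "2 * real N * s \<le> 4 * real N * \<sigma>"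
          using mult_left_mono[of s "2 * \<sigma>" "2 * real N"] s by simp
        then show ?thesis
          using s by (intro mult_left_mono diff_mono mult_left_mono) auto
      qed
      finally show "Re (circle_mean (\<lambda>z. cnj (poly F z) * poly (pderiv F) z) s)
         \<le> 2 * pi * (real N * exp (4 * real N * \<sigma>) - (norm (deriv k 0))\<^sup>2 * exp (- 4 * \<sigma>))" .
    qed
    then show ?thesis by simp
  qed
  have "((\<lambda>\<sigma>. pi * (real N * exp (4 * real N * \<sigma>) - (norm (deriv k 0))\<^sup>2 * exp (- 4 * \<sigma>)))
      \<longlongrightarrow> pi * (real N * exp (4 * real N * 0) - (norm (deriv k 0))\<^sup>2 * exp (- 4 * 0))) (at_right 0)"
    by (intro tendsto_intros)
  moreover have "\<forall>\<^sub>F \<sigma> in at_right 0. ?E \<le> pi * (real N * exp (4 * real N * \<sigma>) - (norm (deriv k 0))\<^sup>2 * exp (- 4 * \<sigma>))"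
    using bound by (auto simp: eventually_at_right_field intro: exI[of _ 1])
  ultimately have "?E \<le> pi * (real N * exp (4 * real N * 0) - (norm (deriv k 0))\<^sup>2 * exp (- 4 * 0))"
    by (intro tendsto_lowerbound[where F="at_right 0"]) auto
  then show ?thesis by simp
qed

end

section \<open>Extremality of the Bergman polynomials\<close>

lemma set_integrable_continuous_bounded:
  fixes f :: "complex \<Rightarrow> 'a::euclidean_space"
  assumes G: "open G" "bounded G" and f: "continuous_on UNIV f"
  shows "set_integrable lebesgue G f"
proof -
  obtain R where R: "G \<subseteq> ball 0 R" using bounded_subset_ballD[OF G(2), of 0] by blast
  have "G \<subseteq> square R" using R cball_subset_square[of R] ball_subset_cball[of 0 R] by blast
  then have "set_integrable lborel G f"
    using set_integrable_subset[OF continuous_set_integrable_square[OF f], of G R] G by simp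
  then show ?thesis
    using set_lebesgue_integral_lborel_eq(2)[of G f] G borel_measurable_continuous_onI[OF f] by simp
qed

text \<open>\<open>P\<close> is A p_n + q with q orthogonal to p_n, where A is the quotient of the
  leading coefficients; by Pythagoras |A|^2 is at most the squared norm of \<open>P\<close>.\<close>

lemma bergman_norm_ge:
  assumes G: "open G" "bounded G" and p: "bergman_polynomials G p lam" and P: "degree P \<le> n"
  shows "(norm (coeff P n))\<^sup>2 / (lam n)\<^sup>2 \<le> (LINT z:G|lebesgue. (norm (poly P z))\<^sup>2)"
proof -
  define ip where "ip = (\<lambda>P Q. bergman_inner G (poly P) (poly Q))"
  have int: "set_integrable lebesgue G (\<lambda>z. poly P z * cnj (poly Q z))" for P Q
    by (rule set_integrable_continuous_bounded[OF G]) (intro continuous_intros)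
  have add: "ip (P + Q) S = ip P S + ip Q S" for P Q S
    unfolding ip_def bergman_inner_def poly_add ring_distribs
    by (rule set_integral_add[OF int int])
  have smult: "ip (smult c P) S = c * ip P S" for c P S
    unfolding ip_def bergman_inner_def by (simp add: mult.assoc)
  have cnj: "ip Q P = cnj (ip P Q)" for P Q
  proof -
    have "ip Q P = (LINT z|lebesgue. cnj (indicator G z *\<^sub>R (poly P z * cnj (poly Q z))))"
      unfolding ip_def bergman_inner_def set_lebesgue_integral_def by (simp add: mult.commute)
    also have "\<dots> = cnj (ip P Q)"
      unfolding ip_def bergman_inner_def set_lebesgue_integral_def by (rule Bochner_Integration.integral_cnj)
    finally show ?thesis .
  qed
  have lead: "coeff (p m) m = of_real (lam m)" "lam m > 0" "degree (p m) = m" for m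
    using p unfolding bergman_polynomials_def by (metis)+
  have ortho: "ip (p m) (p n) = (if m = n then 1 else 0)" for m n
    using p unfolding bergman_polynomials_def ip_def by blast
  \<comment> \<open>Induction on a number \<open>m\<close> from which all coefficients vanish,
    rather than on the degree, so that the base case is the zero polynomial; a multiple of
    \<open>p m\<close> removes the coefficient of index \<open>m\<close>.\<close>
  have perp: "ip q (p n) = 0" if "\<And>i. i \<ge> m \<Longrightarrow> coeff q i = 0" "m \<le> n" for m q
    using that
  proof (induction m arbitrary: q)
    case 0
    then have "q = 0" by (simp add: poly_eq_iff)
    then show ?case by (simp add: ip_def bergman_inner_def set_lebesgue_integral_def)
  next
    case (Suc m)
    define c where "c = coeff q m / of_real (lam m)"
    define q' where "q' = q - smult c (p m)"
    have "coeff q' i = 0" if "i \<ge> m" for i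
    proof (cases "i = m")
      case True
      then show ?thesis using lead[of m] by (simp add: q'_def c_def)
    next
      case False
      then have "coeff q i = 0" "coeff (p m) i = 0"
        using Suc.prems(1)[of i] that lead(3)[of m] by (auto intro: coeff_eq_0)
      then show ?thesis by (simp add: q'_def)
    qed
    then have "ip q' (p n) = 0" using Suc.IH[of q'] Suc.prems(2) by simp
    moreover have "q = smult c (p m) + q'" by (simp add: q'_def)
    moreover have "ip (p m) (p n) = 0" using ortho[of m n] Suc.prems(2) by simp
    ultimately show ?case by (metis add smult add_0_right mult_zero_right)
  qed
  define A where "A = coeff P n / of_real (lam n)"
  define q where "q = P - smult A (p n)"
  have Pq: "P = smult A (p n) + q" by (simp add: q_def)
  have "coeff q i = 0" if "i \<ge> n" for i
  proof (cases "i = n")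
    case True
    then show ?thesis using lead[of n] by (simp add: q_def A_def)
  next
    case False
    then have "coeff P i = 0" "coeff (p n) i = 0"
      using P that lead(3)[of n] by (auto intro: coeff_eq_0)
    then show ?thesis by (simp add: q_def)
  qed
  then have q0: "ip q (p n) = 0" by (rule perp) auto
  have q0': "ip (p n) q = 0" using cnj[of "p n" q] q0 by simp
  have right: "ip S (smult A (p n) + q) = cnj A * ip S (p n) + ip S q" for S
    using cnj[of S "smult A (p n) + q"] cnj[of S "p n"] cnj[of S q] add smult by simp
  have "ip P P = A * (cnj A * 1 + 0) + (cnj A * 0 + ip q q)"
    by (subst (1 2) Pq) (simp add: add smult right q0 q0' ortho)
  then have ipP: "ip P P = of_real ((norm A)\<^sup>2) + ip q q"
    by (simp only: complex_norm_square add_0_right mult_zero_right mult_1_right add_0_left)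
  have sq: "ip Q Q = of_real (LINT z:G|lebesgue. (norm (poly Q z))\<^sup>2)" for Q
    unfolding ip_def bergman_inner_def complex_norm_square[symmetric]
    by (rule set_integral_complex_of_real)
  have "(LINT z:G|lebesgue. (norm (poly P z))\<^sup>2) = (norm A)\<^sup>2 + (LINT z:G|lebesgue. (norm (poly q z))\<^sup>2)"
    using ipP unfolding sq by (simp only: of_real_add[symmetric] of_real_eq_iff)
  moreover have "(LINT z:G|lebesgue. (norm (poly q z))\<^sup>2) \<ge> 0"
    unfolding set_lebesgue_integral_def by (rule integral_nonneg_AE) auto
  ultimately show ?thesis
    using lead(2)[of n] by (simp add: A_def norm_divide power_divide)
qed

context exterior_map
begin

text \<open>The competitor for p_n is the derivative of the Faber polynomial of index n + 1, with
  leading coefficient (n+1) \<gamma>^(n+1). The energy bound is then divided by (n+1) pi.\<close>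

lemma leading_coefficient_bound:
  assumes G: "open G" and p: "bergman_polynomials G p lam"
  shows "real (Suc n) / pi * (\<gamma> ^ (2 * Suc n) / (lam n)\<^sup>2) \<le> 1 - real (Suc n) * \<gamma>\<^sup>2 * (norm (b (Suc n)))\<^sup>2"
proof -
  let ?N = "Suc n"
  obtain F k where F: "degree F \<le> ?N" "coeff F ?N = of_real (\<gamma> ^ ?N)"
    and k: "k holomorphic_on ball 0 1" "k 0 = 0"
    and Fk: "\<And>w. norm w > 1 \<Longrightarrow> poly F (\<Psi> w) = w ^ ?N + k (inverse w)"
    using faber_polynomial_exists by blast
  have "norm (deriv k 0) = norm (of_nat ?N * of_real \<gamma> * b ?N)"
    using faber_first_coefficient[OF k Fk] by (rule arg_cong)
  then have "norm (deriv k 0) = real ?N * \<gamma> * norm (b ?N)"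
    using gamma_pos by (simp add: norm_mult del: of_nat_Suc)
  then have dk: "(norm (deriv k 0))\<^sup>2 = (real ?N)\<^sup>2 * \<gamma>\<^sup>2 * (norm (b ?N))\<^sup>2"
    by (simp only: power_mult_distrib)
  have cf: "(norm (coeff (pderiv F) n))\<^sup>2 = (real ?N)\<^sup>2 * \<gamma> ^ (2 * ?N)"
    unfolding coeff_pderiv F(2) using gamma_pos
    by (simp add: norm_mult norm_power power_mult_distrib power_mult[symmetric] mult.commute del: of_nat_Suc power_Suc)
  have "(real ?N)\<^sup>2 * \<gamma> ^ (2 * ?N) / (lam n)\<^sup>2 \<le> pi * (real ?N - (real ?N)\<^sup>2 * \<gamma>\<^sup>2 * (norm (b ?N))\<^sup>2)"
  proof -
    have d: "degree (pderiv F) \<le> n" using F(1) by (simp add: degree_pderiv)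
    show ?thesis
      using order_trans[OF bergman_norm_ge[OF G bounded_G p d] faber_energy_le[OF G k Fk]]
      unfolding cf dk .
  qed
  also have "\<dots> = (real ?N * pi) * (1 - real ?N * \<gamma>\<^sup>2 * (norm (b ?N))\<^sup>2)"
    by (simp add: algebra_simps power2_eq_square del: of_nat_Suc)
  finally have "(real ?N * pi) * (real ?N / pi * (\<gamma> ^ (2 * ?N) / (lam n)\<^sup>2))
      \<le> (real ?N * pi) * (1 - real ?N * \<gamma>\<^sup>2 * (norm (b ?N))\<^sup>2)"
    by (simp add: power2_eq_square algebra_simps del: of_nat_Suc power_Suc)
  then show ?thesis
    by (rule mult_left_le_imp_le) simp
qed

text \<open>Minus the derivative of 1/\<Phi>, a conformal map of the finite exterior into the unit
  disc. It decays like 1/(\<gamma> z^2) at infinity.\<close>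

definition "phi z = deriv \<Phi> z / (\<Phi> z)\<^sup>2"

lemma holo_phi: "phi holomorphic_on Om"
  unfolding phi_def[abs_def]
  by (intro holomorphic_intros holo_Phi holomorphic_deriv[OF holo_Phi open_Om]) (simp add: Phi_nonzero)

lemma phi_L2:
  assumes V: "V \<subseteq> Om" "V \<in> sets lebesgue"
  shows "(\<lambda>z. (norm (phi z))\<^sup>2) absolutely_integrable_on V"
    and "integral V (\<lambda>z. (norm (phi z))\<^sup>2) \<le> pi"
proof -
  define g where "g = (\<lambda>z. inverse (\<Phi> z))"
  have der: "(g has_derivative (*) (- phi z)) (at z within V)" if "z \<in> V" for z
  proof -
    have zO: "z \<in> Om" using that V by blast
    have "(g has_field_derivative - phi z) (at z)"
      unfolding g_def phi_def
      by (rule DERIV_cong[OF DERIV_inverse'[OF Phi_field_derivative[OF zO] Phi_nonzero[OF zO]]])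
        (simp add: field_simps power2_eq_square)
    then show ?thesis by (simp add: has_field_derivative_def has_derivative_at_withinI)
  qed
  have inj: "inj_on g V"
    unfolding g_def using inj_on_subset[OF inj_Phi V(1)] by (auto simp: inj_on_def)
  have sub: "g ` V \<subseteq> ball 0 1"
    using Phi_gt_1 V by (auto simp: g_def norm_inverse inverse_less_1_iff)
  have meas: "g ` V \<in> sets lebesgue"
    by (rule differentiable_image_in_sets_lebesgue[OF V(2)])
      (use der in \<open>auto simp: differentiable_on_def differentiable_def\<close>)
  have lm: "g ` V \<in> lmeasurable"
    by (rule fmeasurableI2[OF lmeasurable_ball sub meas])
  have J: "\<bar>real_jacobian ((*) (- phi z))\<bar> = (norm (phi z))\<^sup>2" for z
    unfolding real_jacobian_def cmod_power2 by (simp add: power2_eq_square)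
  note im = has_measure_differentiable_image_complex[OF V(2) der inj lm, unfolded J]
  show "(\<lambda>z. (norm (phi z))\<^sup>2) absolutely_integrable_on V" by (rule im(1))
  have "integral V (\<lambda>z. (norm (phi z))\<^sup>2) = measure lebesgue (g ` V)" by (rule im(2))
  also have "\<dots> \<le> measure lebesgue (ball (0::complex) 1)"
    by (rule measure_mono_fmeasurable[OF sub meas lmeasurable_ball])
  also have "\<dots> = pi"
    using content_ball[of 1 "0::complex"] by (simp add: unit_ball_vol_2)
  finally show "integral V (\<lambda>z. (norm (phi z))\<^sup>2) \<le> pi" .
qed

lemma phi_at_infinity: "((\<lambda>z. z\<^sup>2 * phi z) \<longlongrightarrow> of_real (1 / \<gamma>)) at_infinity"
proof -
  obtain h R where h: "R > 1" "h holomorphic_on ball 0 (1 / R)"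
    "\<And>z. norm z > R \<Longrightarrow> z \<in> Om \<and> \<Phi> z = of_real \<gamma> * z + h (1 / z)"
    using expansion_at_infinity by blast
  have R1: "0 \<in> ball (0::complex) (1 / R)" using h(1) by simp
  have c: "isCont h 0" "isCont (deriv h) 0"
    using holomorphic_on_imp_continuous_on[OF h(2)] R1
      holomorphic_on_imp_continuous_on[OF holomorphic_deriv[OF h(2) open_ball]]
    by (auto simp: continuous_on_eq_continuous_at)
  have inv: "(inverse \<longlongrightarrow> 0) (at_infinity :: complex filter)"
    by (rule tendsto_inverse_0)
  have big: "\<forall>\<^sub>F z in (at_infinity :: complex filter). norm z > R"
    by (auto simp: eventually_at_infinity intro: exI[of _ "R + 1"])
  have limh: "((\<lambda>z. h (inverse z)) \<longlongrightarrow> h 0) at_infinity" "((\<lambda>z. deriv h (inverse z)) \<longlongrightarrow> deriv h 0) at_infinity"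
    using isCont_tendsto_compose[OF c(1) inv] isCont_tendsto_compose[OF c(2) inv] by simp_all
  have dPhi: "deriv \<Phi> z = of_real \<gamma> - deriv h (inverse z) * inverse z ^ 2" if z: "norm z > R" for z
  proof (rule DERIV_imp_deriv)
    have z0: "z \<noteq> 0" using z h(1) by auto
    have "norm (inverse z) < 1 / R"
    proof -
      have "inverse (norm z) < inverse R" using z h(1) by (intro less_imp_inverse_less) auto
      then show ?thesis unfolding norm_inverse by (simp add: inverse_eq_divide)
    qed
    then have dh: "(h has_field_derivative deriv h (inverse z)) (at (inverse z))"
      by (intro holomorphic_derivI[OF h(2) open_ball]) simp
    have "((\<lambda>z. of_real \<gamma> * z + h (inverse z)) has_field_derivative
        of_real \<gamma> * 1 + deriv h (inverse z) * - (inverse z ^ Suc (Suc 0))) (at z)"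
      by (intro DERIV_add DERIV_cmult DERIV_ident DERIV_chain2[where f=h and g=inverse, OF dh] DERIV_inverse z0)
    then show "(\<Phi> has_field_derivative of_real \<gamma> - deriv h (inverse z) * inverse z ^ 2) (at z)"
    proof (rule has_field_derivative_transform_within_open[THEN DERIV_cong])
      show "open {z::complex. norm z > R}" by (rule open_outer_disc)
      show "of_real \<gamma> * x + h (inverse x) = \<Phi> x" if "x \<in> {z. norm z > R}" for x
        using h(3)[of x] that by (simp add: divide_inverse)
    qed (use z in \<open>auto simp: power2_eq_square\<close>)
  qed
  have "((\<lambda>z. (of_real \<gamma> - deriv h (inverse z) * inverse z ^ 2) / (of_real \<gamma> + h (inverse z) * inverse z)\<^sup>2)
      \<longlongrightarrow> (of_real \<gamma> - deriv h 0 * 0 ^ 2) / (of_real \<gamma> + h 0 * 0)\<^sup>2) at_infinity"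
    by (intro tendsto_intros limh inv) (use gamma_pos in auto)
  moreover have "\<forall>\<^sub>F z in at_infinity. (of_real \<gamma> - deriv h (inverse z) * inverse z ^ 2) / (of_real \<gamma> + h (inverse z) * inverse z)\<^sup>2
      = z\<^sup>2 * phi z"
    using big
  proof eventually_elim
    fix z :: complex assume z: "norm z > R"
    then have z0: "z \<noteq> 0" using h(1) by auto
    have P: "\<Phi> z = z * (of_real \<gamma> + h (inverse z) * inverse z)"
      using h(3)[OF z] z0 by (simp add: algebra_simps divide_inverse)
    show "(of_real \<gamma> - deriv h (inverse z) * inverse z ^ 2) / (of_real \<gamma> + h (inverse z) * inverse z)\<^sup>2
      = z\<^sup>2 * phi z"
      unfolding phi_def dPhi[OF z] P power_mult_distrib using z0 by simp
  qed
  ultimately have "((\<lambda>z. z\<^sup>2 * phi z) \<longlongrightarrow> (of_real \<gamma> - deriv h 0 * 0 ^ 2) / (of_real \<gamma> + h 0 * 0)\<^sup>2) at_infinity"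
    by (rule Lim_transform_eventually)
  then show ?thesis using gamma_pos by (simp add: power2_eq_square)
qed

end

section \<open>Boundary integrals over large squares\<close>

lemma box_boundary_integral_inverse:
  assumes "R > 0" shows "box_boundary_integral R inverse = 2 * pi"
proof -
  have I: "((\<lambda>t. 2 * R / (R\<^sup>2 + t\<^sup>2)) has_integral pi) {-R..R}"
  proof -
    have "((\<lambda>t. 2 * R / (R\<^sup>2 + t\<^sup>2)) has_integral 2 * arctan (R / R) - 2 * arctan ((-R) / R)) {-R..R}"
    proof (rule fundamental_theorem_of_calculus)
      fix x :: real
      have "((\<lambda>t. 2 * arctan (t / R)) has_real_derivative 2 * (inverse (1 + (x / R)\<^sup>2) * (1 / R))) (at x)"
        by (intro DERIV_cmult DERIV_chain2[OF DERIV_arctan]) (use assms in \<open>auto intro!: derivative_eq_intros\<close>)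
      moreover have "2 * (inverse (1 + (x / R)\<^sup>2) * (1 / R)) = 2 * R / (R\<^sup>2 + x\<^sup>2)"
        using assms by (simp add: field_simps power2_eq_square)
      ultimately show "((\<lambda>t. 2 * arctan (t / R)) has_vector_derivative 2 * R / (R\<^sup>2 + x\<^sup>2)) (at x within {-R..R})"
        by (auto simp: has_real_derivative_iff_has_vector_derivative intro: has_vector_derivative_at_within)
    qed (use assms in simp)
    then show ?thesis using assms by (simp add: arctan_one arctan_minus)
  qed
  \<comment> \<open>Opposite sides combine to the same arctangent density, real for the vertical
    pair and with factor -i for the horizontal one; each pair contributes pi.\<close>
  have e1: "inverse (Complex R t) - inverse (Complex (-R) t) = of_real (2 * R / (R\<^sup>2 + t\<^sup>2))" for t
    by (simp add: complex_eq_iff power2_eq_square add_divide_distrib[symmetric])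
  have e2: "inverse (Complex s R) - inverse (Complex s (-R)) = - \<i> * of_real (2 * R / (R\<^sup>2 + s\<^sup>2))" for s
    by (simp add: complex_eq_iff power2_eq_square add.commute)
  have C: "((\<lambda>t. complex_of_real (2 * R / (R\<^sup>2 + t\<^sup>2))) has_integral of_real pi) {-R..R}"
    using has_integral_linear[OF I bounded_linear_of_real] unfolding o_def .
  show ?thesis
    unfolding box_boundary_integral_def e1 e2
    using integral_unique[OF C] integral_unique[OF has_integral_mult_right[OF C, of "- \<i>"]] by simp
qed

lemma box_boundary_integral_diff:
  assumes "continuous_on (- {0}) u" "continuous_on (- {0}) v" "R > 0"
  shows "box_boundary_integral R (\<lambda>z. u z - v z) = box_boundary_integral R u - box_boundary_integral R v"
proof -
  have c: "(\<lambda>t. f (Complex R t) - f (Complex (-R) t)) integrable_on {-R..R}"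
    "(\<lambda>t. f (Complex t R) - f (Complex t (-R))) integrable_on {-R..R}"
    if "continuous_on (- {0}) f" for f :: "complex \<Rightarrow> complex"
    by (intro integrable_continuous_real continuous_on_diff continuous_on_compose2[OF that] continuous_intros;
        use assms(3) in \<open>auto simp: complex_eq_iff\<close>)+
  have i1: "integral {-R..R} (\<lambda>t. (u (Complex R t) - v (Complex R t)) - (u (Complex (-R) t) - v (Complex (-R) t)))
     = integral {-R..R} (\<lambda>t. u (Complex R t) - u (Complex (-R) t)) - integral {-R..R} (\<lambda>t. v (Complex R t) - v (Complex (-R) t))"
    using integral_diff[OF c(1)[OF assms(1)] c(1)[OF assms(2)]] by (simp add: algebra_simps)
  have i2: "integral {-R..R} (\<lambda>t. (u (Complex t R) - v (Complex t R)) - (u (Complex t (-R)) - v (Complex t (-R))))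
     = integral {-R..R} (\<lambda>t. u (Complex t R) - u (Complex t (-R))) - integral {-R..R} (\<lambda>t. v (Complex t R) - v (Complex t (-R)))"
    using integral_diff[OF c(2)[OF assms(1)] c(2)[OF assms(2)]] by (simp add: algebra_simps)
  show ?thesis unfolding box_boundary_integral_def i1 i2 by (simp add: algebra_simps)
qed

text \<open>The factor \<open>8 * R\<close> is the perimeter of the square.\<close>

lemma box_boundary_integral_bound:
  assumes u: "continuous_on (- {0}) u" and R: "R > 0" and M: "\<And>z. norm z \<ge> R \<Longrightarrow> norm (u z) \<le> M"
  shows "norm (box_boundary_integral R u) \<le> 8 * R * M"
proof -
  have M2: "norm (u z - u w) \<le> 2 * M" if "norm z \<ge> R" "norm w \<ge> R" for z w
    using M[OF that(1)] M[OF that(2)] norm_triangle_ineq4[of "u z" "u w"] by linarith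
  have c: "continuous_on {-R..R} (\<lambda>t. u (Complex R t) - u (Complex (-R) t))"
    "continuous_on {-R..R} (\<lambda>t. u (Complex t R) - u (Complex t (-R)))"
    by (intro continuous_on_diff continuous_on_compose2[OF u] continuous_intros;
        use R in \<open>auto simp: complex_eq_iff\<close>)+
  have "norm (integral {-R..R} (\<lambda>t. u (Complex R t) - u (Complex (-R) t))) \<le> 2 * M * (R - (-R))"
    by (rule integral_bound[OF _ c(1)]) (use R in \<open>auto intro!: M2 square_boundary_norm\<close>)
  moreover have "norm (integral {-R..R} (\<lambda>t. u (Complex t R) - u (Complex t (-R)))) \<le> 2 * M * (R - (-R))"
    by (rule integral_bound[OF _ c(2)]) (use R in \<open>auto intro!: M2 square_boundary_norm\<close>)
  ultimately show ?thesis
    unfolding box_boundary_integral_def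
    by (intro order_trans[OF norm_triangle_ineq]) (simp add: norm_mult algebra_simps)
qed

section \<open>The quasiconformal reflection\<close>

lemma has_vector_derivative_sequential:
  fixes f :: "real \<Rightarrow> complex"
  assumes "(f has_vector_derivative D) (at 0)"
  shows "(\<lambda>n. real (Suc n) *\<^sub>R (f (1 / real (Suc n)) - f 0)) \<longlonglongrightarrow> D"
proof (rule LIMSEQ_I)
  fix e :: real assume e: "e > 0"
  then have "e / 2 > 0" by simp
  then obtain d where d: "d > 0" "\<And>s. \<bar>s\<bar> < d \<Longrightarrow> norm (f s - f 0 - s *\<^sub>R D) \<le> e / 2 * \<bar>s\<bar>"
    using has_vector_derivative_at_0_bound[OF assms] by blast
  obtain N where N: "1 / real (Suc N) < d" using nat_approx_posE[OF d(1)] by metis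
  show "\<exists>N. \<forall>n\<ge>N. norm (real (Suc n) *\<^sub>R (f (1 / real (Suc n)) - f 0) - D) < e"
  proof (intro exI[of _ N] allI impI)
    fix n assume n: "n \<ge> N"
    define s where "s = 1 / real (Suc n)"
    have s: "s > 0" "s < d"
    proof -
      have "1 / real (Suc n) \<le> 1 / real (Suc N)" using n by (intro divide_left_mono) auto
      then show "s < d" using N by (simp add: s_def)
    qed (simp add: s_def)
    have "norm (real (Suc n) *\<^sub>R (f s - f 0) - D) = norm (real (Suc n) *\<^sub>R (f s - f 0 - s *\<^sub>R D))"
      by (simp add: s_def scaleR_diff_right del: of_nat_Suc)
    also have "\<dots> = real (Suc n) * norm (f s - f 0 - s *\<^sub>R D)" by simp
    also have "\<dots> \<le> real (Suc n) * (e / 2 * \<bar>s\<bar>)"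
      using d(2)[of s] s by (intro mult_left_mono) auto
    also have "\<dots> = e / 2" by (simp add: s_def field_simps del: of_nat_Suc)
    also have "\<dots> < e" using e by simp
    finally show "norm (real (Suc n) *\<^sub>R (f (1 / real (Suc n)) - f 0) - D) < e" by (simp add: s_def)
  qed
qed

text \<open>For the partial derivatives \<open>x\<close>, \<open>y\<close> of a map that reverses
  orientation, (x + i y)/2 is the derivative with respect to cnj z and dominates (x - i y)/2, the
  one with respect to z. The Jacobian is the difference of squares |x - i y|^2/4 - |x + i y|^2/4, so
  its absolute value controls the dominant part.\<close>

lemma beltrami_jacobian:
  fixes x y :: complex
  assumes "norm (x - \<i> * y) \<le> k * norm (x + \<i> * y)"
  shows "(1 - k\<^sup>2) / 4 * (norm (x + \<i> * y))\<^sup>2 \<le> \<bar>Re x * Im y - Im x * Re y\<bar>"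
proof -
  have "(norm (x - \<i> * y))\<^sup>2 \<le> (k * norm (x + \<i> * y))\<^sup>2"
    using assms by (intro power_mono) auto
  then have "(norm (x + \<i> * y))\<^sup>2 - (norm (x - \<i> * y))\<^sup>2 \<ge> (1 - k\<^sup>2) * (norm (x + \<i> * y))\<^sup>2"
    by (simp add: algebra_simps power_mult_distrib)
  moreover have "(norm (x + \<i> * y))\<^sup>2 - (norm (x - \<i> * y))\<^sup>2 = - 4 * (Re x * Im y - Im x * Re y)"
    unfolding cmod_power2 by (simp add: power2_eq_square algebra_simps)
  moreover have "A / 4 \<le> \<bar>J\<bar>" if "d \<ge> A" "d = - 4 * J" for A d J :: real
    using that by linarith
  ultimately have "((1 - k\<^sup>2) * (norm (x + \<i> * y))\<^sup>2) / 4 \<le> \<bar>Re x * Im y - Im x * Re y\<bar>"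
    by blast
  then show ?thesis by simp
qed

lemma beltrami_norms:
  fixes x y :: complex
  assumes "norm (x - \<i> * y) \<le> k * norm (x + \<i> * y)" "k \<le> 1"
  shows "norm x \<le> norm (x + \<i> * y)" "norm y \<le> norm (x + \<i> * y)"
proof -
  have le: "norm (x - \<i> * y) \<le> norm (x + \<i> * y)"
    using assms mult_right_mono[of k 1 "norm (x + \<i> * y)"] by simp
  have "norm (2 * x) = norm ((x + \<i> * y) + (x - \<i> * y))" by (simp add: algebra_simps)
  also have "\<dots> \<le> norm (x + \<i> * y) + norm (x + \<i> * y)"
    using norm_triangle_ineq[of "x + \<i> * y" "x - \<i> * y"] le by linarith
  finally show "norm x \<le> norm (x + \<i> * y)" by (simp add: norm_mult)
  have "norm (2 * \<i> * y) = norm ((x + \<i> * y) - (x - \<i> * y))" by (simp add: algebra_simps)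
  also have "\<dots> \<le> norm (x + \<i> * y) + norm (x + \<i> * y)"
    using norm_triangle_ineq4[of "x + \<i> * y" "x - \<i> * y"] le by linarith
  finally show "norm y \<le> norm (x + \<i> * y)" by (simp add: norm_mult)
qed

lemma has_vector_derivative_horizontal_shift:
  assumes "((\<lambda>h. f (Complex s t + of_real h)) has_vector_derivative D) (at 0)"
  shows "((\<lambda>s. f (Complex s t)) has_vector_derivative D) (at s)"
proof -
  have "((\<lambda>s'. s' - s) has_derivative (\<lambda>x. x)) (at s)" by (auto intro!: derivative_eq_intros)
  from has_derivative_compose[OF this, of "\<lambda>h. f (Complex s t + of_real h)" "\<lambda>x. x *\<^sub>R D"] assms
  have "((\<lambda>s'. f (Complex s t + of_real (s' - s))) has_vector_derivative D) (at s)"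
    by (simp add: has_vector_derivative_def)
  moreover have "Complex s t + of_real (s' - s) = Complex s' t" for s' by (simp add: complex_eq_iff)
  ultimately show ?thesis by simp
qed

lemma has_vector_derivative_vertical_shift:
  assumes "((\<lambda>h. f (Complex s t + \<i> * of_real h)) has_vector_derivative D) (at 0)"
  shows "((\<lambda>t. f (Complex s t)) has_vector_derivative D) (at t)"
proof -
  have "((\<lambda>t'. t' - t) has_derivative (\<lambda>x. x)) (at t)" by (auto intro!: derivative_eq_intros)
  from has_derivative_compose[OF this, of "\<lambda>h. f (Complex s t + \<i> * of_real h)" "\<lambda>x. x *\<^sub>R D"] assms
  have "((\<lambda>t'. f (Complex s t + \<i> * of_real (t' - t))) has_vector_derivative D) (at t)"
    by (simp add: has_vector_derivative_def)
  moreover have "Complex s t + \<i> * of_real (t' - t) = Complex s t'" for t' by (simp add: complex_eq_iff)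
  ultimately show ?thesis by simp
qed

text \<open>Absolute continuity is given on boxes that avoid \<open>a\<close>. Countably many closed
  intervals on either side of \<open>p\<close> exhaust the line without \<open>p\<close>, and a
  countable union of null sets is null. The 2 in the outer end keeps every interval
  nondegenerate.\<close>

lemma AE_lborel_punctured:
  fixes p :: real
  assumes Q: "\<And>c d. c < d \<Longrightarrow> p \<notin> {c..d} \<Longrightarrow> AE t in lebesgue. t \<in> {c..d} \<longrightarrow> Q t"
  shows "AE t in lborel. t \<noteq> p \<and> Q t"
proof -
  have bd: "1 / real (Suc n) < real n + 2" for n
    by (rule le_less_trans[of _ 1]) auto
  have upper: "AE t in lebesgue. t \<in> {p + 1 / real (Suc n)..p + (real n + 2)} \<longrightarrow> Q t" for n
    by (rule Q) (use bd[of n] in auto)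
  have lower: "AE t in lebesgue. t \<in> {p - (real n + 2)..p - 1 / real (Suc n)} \<longrightarrow> Q t" for n
    by (rule Q) (use bd[of n] in auto)
  have "AE t in lborel. t \<noteq> p" by (rule AE_lborel_singleton)
  moreover have "AE t in lborel. \<forall>n. t \<in> {p + 1 / real (Suc n)..p + (real n + 2)} \<longrightarrow> Q t"
    using upper by (subst AE_all_countable) (simp add: AE_completion_iff)
  moreover have "AE t in lborel. \<forall>n. t \<in> {p - (real n + 2)..p - 1 / real (Suc n)} \<longrightarrow> Q t"
    using lower by (subst AE_all_countable) (simp add: AE_completion_iff)
  ultimately show ?thesis
  proof eventually_elim
    case (elim t)
    have "\<bar>t - p\<bar> > 0" using elim(1) by simp
    then obtain n1 where n1: "1 / real (Suc n1) < \<bar>t - p\<bar>" using nat_approx_posE by metis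
    obtain n2 where n2: "\<bar>t - p\<bar> < real n2" using reals_Archimedean2 by blast
    have "1 / real (Suc (n1 + n2)) \<le> 1 / real (Suc n1)" by (intro divide_left_mono) auto
    then have "t \<in> {p + 1 / real (Suc (n1 + n2))..p + (real (n1 + n2) + 2)} \<or>
        t \<in> {p - (real (n1 + n2) + 2)..p - 1 / real (Suc (n1 + n2))}"
      using n1 n2 by auto
    then show ?case using elim by blast
  qed
qed

lemma absolutely_continuous_lines_punctured:
  assumes acl: "absolutely_continuous_on_lines (- {a}) F" and R: "R > 0"
  shows "AE t in lborel. t \<noteq> Im a \<and> absolutely_continuous_real (-R) R (\<lambda>s. F (Complex s t))"
    and "AE s in lborel. s \<noteq> Re a \<and> absolutely_continuous_real (-R) R (\<lambda>t. F (Complex s t))"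
proof -
  have box: "(AE t in lebesgue. t \<in> {c..d} \<longrightarrow> absolutely_continuous_real a' b' (\<lambda>s. F (Complex s t))) \<and>
     (AE s in lebesgue. s \<in> {a'..b'} \<longrightarrow> absolutely_continuous_real c d (\<lambda>t. F (Complex s t)))"
    if "a' < b'" "c < d" "a \<notin> cbox (Complex a' c) (Complex b' d)" for a' b' c d
    using acl that unfolding absolutely_continuous_on_lines_def by blast
  show "AE t in lborel. t \<noteq> Im a \<and> absolutely_continuous_real (-R) R (\<lambda>s. F (Complex s t))"
    by (rule AE_lborel_punctured, rule box[THEN conjunct1])
      (use R in \<open>auto simp: cbox_def Basis_complex_def\<close>)
  show "AE s in lborel. s \<noteq> Re a \<and> absolutely_continuous_real (-R) R (\<lambda>t. F (Complex s t))"
    by (rule AE_lborel_punctured, rule box[THEN conjunct2])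
      (use R in \<open>auto simp: cbox_def Basis_complex_def\<close>)
qed

text \<open>\<open>F\<close> is the conjugate of the reflection read in the finite charts, hence
  orientation preserving, and \<open>a\<close> is the point that it sends to infinity.\<close>

locale exterior_reflection = exterior_map +
  fixes F :: "complex \<Rightarrow> complex" and a :: complex and k :: real
  assumes open_G: "open G" and a_in_G: "a \<in> G"
    and F_cont: "continuous_on (- {a}) F"
    and F_acl: "absolutely_continuous_on_lines (- {a}) F"
    and F_dilatation: "AE z in lebesgue. z \<noteq> a \<longrightarrow>
        (\<exists>fx fy.
           ((\<lambda>s. F (z + of_real s)) has_vector_derivative fx) (at 0) \<and>
           ((\<lambda>t. F (z + \<i> * of_real t)) has_vector_derivative fy) (at 0) \<and>
           norm ((fx + \<i> * fy) / 2) \<le> k * norm ((fx - \<i> * fy) / 2))"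
    and k_range: "0 \<le> k" "k < 1"
    and F_image: "\<And>z. z \<in> Om \<Longrightarrow> cnj (F z) \<in> G"
    and F_inj: "inj_on F Om"
    and F_frontier: "\<And>z. z \<in> frontier G \<Longrightarrow> F z = cnj z"
begin

definition "e z = (if z \<in> closure G then 0 else cnj (F z) - z)"

text \<open>The reflection on the exterior glued to the identity on the closure of \<open>G\<close>.
  Both agree on the boundary, so \<open>H\<close> is continuous on the plane, as the Jacobian
  estimate demands.\<close>

definition "H z = e z + z"

text \<open>A limit along one sequence of continuous quotients is Borel measurable everywhere, and
  it is the partial derivative wherever the latter exists.\<close>

definition "Hx z = lim (\<lambda>n. real (Suc n) *\<^sub>R (H (z + of_real (1 / real (Suc n))) - H z))"

definition "Hy z = lim (\<lambda>n. real (Suc n) *\<^sub>R (H (z + \<i> * of_real (1 / real (Suc n))) - H z))"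

lemma e_cont: "continuous_on UNIV e"
proof -
  have "continuous_on (closure G \<union> - G) (\<lambda>z. if z \<in> closure G then 0 else cnj (F z) - z)"
  proof (rule continuous_on_cases)
    show "closed (- G)" using open_G by (simp add: closed_def)
    show "continuous_on (- G) (\<lambda>z. cnj (F z) - z)"
      by (intro continuous_intros continuous_on_subset[OF F_cont]) (use a_in_G in auto)
    show "\<forall>z. z \<in> closure G \<and> z \<notin> closure G \<or> z \<in> - G \<and> z \<in> closure G \<longrightarrow> 0 = cnj (F z) - z"
      using F_frontier open_G by (auto simp: frontier_def interior_open)
  qed auto
  moreover have "closure G \<union> - G = UNIV" using closure_subset by auto
  ultimately show ?thesis unfolding e_def[abs_def] by simp
qed

lemma H_cont: "continuous_on UNIV H"
  unfolding H_def[abs_def] by (intro continuous_intros e_cont)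

lemma H_Om: "z \<in> Om \<Longrightarrow> H z = cnj (F z)" and e_Om: "z \<in> Om \<Longrightarrow> e z = cnj (F z) - z"
  and e_not_Om: "z \<notin> Om \<Longrightarrow> e z = 0"
  by (auto simp: H_def e_def Om_def)

lemma Hx_borel [measurable]: "Hx \<in> borel_measurable borel"
  and Hy_borel [measurable]: "Hy \<in> borel_measurable borel"
proof -
  show "Hx \<in> borel_measurable borel"
    unfolding Hx_def[abs_def]
    by (intro borel_measurable_lim_metric borel_measurable_continuous_onI continuous_intros
        continuous_on_compose2[OF H_cont]) auto
  show "Hy \<in> borel_measurable borel"
    unfolding Hy_def[abs_def]
    by (intro borel_measurable_lim_metric borel_measurable_continuous_onI continuous_intros
        continuous_on_compose2[OF H_cont]) auto
qed

text \<open>The dilatation condition of \<open>F\<close> rewritten for its conjugate: conjugation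
  exchanges the two Wirtinger derivatives, so here the one with respect to cnj z dominates.\<close>

definition "regular z \<longleftrightarrow>
  ((\<lambda>s. H (z + of_real s)) has_vector_derivative Hx z) (at 0) \<and>
  ((\<lambda>t. H (z + \<i> * of_real t)) has_vector_derivative Hy z) (at 0) \<and>
  norm (Hx z - \<i> * Hy z) \<le> k * norm (Hx z + \<i> * Hy z)"

lemma AE_regular: "AE z in lebesgue. z \<in> Om \<longrightarrow> regular z"
  using F_dilatation
proof eventually_elim
  case (elim z)
  show ?case
  proof
    assume z: "z \<in> Om"
    then have "z \<noteq> a" using a_in_G closure_subset by (auto simp: Om_def)
    with elim obtain fx fy where fx: "((\<lambda>s. F (z + of_real s)) has_vector_derivative fx) (at 0)"
      and fy: "((\<lambda>t. F (z + \<i> * of_real t)) has_vector_derivative fy) (at 0)"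
      and le: "norm ((fx + \<i> * fy) / 2) \<le> k * norm ((fx - \<i> * fy) / 2)" by blast
    have hx: "((\<lambda>s. H (z + of_real s)) has_vector_derivative cnj fx) (at 0)"
    proof (rule has_vector_derivative_transform_within_open)
      show "((\<lambda>s. cnj (F (z + of_real s))) has_vector_derivative cnj fx) (at 0)"
        by (rule bounded_linear.has_vector_derivative[OF bounded_linear_cnj fx])
      show "open ((\<lambda>s::real. z + of_real s) -` Om)"
        by (intro open_vimage open_Om continuous_intros)
    qed (use z H_Om in auto)
    have hy: "((\<lambda>t. H (z + \<i> * of_real t)) has_vector_derivative cnj fy) (at 0)"
    proof (rule has_vector_derivative_transform_within_open)
      show "((\<lambda>t. cnj (F (z + \<i> * of_real t))) has_vector_derivative cnj fy) (at 0)"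
        by (rule bounded_linear.has_vector_derivative[OF bounded_linear_cnj fy])
      show "open ((\<lambda>t::real. z + \<i> * of_real t) -` Om)"
        by (intro open_vimage open_Om continuous_intros)
    qed (use z H_Om in auto)
    have Hx: "Hx z = cnj fx"
      unfolding Hx_def using has_vector_derivative_sequential[OF hx] by (intro limI) simp
    have Hy: "Hy z = cnj fy"
      unfolding Hy_def using has_vector_derivative_sequential[OF hy] by (intro limI) simp
    have "norm (fx + \<i> * fy) \<le> k * norm (fx - \<i> * fy)" using le by (simp add: norm_divide)
    moreover have "norm (fx + \<i> * fy) = norm (cnj fx - \<i> * cnj fy)"
      by (metis complex_mod_cnj complex_cnj_add complex_cnj_mult complex_cnj_i mult_minus_left diff_conv_add_uminus)
    moreover have "norm (fx - \<i> * fy) = norm (cnj fx + \<i> * cnj fy)"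
      by (metis complex_mod_cnj complex_cnj_diff complex_cnj_mult complex_cnj_i mult_minus_left diff_minus_eq_add)
    ultimately show "regular z" unfolding regular_def Hx Hy using hx hy by simp
  qed
qed

abbreviation "Z z \<equiv> Hx z + \<i> * Hy z"

text \<open>\<open>Z\<close> is twice the derivative of \<open>H\<close> with respect to cnj z,
  whence the factor 4. The square makes the domain of finite measure, and the bound is independent
  of \<open>R\<close>.\<close>

lemma energy_reflection:
  assumes V: "V = Om \<inter> square R"
  shows "integrable lborel (\<lambda>z. indicator V z * (norm (Z z))\<^sup>2)"
    and "(LINT z|lborel. indicator V z * (norm (Z z))\<^sup>2) \<le> 4 * area G / (1 - k\<^sup>2)"
proof -
  have V_sets [measurable]: "V \<in> sets borel" unfolding V using open_Om by simp
  have V_lm: "V \<in> lmeasurable"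
    by (rule fmeasurableI2[of "square R"]) (use V_sets in \<open>auto simp: V\<close>)
  have G_lm: "G \<in> lmeasurable" using open_G bounded_G by (simp add: lmeasurable_open)
  have k1: "1 - k\<^sup>2 > 0" using k_range by (simp add: power_less_one_iff abs_square_less_1)
  obtain N where N: "{z. \<not> (z \<in> Om \<longrightarrow> regular z)} \<subseteq> N" "N \<in> null_sets lebesgue"
    using AE_regular by (auto simp: eventually_ae_filter)
  have reg: "regular z" if "z \<in> V - N" for z using that N(1) by (auto simp: V)
  have injH: "inj_on H V"
    unfolding V using F_inj H_Om by (auto simp: inj_on_def)
  have HV: "H ` V \<subseteq> G" unfolding V using F_image H_Om by auto
  have nn: "(\<integral>\<^sup>+z. indicator V z * ennreal \<bar>Re (Hx z) * Im (Hy z) - Im (Hx z) * Re (Hy z)\<bar> \<partial>lebesgue)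
           \<le> ennreal (measure lebesgue G)"
    by (rule jacobian_integral_le_measure[OF H_cont V_lm injH _ _ _ Hx_borel Hy_borel HV G_lm, of N])
      (use reg N(2) in \<open>auto simp: regular_def negligible_iff_null_sets\<close>)
  define q where "q = (\<lambda>z. indicator V z * ((1 - k\<^sup>2) / 4 * (norm (Z z))\<^sup>2))"
  have q_meas: "q \<in> borel_measurable borel" unfolding q_def by measurable
  have q_nonneg: "q z \<ge> 0" for z unfolding q_def using k1 by (simp add: indicator_def)
  have "(\<integral>\<^sup>+z. ennreal (q z) \<partial>lborel) = (\<integral>\<^sup>+z. ennreal (q z) \<partial>lebesgue)"
    by (simp add: nn_integral_completion)
  also have "\<dots> \<le> (\<integral>\<^sup>+z. indicator V z * ennreal \<bar>Re (Hx z) * Im (Hy z) - Im (Hx z) * Re (Hy z)\<bar> \<partial>lebesgue)"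
  proof (rule nn_integral_mono_AE)
    have "AE z in lebesgue. z \<notin> N" using N(2) by (rule AE_not_in)
    then show "AE z in lebesgue. ennreal (q z) \<le>
        indicator V z * ennreal \<bar>Re (Hx z) * Im (Hy z) - Im (Hx z) * Re (Hy z)\<bar>"
    proof eventually_elim
      fix z assume z: "z \<notin> N"
      show "ennreal (q z) \<le> indicator V z * ennreal \<bar>Re (Hx z) * Im (Hy z) - Im (Hx z) * Re (Hy z)\<bar>"
      proof (cases "z \<in> V")
        case True
        then have "norm (Hx z - \<i> * Hy z) \<le> k * norm (Z z)" using reg[of z] z by (auto simp: regular_def)
        from beltrami_jacobian[OF this] True show ?thesis
          by (simp add: q_def ennreal_leI)
      qed (simp add: q_def)
    qed
  qed
  also have "\<dots> \<le> ennreal (measure lebesgue G)" by (rule nn)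
  finally have fin: "(\<integral>\<^sup>+z. ennreal (q z) \<partial>lborel) \<le> ennreal (measure lebesgue G)" .
  have q_int: "integrable lborel q"
    by (rule integrableI_nonneg) (use q_meas q_nonneg le_less_trans[OF fin] in auto)
  have "ennreal (integral\<^sup>L lborel q) \<le> ennreal (measure lebesgue G)"
    using fin nn_integral_eq_integral[OF q_int] q_nonneg by simp
  then have q_le: "integral\<^sup>L lborel q \<le> area G" by (simp add: area_def ennreal_le_iff)
  have eq: "(\<lambda>z. indicator V z * (norm (Z z))\<^sup>2) = (\<lambda>z. 4 / (1 - k\<^sup>2) * q z)"
    using k1 by (auto simp: q_def fun_eq_iff)
  show "integrable lborel (\<lambda>z. indicator V z * (norm (Z z))\<^sup>2)"
    unfolding eq using q_int by simp
  have "(LINT z|lborel. indicator V z * (norm (Z z))\<^sup>2) = 4 / (1 - k\<^sup>2) * integral\<^sup>L lborel q"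
    unfolding eq by simp
  also have "\<dots> \<le> 4 / (1 - k\<^sup>2) * area G"
    using q_le k1 by (intro mult_left_mono) auto
  finally show "(LINT z|lborel. indicator V z * (norm (Z z))\<^sup>2) \<le> 4 * area G / (1 - k\<^sup>2)" by simp
qed

end

section \<open>Green's formula with a holomorphic weight\<close>

lemma compact_bound_UNIV:
  fixes f :: "complex \<Rightarrow> complex"
  assumes "continuous_on UNIV f" "compact S"
  obtains C where "C > 0" "\<And>z. z \<in> S \<Longrightarrow> norm (f z) \<le> C"
proof -
  have "compact (f ` S)" using assms by (intro compact_continuous_image continuous_on_subset[OF assms(1)]) auto
  then obtain C where "C > 0" "\<forall>x\<in>f ` S. norm x \<le> C"
    using compact_imp_bounded bounded_pos by metis
  then show thesis by (intro that[of C]) auto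
qed

context exterior_map
begin

definition "phi0 z = (if z \<in> Om then phi z else 0)"

text \<open>The cutoff turns the holomorphic weight, which is uncontrolled at the boundary, into a
  C1 function on the whole plane.\<close>

definition "weight \<sigma> z = of_real (cutoff \<sigma> z) * phi0 z"

definition "weight' \<sigma> z v = of_real (cutoff \<sigma> z) * ((if z \<in> Om then deriv phi z else 0) * v)
    + of_real (Re (cnj (cutoff_grad \<sigma> z) * v)) * phi0 z"

lemma weight_derivative:
  assumes \<sigma>: "\<sigma> > 0"
  shows "(weight \<sigma> has_derivative weight' \<sigma> z) (at z)"
proof (cases "z \<in> Om")
  case True
  have 1: "((\<lambda>z. complex_of_real (cutoff \<sigma> z)) has_derivative (\<lambda>v. of_real (Re (cnj (cutoff_grad \<sigma> z) * v)))) (at z)"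
    by (rule bounded_linear.has_derivative[OF bounded_linear_of_real cutoff_derivative[OF \<sigma>]])
  have 2: "(phi has_derivative (\<lambda>v. deriv phi z * v)) (at z)"
    using holomorphic_derivI[OF holo_phi open_Om True] by (simp add: has_field_derivative_def)
  have "((\<lambda>z. complex_of_real (cutoff \<sigma> z) * phi z) has_derivative weight' \<sigma> z) (at z)"
    using has_derivative_mult[OF 1 2] True unfolding weight'_def[abs_def] phi0_def by simp
  then show ?thesis
    by (rule has_derivative_transform_within_open[OF _ open_Om True]) (simp add: weight_def phi0_def)
next
  case False
  have c: "closed {z \<in> Om. norm (\<Phi> z) \<ge> exp \<sigma>}" using \<sigma> by (intro closed_outer) simp
  have "weight' \<sigma> z = (\<lambda>v. 0)"
    unfolding weight'_def[abs_def] phi0_def using False by simp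
  then have "((\<lambda>_. 0) has_derivative weight' \<sigma> z) (at z)" by simp
  then show ?thesis
    by (rule has_derivative_transform_within_open[where s="- {z \<in> Om. norm (\<Phi> z) \<ge> exp \<sigma>}"])
      (use c collar_zero[OF \<sigma>] False in \<open>auto simp: weight_def\<close>)
qed

lemma continuous_on_phi: "continuous_on Om phi" "continuous_on Om (deriv phi)"
  using holo_phi holomorphic_deriv[OF holo_phi open_Om] by (auto intro: holomorphic_on_imp_continuous_on)

lemma weight_continuous:
  assumes \<sigma>: "\<sigma> > 0"
  shows "continuous_on UNIV (weight \<sigma>)" "continuous_on UNIV (\<lambda>z. weight' \<sigma> z v)"
    "continuous_on UNIV (\<lambda>z. cutoff_grad \<sigma> z * phi0 z)"
proof -
  have p0: "continuous_on Om phi0"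
    using continuous_on_phi(1) by (subst continuous_on_cong[OF refl]) (auto simp: phi0_def)
  have p1: "continuous_on Om (\<lambda>z. if z \<in> Om then deriv phi z else 0)"
    using continuous_on_phi(2) by (subst continuous_on_cong[OF refl, of _ _ "deriv phi"]) auto
  have c: "continuous_on Om (cutoff \<sigma>)" "continuous_on Om (cutoff_grad \<sigma>)"
    using continuous_on_subset[OF continuous_on_cutoff[OF \<sigma>]] continuous_on_subset[OF continuous_on_cutoff_grad[OF \<sigma>]] by auto
  show "continuous_on UNIV (weight \<sigma>)"
    by (rule has_derivative_continuous_on[OF has_derivative_at_withinI[OF weight_derivative[OF \<sigma>]]])
  show "continuous_on UNIV (\<lambda>z. weight' \<sigma> z v)"
  proof (rule continuous_on_UNIV_by_collar[OF \<sigma>])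
    show "continuous_on Om (\<lambda>z. weight' \<sigma> z v)"
      unfolding weight'_def by (intro continuous_intros c p0 p1)
  qed (simp add: weight'_def collar_zero[OF \<sigma>])
  show "continuous_on UNIV (\<lambda>z. cutoff_grad \<sigma> z * phi0 z)"
  proof (rule continuous_on_UNIV_by_collar[OF \<sigma>])
    show "continuous_on Om (\<lambda>z. cutoff_grad \<sigma> z * phi0 z)"
      by (intro continuous_intros c p0)
  qed (simp add: collar_zero[OF \<sigma>])
qed

text \<open>As \<open>phi\<close> is holomorphic, the derivative with respect to cnj z falls on the
  cutoff alone.\<close>

lemma weight_Dbar: "weight' \<sigma> z 1 + \<i> * weight' \<sigma> z \<i> = cutoff_grad \<sigma> z * phi0 z"
proof -
  have "weight' \<sigma> z 1 + \<i> * weight' \<sigma> z \<i> =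
    (of_real (Re (cnj (cutoff_grad \<sigma> z) * 1)) + \<i> * of_real (Re (cnj (cutoff_grad \<sigma> z) * \<i>))) * phi0 z"
    unfolding weight'_def by (simp add: algebra_simps)
  also have "of_real (Re (cnj (cutoff_grad \<sigma> z) * 1)) + \<i> * of_real (Re (cnj (cutoff_grad \<sigma> z) * \<i>)) = cutoff_grad \<sigma> z"
    by (simp add: complex_eq_iff)
  finally show ?thesis .
qed

lemma weight_norm: "\<sigma> > 0 \<Longrightarrow> norm (weight \<sigma> z) \<le> norm (phi0 z)"
  unfolding weight_def norm_mult using cutoff_range[of \<sigma> z] by (auto intro!: mult_left_le_one_le)

text \<open>The form \<open>phi\<close> dz is the differential of -1/\<Phi>. On the level curve with
  parameter s its density therefore has modulus e^(-s), however irregular the boundary of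
  \<open>G\<close> may be.\<close>

lemma phi_strip: "Re \<zeta> > 0 \<Longrightarrow> phi (strip \<zeta>) * strip' \<zeta> = exp (- \<zeta>)"
proof -
  assume p: "Re \<zeta> > 0"
  have "phi (strip \<zeta>) * strip' \<zeta> = (deriv \<Phi> (strip \<zeta>) / \<Phi> (strip \<zeta>) * strip' \<zeta>) / \<Phi> (strip \<zeta>)"
    by (simp add: phi_def power2_eq_square)
  also have "\<dots> = 1 / \<Phi> (strip \<zeta>)" by (simp only: strip_facts(5)[OF p])
  also have "\<dots> = exp (- \<zeta>)" by (simp add: strip_facts(3)[OF p] exp_minus inverse_eq_divide)
  finally show ?thesis .
qed

end

context exterior_reflection
begin

definition "P \<sigma> z = e z * weight \<sigma> z"

text \<open>Formal product rule for \<open>P\<close>. The value 0 outside \<open>Om\<close> is the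
  true derivative, because \<open>P\<close> vanishes in a neighbourhood of every such point.\<close>

definition "Px \<sigma> z = (if z \<in> Om then e z * weight' \<sigma> z 1 + (Hx z - 1) * weight \<sigma> z else 0)"

definition "Py \<sigma> z = (if z \<in> Om then e z * weight' \<sigma> z \<i> + (Hy z - \<i>) * weight \<sigma> z else 0)"

lemma weight_not_Om: "z \<notin> Om \<Longrightarrow> weight \<sigma> z = 0"
  by (simp add: weight_def phi0_def)

lemma P_cont: "\<sigma> > 0 \<Longrightarrow> continuous_on UNIV (P \<sigma>)"
  unfolding P_def[abs_def] by (intro continuous_intros e_cont weight_continuous)

lemma P_zero: "\<sigma> > 0 \<Longrightarrow> z \<in> - {z \<in> Om. norm (\<Phi> z) \<ge> exp \<sigma>} \<Longrightarrow> P \<sigma> z = 0"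
  using collar_zero(1)[of \<sigma> z] by (simp add: P_def weight_def)

lemma open_P_zero: "\<sigma> > 0 \<Longrightarrow> open (- {z \<in> Om. norm (\<Phi> z) \<ge> exp \<sigma>})"
  by (intro open_Compl closed_outer) simp

lemma regular_lines:
  assumes "Complex s t \<in> Om" "regular (Complex s t)"
  shows "((\<lambda>s. e (Complex s t)) has_vector_derivative Hx (Complex s t) - 1) (at s)"
    and "((\<lambda>t. e (Complex s t)) has_vector_derivative Hy (Complex s t) - \<i>) (at t)"
proof -
  have H: "((\<lambda>s. H (Complex s t)) has_vector_derivative Hx (Complex s t)) (at s)"
    "((\<lambda>t. H (Complex s t)) has_vector_derivative Hy (Complex s t)) (at t)"
    using assms(2) unfolding regular_def
    by (auto intro: has_vector_derivative_horizontal_shift has_vector_derivative_vertical_shift)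
  have "((\<lambda>s. Complex s t) has_vector_derivative 1) (at s)" "((\<lambda>t. Complex s t) has_vector_derivative \<i>) (at t)"
    unfolding Complex_eq by (auto intro!: derivative_eq_intros)
  from has_vector_derivative_diff[OF H(1) this(1)] has_vector_derivative_diff[OF H(2) this(2)]
  show "((\<lambda>s. e (Complex s t)) has_vector_derivative Hx (Complex s t) - 1) (at s)"
    "((\<lambda>t. e (Complex s t)) has_vector_derivative Hy (Complex s t) - \<i>) (at t)"
    by (simp_all add: H_def)
qed

lemma P_horizontal_derivative:
  assumes \<sigma>: "\<sigma> > 0" and reg: "Complex s t \<in> Om \<longrightarrow> regular (Complex s t)"
  shows "((\<lambda>s. P \<sigma> (Complex s t)) has_vector_derivative Px \<sigma> (Complex s t)) (at s)"
proof (cases "Complex s t \<in> Om")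
  case True
  have "((\<lambda>s. e (Complex s t) * weight \<sigma> (Complex s t)) has_vector_derivative
     e (Complex s t) * weight' \<sigma> (Complex s t) 1 + (Hx (Complex s t) - 1) * weight \<sigma> (Complex s t)) (at s)"
    by (rule has_vector_derivative_mult[OF regular_lines(1) has_vector_derivative_horizontal[OF weight_derivative[OF \<sigma>]]])
      (use True reg in auto)
  then show ?thesis using True by (simp add: P_def Px_def)
next
  case False
  have "((\<lambda>s::real. 0) has_vector_derivative Px \<sigma> (Complex s t)) (at s)" using False by (simp add: Px_def)
  then show ?thesis
  proof (rule has_vector_derivative_transform_within_open)
    show "open ((\<lambda>s. Complex s t) -` (- {z \<in> Om. norm (\<Phi> z) \<ge> exp \<sigma>}))"
      by (intro open_vimage open_P_zero[OF \<sigma>] continuous_intros)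
  qed (use False P_zero[OF \<sigma>] in auto)
qed

lemma P_vertical_derivative:
  assumes \<sigma>: "\<sigma> > 0" and reg: "Complex s t \<in> Om \<longrightarrow> regular (Complex s t)"
  shows "((\<lambda>t. P \<sigma> (Complex s t)) has_vector_derivative Py \<sigma> (Complex s t)) (at t)"
proof (cases "Complex s t \<in> Om")
  case True
  have "((\<lambda>t. e (Complex s t) * weight \<sigma> (Complex s t)) has_vector_derivative
     e (Complex s t) * weight' \<sigma> (Complex s t) \<i> + (Hy (Complex s t) - \<i>) * weight \<sigma> (Complex s t)) (at t)"
    by (rule has_vector_derivative_mult[OF regular_lines(2) has_vector_derivative_vertical[OF weight_derivative[OF \<sigma>]]])
      (use True reg in auto)
  then show ?thesis using True by (simp add: P_def Py_def)
next
  case False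
  have "((\<lambda>t::real. 0) has_vector_derivative Py \<sigma> (Complex s t)) (at t)" using False by (simp add: Py_def)
  then show ?thesis
  proof (rule has_vector_derivative_transform_within_open)
    show "open ((\<lambda>t. Complex s t) -` (- {z \<in> Om. norm (\<Phi> z) \<ge> exp \<sigma>}))"
      by (intro open_vimage open_P_zero[OF \<sigma>] continuous_intros)
  qed (use False P_zero[OF \<sigma>] in auto)
qed

end

context exterior_reflection
begin

text \<open>
  On a line that avoids \<open>a\<close>, the product \<open>P = e w\<close> equals \<open>(cnj F - z) w\<close>, also inside \<open>G\<close>, since
  the weight \<open>w\<close> vanishes near the closure of \<open>G\<close>; so the absolute continuity of \<open>F\<close> is inherited.
\<close>

lemma P_absolutely_continuous:
  fixes line :: "real \<Rightarrow> complex"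
  assumes \<sigma>: "\<sigma> > 0" and R: "R > 0"
    and ac: "absolutely_continuous_real (-R) R (\<lambda>s. F (line s))"
    and l: "continuous_on {-R..R} line" "\<And>s. s \<in> {-R..R} \<Longrightarrow> line s \<noteq> a"
      "\<And>s s'. norm (line s - line s') = \<bar>s - s'\<bar>"
    and w: "\<And>s. ((\<lambda>s. weight \<sigma> (line s)) has_vector_derivative w' s) (at s)" "continuous_on {-R..R} w'"
  shows "absolutely_continuous_real (-R) R (\<lambda>s. P \<sigma> (line s))"
proof -
  define E where "E = (\<lambda>s. cnj (F (line s)) - line s)"
  define u where "u = (\<lambda>s. weight \<sigma> (line s))"
  have PE: "P \<sigma> (line s) = E s * u s" for s
    by (cases "line s \<in> Om") (auto simp: P_def E_def u_def e_Om weight_not_Om)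
  have bd: "\<exists>C>0. \<forall>s\<in>{-R..R}. norm (f s) \<le> C" if "continuous_on {-R..R} f" for f :: "real \<Rightarrow> complex"
    using compact_imp_bounded[OF compact_continuous_image[OF that]] by (simp add: bounded_pos)
  have "continuous_on {-R..R} E"
    unfolding E_def by (intro continuous_intros l(1) continuous_on_compose2[OF F_cont l(1)]) (use l(2) in fastforce)+
  then obtain M1 where M1: "M1 > 0" "\<And>s. s \<in> {-R..R} \<Longrightarrow> norm (E s) \<le> M1" using bd by blast
  have "continuous_on {-R..R} u"
    unfolding u_def using w(1) by (intro continuous_at_imp_continuous_on) (auto intro: has_vector_derivative_continuous)
  then obtain M2 where M2: "M2 > 0" "\<And>s. s \<in> {-R..R} \<Longrightarrow> norm (u s) \<le> M2" using bd by blast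
  obtain L where L: "L > 0" "\<And>s. s \<in> {-R..R} \<Longrightarrow> norm (w' s) \<le> L" using bd[OF w(2)] by blast
  have u_lip: "norm (u s - u s') \<le> L * norm (s - s')" if "s \<in> {-R..R}" "s' \<in> {-R..R}" for s s'
  proof (rule differentiable_bound[where f=u and S="{-R..R}" and f'="\<lambda>s x. x *\<^sub>R w' s"])
    show "(u has_derivative (\<lambda>x. x *\<^sub>R w' s)) (at s within {-R..R})" for s
      using w(1)[of s] unfolding u_def has_vector_derivative_def by (rule has_derivative_at_withinI)
    show "onorm (\<lambda>x. x *\<^sub>R w' s) \<le> L" if "s \<in> {-R..R}" for s
    proof (rule onorm_le)
      fix x
      have "\<bar>x\<bar> * norm (w' s) \<le> \<bar>x\<bar> * L" by (rule mult_left_mono[OF L(2)[OF that]]) simp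
      then show "norm (x *\<^sub>R w' s) \<le> L * norm x" by (simp add: mult.commute)
    qed
  qed (use that in auto)
  show ?thesis
  proof (rule absolutely_continuous_real_dominated[OF ac])
    show "M2 \<ge> 0" "M2 + M1 * L \<ge> 0" using M1 M2 L by auto
    fix s s' :: real assume s: "-R \<le> s" "s \<le> s'" "s' \<le> R"
    then have ss: "s \<in> {-R..R}" "s' \<in> {-R..R}" by auto
    have "norm (E s - E s') \<le> dist (F (line s)) (F (line s')) + (s' - s)"
    proof -
      have "E s - E s' = cnj (F (line s) - F (line s')) - (line s - line s')" by (simp add: E_def)
      then have "norm (E s - E s') \<le> norm (cnj (F (line s) - F (line s'))) + norm (line s - line s')"
        by (metis norm_triangle_ineq4)
      then show ?thesis using l(3)[of s s'] s by (simp only: complex_mod_cnj dist_norm)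
    qed
    then have "norm ((E s - E s') * u s) \<le> (dist (F (line s)) (F (line s')) + (s' - s)) * M2"
      unfolding norm_mult using M2 ss s by (intro mult_mono) auto
    moreover have "norm (E s' * (u s - u s')) \<le> M1 * (L * (s' - s))"
      unfolding norm_mult using M1 ss s u_lip[OF ss] by (intro mult_mono) auto
    moreover have "dist (P \<sigma> (line s)) (P \<sigma> (line s')) \<le> norm ((E s - E s') * u s) + norm (E s' * (u s - u s'))"
      unfolding PE dist_norm using norm_triangle_ineq[of "(E s - E s') * u s" "E s' * (u s - u s')"]
      by (simp add: algebra_simps)
    ultimately show "dist (P \<sigma> (line s)) (P \<sigma> (line s')) \<le> M2 * dist (F (line s)) (F (line s')) + (M2 + M1 * L) * (s' - s)"
      by (simp add: algebra_simps)
  qed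
qed

lemma Om_borel [measurable]: "Om \<in> sets borel"
  using open_Om by simp

text \<open>The dilatation inequality bounds both partial derivatives of \<open>H\<close> by |Z|,
  and Z is square integrable; on a bounded square this gives integrability.\<close>

lemma P_integrable:
  assumes \<sigma>: "\<sigma> > 0" and R: "R > 0"
  shows "set_integrable lborel (square R) (Px \<sigma>)" "set_integrable lborel (square R) (Py \<sigma>)"
proof -
  obtain C1 where C1: "C1 > 0" "\<And>z. z \<in> square R \<Longrightarrow> norm (weight \<sigma> z) \<le> C1"
    using compact_bound_UNIV[OF weight_continuous(1)[OF \<sigma>] compact_cbox] by blast
  have ec: "continuous_on UNIV (\<lambda>z. e z * weight' \<sigma> z v)" for v
    by (intro continuous_intros e_cont weight_continuous(2)[OF \<sigma>])
  define V where "V = Om \<inter> square R"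
  have Zint: "integrable lborel (\<lambda>z. indicator V z * (norm (Z z))\<^sup>2)"
    by (rule energy_reflection(1)[OF V_def])
  have main: "integrable lborel (\<lambda>z. indicator (square R) z *\<^sub>R
      (if z \<in> Om then e z * weight' \<sigma> z v + (D z - v) * weight \<sigma> z else 0))"
    if D: "D \<in> borel_measurable borel" and le: "\<And>z. regular z \<Longrightarrow> norm (D z) \<le> norm (Z z)" and v: "norm v = 1" for D v
  proof -
    obtain C2 where C2: "C2 > 0" "\<And>z. z \<in> square R \<Longrightarrow> norm (e z * weight' \<sigma> z v) \<le> C2"
      using compact_bound_UNIV[OF ec compact_cbox] by blast
    define g where "g = (\<lambda>z. indicator (square R) z * (C2 + 2 * C1) + C1 * (indicator V z * (norm (Z z))\<^sup>2))"
    have g: "integrable lborel g"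
    proof -
      have "integrable lborel (indicat_real (square R))"
        using continuous_set_integrable_square[of "\<lambda>_. 1::real" R] by (simp add: set_integrable_def)
      then show ?thesis
        unfolding g_def using Zint
        by (intro Bochner_Integration.integrable_add integrable_mult_right integrable_mult_left) auto
    qed
    show ?thesis
    proof (rule Bochner_Integration.integrable_bound[OF g])
      have "(\<lambda>z. e z * weight' \<sigma> z v) \<in> borel_measurable borel" "weight \<sigma> \<in> borel_measurable borel"
        using ec weight_continuous(1)[OF \<sigma>] by (auto intro: borel_measurable_continuous_onI)
      then show "(\<lambda>z. indicator (square R) z *\<^sub>R
          (if z \<in> Om then e z * weight' \<sigma> z v + (D z - v) * weight \<sigma> z else 0)) \<in> borel_measurable lborel"
        using D by measurable
      have "AE z in lborel. z \<in> Om \<longrightarrow> regular z" using AE_regular by (simp add: AE_completion_iff)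
      then show "AE z in lborel. norm (indicator (square R) z *\<^sub>R
          (if z \<in> Om then e z * weight' \<sigma> z v + (D z - v) * weight \<sigma> z else 0)) \<le> norm (g z)"
      proof eventually_elim
        case (elim z)
        have g0: "g z \<ge> 0" unfolding g_def using C1(1) C2(1) by (simp add: indicator_def)
        show ?case
        proof (cases "z \<in> Om \<and> z \<in> square R")
          case True
          then have zV: "z \<in> V" by (simp add: V_def)
          \<comment> \<open>Passes from the square integrable |Z| to an integrable majorant, the
            constants being integrable over the square.\<close>
          have t: "t \<le> 1 + t\<^sup>2" for t :: real
            using sum_squares_ge_zero[of "t - 1/2" 0] by (simp add: power2_eq_square algebra_simps)
          have "norm (D z - v) \<le> norm (Z z) + 1"
            using norm_triangle_ineq4[of "D z" v] le[of z] elim True v by auto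
          also have "\<dots> \<le> 2 + (norm (Z z))\<^sup>2" using t[of "norm (Z z)"] by simp
          finally have "norm ((D z - v) * weight \<sigma> z) \<le> (2 + (norm (Z z))\<^sup>2) * C1"
            unfolding norm_mult using C1 True by (intro mult_mono) auto
          then have "norm (e z * weight' \<sigma> z v + (D z - v) * weight \<sigma> z) \<le> C2 + (2 + (norm (Z z))\<^sup>2) * C1"
            using C2(2)[of z] True norm_triangle_ineq[of "e z * weight' \<sigma> z v" "(D z - v) * weight \<sigma> z"] by linarith
          then show ?thesis using True zV g0 by (simp add: g_def algebra_simps)
        qed (use g0 in auto)
      qed
    qed
  qed
  have "norm (Hx z) \<le> norm (Z z)" "norm (Hy z) \<le> norm (Z z)" if "regular z" for z
    using beltrami_norms[of "Hx z" "Hy z" k] that k_range unfolding regular_def by auto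
  from main[OF Hx_borel this(1), of 1] main[OF Hy_borel this(2), of \<i>]
  show "set_integrable lborel (square R) (Px \<sigma>)" "set_integrable lborel (square R) (Py \<sigma>)"
    unfolding set_integrable_def Px_def[abs_def] Py_def[abs_def] by auto
qed

text \<open>By Fubini almost every line meets the irregular points in a null set, and almost every
  line avoids \<open>a\<close> and carries an absolutely continuous \<open>F\<close>. On such a line
  the fundamental theorem applies to \<open>P\<close>.\<close>

lemma Green_P:
  assumes \<sigma>: "\<sigma> > 0" and R: "R > 0"
  shows "(LINT z:square R|lborel. Px \<sigma> z + \<i> * Py \<sigma> z) = box_boundary_integral R (P \<sigma>)"
proof (rule Green_square[OF P_integrable[OF \<sigma> R] _ _ P_cont[OF \<sigma>]])
  have neg: "negligible {s. \<not> Q s}" if "AE s in lborel. Q s" for Q :: "real \<Rightarrow> bool"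
  proof -
    have "AE s in lebesgue. Q s" using that by (simp add: AE_completion_iff)
    then obtain N where "{s. \<not> Q s} \<subseteq> N" "N \<in> null_sets lebesgue"
      by (auto simp: eventually_ae_filter)
    then show ?thesis by (meson negligible_iff_null_sets negligible_subset)
  qed
  show "AE t in lborel. t \<in> {-R..R} \<longrightarrow>
       ((\<lambda>s. Px \<sigma> (Complex s t)) has_integral P \<sigma> (Complex R t) - P \<sigma> (Complex (-R) t)) {-R..R}"
    using AE_lborel_complex_lines(1)[OF AE_regular] absolutely_continuous_lines_punctured(1)[OF F_acl R]
  proof eventually_elim
    case (elim t)
    show ?case
    proof
      assume "t \<in> {-R..R}"
      show "((\<lambda>s. Px \<sigma> (Complex s t)) has_integral P \<sigma> (Complex R t) - P \<sigma> (Complex (-R) t)) {-R..R}"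
      proof (rule fundamental_theorem_of_calculus_absolutely_continuous[OF _ _ neg[OF elim(1)]])
        show "absolutely_continuous_real (-R) R (\<lambda>s. P \<sigma> (Complex s t))"
        proof (rule P_absolutely_continuous[OF \<sigma> R, where w'="\<lambda>s. weight' \<sigma> (Complex s t) 1"])
          show "((\<lambda>s. weight \<sigma> (Complex s t)) has_vector_derivative weight' \<sigma> (Complex s t) 1) (at s)" for s
            by (rule has_vector_derivative_horizontal[OF weight_derivative[OF \<sigma>]])
          show "continuous_on {-R..R} (\<lambda>s. weight' \<sigma> (Complex s t) 1)"
            by (rule continuous_on_compose2[OF weight_continuous(2)[OF \<sigma>]]) (auto intro!: continuous_intros)
          show "norm (Complex s t - Complex s' t) = \<bar>s - s'\<bar>" for s s'
            by (simp add: cmod_def)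
        qed (use elim in \<open>auto intro!: continuous_intros\<close>)
        show "((\<lambda>s. P \<sigma> (Complex s t)) has_vector_derivative Px \<sigma> (Complex s t)) (at s within {-R..R})"
          if "s \<in> {-R..R} - {s. \<not> (Complex s t \<in> Om \<longrightarrow> regular (Complex s t))}" for s
          by (rule has_vector_derivative_at_within[OF P_horizontal_derivative[OF \<sigma>]]) (use that in auto)
      qed (use R in auto)
    qed
  qed
  show "AE s in lborel. s \<in> {-R..R} \<longrightarrow>
       ((\<lambda>t. Py \<sigma> (Complex s t)) has_integral P \<sigma> (Complex s R) - P \<sigma> (Complex s (-R))) {-R..R}"
    using AE_lborel_complex_lines(2)[OF AE_regular] absolutely_continuous_lines_punctured(2)[OF F_acl R]
  proof eventually_elim
    case (elim s)
    show ?case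
    proof
      assume "s \<in> {-R..R}"
      show "((\<lambda>t. Py \<sigma> (Complex s t)) has_integral P \<sigma> (Complex s R) - P \<sigma> (Complex s (-R))) {-R..R}"
      proof (rule fundamental_theorem_of_calculus_absolutely_continuous[OF _ _ neg[OF elim(1)]])
        show "absolutely_continuous_real (-R) R (\<lambda>t. P \<sigma> (Complex s t))"
        proof (rule P_absolutely_continuous[OF \<sigma> R, where w'="\<lambda>t. weight' \<sigma> (Complex s t) \<i>"])
          show "((\<lambda>t. weight \<sigma> (Complex s t)) has_vector_derivative weight' \<sigma> (Complex s t) \<i>) (at t)" for t
            by (rule has_vector_derivative_vertical[OF weight_derivative[OF \<sigma>]])
          show "continuous_on {-R..R} (\<lambda>t. weight' \<sigma> (Complex s t) \<i>)"
            by (rule continuous_on_compose2[OF weight_continuous(2)[OF \<sigma>]]) (auto intro!: continuous_intros)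
          show "norm (Complex s t - Complex s t') = \<bar>t - t'\<bar>" for t t'
            by (simp add: cmod_def)
        qed (use elim in \<open>auto intro!: continuous_intros\<close>)
        show "((\<lambda>t. P \<sigma> (Complex s t)) has_vector_derivative Py \<sigma> (Complex s t)) (at t within {-R..R})"
          if "t \<in> {-R..R} - {t. \<not> (Complex s t \<in> Om \<longrightarrow> regular (Complex s t))}" for t
          by (rule has_vector_derivative_at_within[OF P_vertical_derivative[OF \<sigma>]]) (use that in auto)
      qed (use R in auto)
    qed
  qed
qed

lemma P_Dbar:
  "Px \<sigma> z + \<i> * Py \<sigma> z = indicator Om z *\<^sub>R (Z z * weight \<sigma> z) + cutoff_grad \<sigma> z * (e z * phi0 z)"
proof (cases "z \<in> Om")
  case True
  \<comment> \<open>The contributions of the subtracted identity cancel: 1 + i * i = 0, so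
    \<open>e\<close> and \<open>H\<close> have the same derivative with respect to cnj z.\<close>
  have "Px \<sigma> z + \<i> * Py \<sigma> z = Z z * weight \<sigma> z + e z * (weight' \<sigma> z 1 + \<i> * weight' \<sigma> z \<i>)"
    using True by (simp add: Px_def Py_def algebra_simps)
  then show ?thesis unfolding weight_Dbar using True by (simp add: mult_ac)
qed (simp add: Px_def Py_def phi0_def)

end

section \<open>The lower bound for the area\<close>

context exterior_reflection
begin

text \<open>Within a bounded region the points with |e| \<ge> \<epsilon> form a compact set. It lies
  in \<open>Om\<close>, since \<open>e\<close> vanishes elsewhere, so |\<Phi>| has a minimum above 1
  on it; a collar below this minimum avoids the set.\<close>

lemma e_small_near_boundary:
  assumes \<epsilon>: "\<epsilon> > 0"
  obtains \<sigma> where "0 < \<sigma>" "\<sigma> \<le> 1" "\<And>z. z \<in> Om \<Longrightarrow> norm (\<Phi> z) \<le> exp (2 * \<sigma>) \<Longrightarrow> norm (e z) \<le> \<epsilon>"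
proof -
  obtain R where "{z \<in> Om. norm (\<Phi> z) \<le> exp 2} \<subseteq> ball 0 R"
    using bounded_subset_ballD[OF bounded_inner] by blast
  then have R: "{z \<in> Om. norm (\<Phi> z) \<le> exp 2} \<subseteq> cball 0 R"
    using ball_subset_cball by blast
  define S where "S = cball 0 R \<inter> {z. \<epsilon> \<le> norm (e z)}"
  have "compact S"
    unfolding S_def by (intro compact_Int_closed compact_cball closed_Collect_le continuous_intros e_cont)
  have S_Om: "S \<subseteq> Om" using e_not_Om \<epsilon> by (fastforce simp: S_def)
  have inS: "z \<in> S" if "z \<in> Om" "norm (\<Phi> z) \<le> exp (2 * \<sigma>)" "\<sigma> \<le> 1" "\<not> norm (e z) \<le> \<epsilon>" for z \<sigma>
  proof -
    have "exp (2 * \<sigma>) \<le> exp 2" using that(3) by simp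
    then have "norm (\<Phi> z) \<le> exp 2" using that(2) by (rule order_trans[rotated])
    then have "z \<in> cball 0 R" using R that(1) by blast
    then show ?thesis using that(4) by (simp add: S_def)
  qed
  show thesis
  proof (cases "S = {}")
    case True
    then show thesis using inS[of _ 1] by (intro that[of 1]) auto
  next
    case False
    have "continuous_on S (\<lambda>z. norm (\<Phi> z))"
      by (intro continuous_intros continuous_on_subset[OF continuous_on_Phi S_Om])
    from continuous_attains_inf[OF \<open>compact S\<close> False this]
    obtain z0 where z0: "z0 \<in> S" "\<And>z. z \<in> S \<Longrightarrow> norm (\<Phi> z0) \<le> norm (\<Phi> z)" by blast
    have m: "norm (\<Phi> z0) > 1" using Phi_gt_1 z0(1) S_Om by blast
    \<comment> \<open>A quarter of the logarithm makes 2\<sigma> strictly smaller than ln |\<Phi>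
      z0|; the cap 1 keeps the collar inside the ball of radius \<open>R\<close>.\<close>
    define \<sigma> where "\<sigma> = min 1 (ln (norm (\<Phi> z0)) / 4)"
    have ln: "ln (norm (\<Phi> z0)) > 0" using m by (rule ln_gt_zero)
    have \<sigma>: "0 < \<sigma>" "\<sigma> \<le> 1" using ln by (auto simp: \<sigma>_def)
    have "exp (2 * \<sigma>) < exp (ln (norm (\<Phi> z0)))" using ln by (auto simp: \<sigma>_def min_def)
    then have lt: "exp (2 * \<sigma>) < norm (\<Phi> z0)" using m exp_ln[of "norm (\<Phi> z0)"] by linarith
    show thesis
    proof (rule that[OF \<sigma>], rule ccontr)
      fix z assume z: "z \<in> Om" "norm (\<Phi> z) \<le> exp (2 * \<sigma>)" "\<not> norm (e z) \<le> \<epsilon>"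
      have "z \<in> S" by (rule inS[OF z(1,2) \<sigma>(2) z(3)])
      then show False using z0(2)[of z] z(2) lt by simp
    qed
  qed
qed

text \<open>The reflection maps the exterior into the bounded set \<open>G\<close>, so cnj F - z
  behaves like -z, while z^2 \<open>phi\<close> tends to 1/\<gamma>.\<close>

lemma P_at_infinity: "((\<lambda>z. z * ((cnj (F z) - z) * phi z)) \<longlongrightarrow> - of_real (1 / \<gamma>)) at_infinity"
proof -
  obtain A where A: "\<And>z. z \<in> G \<Longrightarrow> norm z \<le> A" using bounded_G by (meson bounded_iff)
  obtain R where R: "\<And>z. z \<in> closure G \<Longrightarrow> norm z \<le> R" using bounded_closure[OF bounded_G] by (meson bounded_iff)
  have Om: "\<forall>\<^sub>F z in at_infinity. z \<in> Om \<and> z \<noteq> 0"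
    unfolding eventually_at_infinity
    by (intro exI[of _ "max R 0 + 1"]) (auto simp: Om_def dest!: R)
  have zphi: "((\<lambda>z. z * phi z) \<longlongrightarrow> 0) at_infinity"
  proof (rule Lim_transform_eventually)
    show "((\<lambda>z. inverse z * (z\<^sup>2 * phi z)) \<longlongrightarrow> 0) at_infinity"
      using tendsto_mult[OF tendsto_inverse_0 phi_at_infinity] by simp
    show "\<forall>\<^sub>F z in at_infinity. inverse z * (z\<^sup>2 * phi z) = z * phi z"
      using Om by eventually_elim (simp add: power2_eq_square)
  qed
  have "((\<lambda>z. cnj (F z) * (z * phi z)) \<longlongrightarrow> 0) at_infinity"
  proof (rule Lim_null_comparison)
    show "\<forall>\<^sub>F z in at_infinity. norm (cnj (F z) * (z * phi z)) \<le> A * norm (z * phi z)"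
      using Om
    proof eventually_elim
      case (elim z)
      then have "norm (cnj (F z)) \<le> A" by (intro A F_image) simp
      then show ?case unfolding norm_mult[of "cnj (F z)"] by (rule mult_right_mono) simp
    qed
    show "((\<lambda>z. A * norm (z * phi z)) \<longlongrightarrow> 0) at_infinity"
      using tendsto_mult_right_zero[OF tendsto_norm_zero[OF zphi]] .
  qed
  from tendsto_diff[OF this phi_at_infinity]
  have "((\<lambda>z. cnj (F z) * (z * phi z) - z\<^sup>2 * phi z) \<longlongrightarrow> - of_real (1 / \<gamma>)) at_infinity" by simp
  then show ?thesis by (simp add: algebra_simps power2_eq_square)
qed

text \<open>Cauchy-Schwarz in the form of the inequality between arithmetic and geometric mean. The
  scale is chosen so that the weight contributes pi / \<gamma>, half of the term 2 pi / \<gamma>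
  coming from infinity. The bound depends on neither \<sigma> nor \<open>R\<close>.\<close>

lemma weighted_energy_bound:
  assumes \<sigma>: "\<sigma> > 0"
  shows "norm (LINT z:square R|lborel. indicator Om z *\<^sub>R (Z z * weight \<sigma> z))
           \<le> \<gamma> * area G / (1 - k\<^sup>2) + pi / \<gamma>"
proof -
  define V where "V = Om \<inter> square R"
  have V_sets: "V \<in> sets borel" using open_Om by (simp add: V_def)
  note ZZ = energy_reflection[OF V_def]
  have V_leb: "V \<in> sets lebesgue" using V_sets by simp
  have "V \<subseteq> Om" by (simp add: V_def)
  note ph = phi_L2[OF this V_leb]
  define p where "p = (\<lambda>z. indicator V z * (norm (phi z))\<^sup>2)"
  have p_meas: "p \<in> borel_measurable borel"
  proof -
    have "continuous_on V (\<lambda>z. (norm (phi z))\<^sup>2)"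
      by (intro continuous_intros continuous_on_subset[OF continuous_on_phi(1)]) (simp add: V_def)
    from borel_measurable_continuous_on_indicator[OF V_sets this] show ?thesis by (simp add: p_def)
  qed
  have pm: "p \<in> borel_measurable lborel" using p_meas by simp
  have "integrable lebesgue p"
    using ph(1) unfolding set_integrable_def p_def by (simp only: real_scaleR_def)
  then have p_int: "integrable lborel p" using integrable_completion[OF pm] by blast
  have "integral\<^sup>L lborel p = integral\<^sup>L lebesgue p"
    by (rule integral_completion[OF pm, symmetric])
  also have "\<dots> = (LINT z:V|lebesgue. (norm (phi z))\<^sup>2)"
    unfolding set_lebesgue_integral_def p_def real_scaleR_def ..
  also have "\<dots> \<le> pi"
    unfolding set_lebesgue_integral_eq_integral(2)[OF ph(1)] by (rule ph(2))
  finally have p_le: "integral\<^sup>L lborel p \<le> pi" .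
  define q where "q = (\<lambda>z. \<gamma> / 4 * (indicator V z * (norm (Z z))\<^sup>2) + 1 / \<gamma> * p z)"
  have q_int: "integrable lborel q"
    unfolding q_def using ZZ(1) p_int by (intro Bochner_Integration.integrable_add integrable_mult_right) auto
  have "norm (LINT z:square R|lborel. indicator Om z *\<^sub>R (Z z * weight \<sigma> z)) \<le> integral\<^sup>L lborel q"
  proof -
    have "(\<lambda>z. weight \<sigma> z) \<in> borel_measurable borel"
      by (rule borel_measurable_continuous_onI[OF weight_continuous(1)[OF \<sigma>]])
    then have m: "(\<lambda>z. indicator (square R) z *\<^sub>R (indicator Om z *\<^sub>R (Z z * weight \<sigma> z))) \<in> borel_measurable lborel"
      by measurable
    have le: "norm (indicator (square R) z *\<^sub>R (indicator Om z *\<^sub>R (Z z * weight \<sigma> z))) \<le> q z" for z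
    proof (cases "z \<in> V")
      case True
      then have "norm (indicator (square R) z *\<^sub>R (indicator Om z *\<^sub>R (Z z * weight \<sigma> z))) = norm (Z z) * norm (weight \<sigma> z)"
        by (simp add: V_def norm_mult)
      also have "\<dots> \<le> norm (Z z) * norm (phi z)"
        using weight_norm[OF \<sigma>, of z] True by (intro mult_left_mono) (auto simp: phi0_def V_def)
      also have "\<dots> \<le> \<gamma> / 4 * (norm (Z z))\<^sup>2 + 1 / \<gamma> * (norm (phi z))\<^sup>2"
      proof -
        \<comment> \<open>Expanding this square gives the coefficients \<gamma>/4 and 1/\<gamma>
          with cross term exactly 1.\<close>
        have "0 \<le> (\<gamma> / 2 * norm (Z z) - norm (phi z))\<^sup>2 / \<gamma>" using gamma_pos by simp
        also have "\<dots> = \<gamma> / 4 * (norm (Z z))\<^sup>2 + 1 / \<gamma> * (norm (phi z))\<^sup>2 - norm (Z z) * norm (phi z)"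
          using gamma_pos by (simp add: power2_eq_square field_simps)
        finally show ?thesis by simp
      qed
      finally show ?thesis using True by (simp add: q_def p_def)
    next
      case False
      then have "norm (indicator (square R) z *\<^sub>R (indicator Om z *\<^sub>R (Z z * weight \<sigma> z))) = 0"
        by (auto simp: V_def indicator_def)
      moreover have "q z = 0" using False by (simp add: q_def p_def)
      ultimately show ?thesis by linarith
    qed
    have f: "integrable lborel (\<lambda>z. indicator (square R) z *\<^sub>R (indicator Om z *\<^sub>R (Z z * weight \<sigma> z)))"
    proof (rule Bochner_Integration.integrable_bound[OF q_int m], rule AE_I2)
      show "norm (indicator (square R) z *\<^sub>R (indicator Om z *\<^sub>R (Z z * weight \<sigma> z))) \<le> norm (q z)" for z
        unfolding real_norm_def by (rule order_trans[OF le abs_ge_self])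
    qed
    have "norm (LINT z:square R|lborel. indicator Om z *\<^sub>R (Z z * weight \<sigma> z))
       \<le> (LINT z|lborel. norm (indicator (square R) z *\<^sub>R (indicator Om z *\<^sub>R (Z z * weight \<sigma> z))))"
      unfolding set_lebesgue_integral_def by (rule integral_norm_bound)
    also have "\<dots> \<le> integral\<^sup>L lborel q"
      by (rule integral_mono[OF integrable_norm[OF f] q_int le])
    finally show ?thesis .
  qed
  also have "\<dots> = \<gamma> / 4 * (LINT z|lborel. indicator V z * (norm (Z z))\<^sup>2) + 1 / \<gamma> * integral\<^sup>L lborel p"
    unfolding q_def using ZZ(1) p_int by (subst Bochner_Integration.integral_add) auto
  also have "\<dots> \<le> \<gamma> / 4 * (4 * area G / (1 - k\<^sup>2)) + 1 / \<gamma> * pi"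
    using ZZ(2) p_le gamma_pos by (intro add_mono mult_left_mono) auto
  finally show ?thesis by simp
qed

text \<open>On each level curve \<open>phi\<close> dz has density at most 1 in \<theta>, so the
  integral over the curve is at most 2 pi times the supremum of |e| there, and averaging preserves
  the bound.\<close>

lemma collar_term_bound:
  assumes \<sigma>: "\<sigma> > 0" and R: "collar \<sigma> \<subseteq> square R"
    and \<epsilon>: "\<And>z. z \<in> Om \<Longrightarrow> norm (\<Phi> z) \<le> exp (2 * \<sigma>) \<Longrightarrow> norm (e z) \<le> \<epsilon>"
  shows "norm (LINT z:square R|lborel. cutoff_grad \<sigma> z * (e z * phi0 z)) \<le> 2 * pi * \<epsilon>"
proof -
  define v where "v = (\<lambda>z. e z * phi0 z)"
  have v_cont: "continuous_on Om v"
  proof -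
    have "continuous_on Om (\<lambda>z. e z * phi z)"
      by (intro continuous_intros continuous_on_phi continuous_on_subset[OF e_cont]) auto
    then show ?thesis unfolding v_def by (subst continuous_on_cong[OF refl]) (auto simp: phi0_def)
  qed
  have "continuous_on UNIV (\<lambda>z. e z * (cutoff_grad \<sigma> z * phi0 z))"
    by (intro continuous_intros e_cont weight_continuous(3)[OF \<sigma>])
  then have cont: "continuous_on UNIV (\<lambda>z. cutoff_grad \<sigma> z * v z)"
    by (simp add: v_def mult_ac)
  have zero: "cutoff_grad \<sigma> z * v z = 0" if "z \<notin> collar \<sigma>" for z
  proof (cases "z \<in> Om \<and> norm (\<Phi> z) \<ge> exp \<sigma>")
    case True
    then show ?thesis using that cutoff_one(2)[OF \<sigma>, of z] by (auto simp: collar_def)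
  next
    case False
    then have "cutoff_grad \<sigma> z = 0" by (intro collar_zero(2)[OF \<sigma>]) blast
    then show ?thesis by simp
  qed
  have "(LINT z:square R|lborel. cutoff_grad \<sigma> z * v z) = integral (collar \<sigma>) (\<lambda>z. cutoff_grad \<sigma> z * v z)"
    by (rule integral_square_eq_subset[OF cont R zero])
  also have "\<dots> = integral {\<sigma>..2 * \<sigma>} (\<lambda>s. smooth_step' \<sigma> s *\<^sub>R circle_mean v s)"
    by (rule integral_collar(2)[OF v_cont \<sigma>])
  also have "norm \<dots> \<le> 2 * pi * \<epsilon>"
  proof (rule smooth_step_average_bound(1)[OF \<sigma> circle_mean_cont[OF v_cont \<sigma>]])
    fix s assume s: "s \<in> {\<sigma>..2 * \<sigma>}"
    then have s0: "s > 0" using \<sigma> by auto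
    have "norm (circle_mean v s) \<le> \<epsilon> * (2 * pi - 0)"
      unfolding circle_mean_def
    proof (rule integral_bound)
      show "continuous_on {0..2 * pi} (\<lambda>\<theta>. v (strip (Complex s \<theta>)) * strip' (Complex s \<theta>))"
        by (rule continuous_on_compose2[OF continuous_on_strip_integrand[OF v_cont]])
          (use s0 in \<open>auto intro!: continuous_intros\<close>)
      fix \<theta>
      let ?\<zeta> = "Complex s \<theta>"
      have p: "Re ?\<zeta> > 0" using s0 by simp
      have Om: "strip ?\<zeta> \<in> Om" by (rule strip_facts(2)[OF p])
      have "norm (\<Phi> (strip ?\<zeta>)) \<le> exp (2 * \<sigma>)" unfolding strip_facts(3)[OF p] using s by simp
      then have e: "norm (e (strip ?\<zeta>)) \<le> \<epsilon>" by (rule \<epsilon>[OF Om])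
      have "v (strip ?\<zeta>) * strip' ?\<zeta> = e (strip ?\<zeta>) * (phi (strip ?\<zeta>) * strip' ?\<zeta>)"
        using Om by (simp add: v_def phi0_def)
      also have "\<dots> = e (strip ?\<zeta>) * exp (- ?\<zeta>)" unfolding phi_strip[OF p] ..
      finally have "norm (v (strip ?\<zeta>) * strip' ?\<zeta>) = norm (e (strip ?\<zeta>)) * exp (- s)"
        by (simp add: norm_mult)
      also have "\<dots> \<le> \<epsilon> * 1"
        using e s0 order_trans[OF norm_ge_zero e] by (intro mult_mono) auto
      finally show "norm (v (strip ?\<zeta>) * strip' ?\<zeta>) \<le> \<epsilon>" by simp
    qed simp
    then show "norm (circle_mean v s) \<le> 2 * pi * \<epsilon>" by (simp add: mult.commute)
  qed
  finally show ?thesis by (simp add: v_def)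
qed

theorem area_ge: "pi * (1 - k\<^sup>2) \<le> \<gamma>\<^sup>2 * area G"
proof -
  have k1: "1 - k\<^sup>2 > 0" using k_range by (simp add: power_less_one_iff abs_square_less_1)
  have "2 * pi / \<gamma> \<le> \<gamma> * area G / (1 - k\<^sup>2) + pi / \<gamma> + x" if x: "x > 0" for x
  proof -
    \<comment> \<open>The denominator collects the two errors to come: 8 \<epsilon> on the boundary
      of the square and 2 pi \<epsilon> in the collar.\<close>
    define \<epsilon> where "\<epsilon> = x / (8 + 2 * pi)"
    have pp: "8 + 2 * pi > 0" using pi_gt_zero by linarith
    have \<epsilon>: "\<epsilon> > 0" "\<epsilon> * (8 + 2 * pi) = x" using x pp by (auto simp: \<epsilon>_def)
    obtain \<sigma> where \<sigma>: "0 < \<sigma>" "\<sigma> \<le> 1" "\<And>z. z \<in> Om \<Longrightarrow> norm (\<Phi> z) \<le> exp (2 * \<sigma>) \<Longrightarrow> norm (e z) \<le> \<epsilon>"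
      using e_small_near_boundary[OF \<epsilon>(1)] by blast
    have "\<forall>\<^sub>F z in at_infinity. dist (z * ((cnj (F z) - z) * phi z)) (- of_real (1 / \<gamma>)) < \<epsilon>"
      using tendstoD[OF P_at_infinity \<epsilon>(1)] .
    then obtain R0 where R0: "\<And>z. norm z \<ge> R0 \<Longrightarrow> dist (z * ((cnj (F z) - z) * phi z)) (- of_real (1 / \<gamma>)) < \<epsilon>"
      unfolding eventually_at_infinity by blast
    have "bounded (closure G \<union> {z \<in> Om. norm (\<Phi> z) \<le> exp (2 * \<sigma>)})"
      using bounded_closure[OF bounded_G] bounded_inner by simp
    then obtain R1 where R1: "R1 > 0" "closure G \<union> {z \<in> Om. norm (\<Phi> z) \<le> exp (2 * \<sigma>)} \<subseteq> ball 0 R1"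
      using bounded_subset_ballD by blast
    define R where "R = max R0 R1"
    have R: "R > 0" "R \<ge> R0" "R \<ge> R1" using R1(1) by (auto simp: R_def)
    have col: "collar \<sigma> \<subseteq> square R"
    proof -
      have "collar \<sigma> \<subseteq> ball 0 R1" using R1(2) unfolding collar_def by blast
      also have "\<dots> \<subseteq> cball 0 R" using R(3) by auto
      also have "\<dots> \<subseteq> square R" by (rule cball_subset_square)
      finally show ?thesis .
    qed
    \<comment> \<open>\<open>P\<close> is compared with its leading term -1/(\<gamma> z), whose
      boundary integral is -2 pi / \<gamma>. The error \<epsilon>/R times the perimeter 8 R stays
      bounded by 8 \<epsilon> for every large \<open>R\<close>.\<close>
    have P_far: "norm (P \<sigma> z - - (of_real (1 / \<gamma>) * inverse z)) \<le> \<epsilon> / R" if z: "norm z \<ge> R" for z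
    proof -
      have z0: "z \<noteq> 0" using z R(1) by auto
      have "z \<notin> closure G \<union> {z \<in> Om. norm (\<Phi> z) \<le> exp (2 * \<sigma>)}" using R1(2) z R(3) by auto
      then have zO: "z \<in> Om" "norm (\<Phi> z) \<ge> exp (2 * \<sigma>)" by (auto simp: Om_def)
      then have Pz: "P \<sigma> z = (cnj (F z) - z) * phi z"
        using cutoff_one(1)[OF \<sigma>(1) zO] by (simp add: P_def weight_def phi0_def e_Om)
      have "z * (Y - - (c * inverse z)) = z * Y - - c" for Y c :: complex
        using z0 by (simp add: distrib_left mult.left_commute)
      then have "z * (P \<sigma> z - - (of_real (1 / \<gamma>) * inverse z)) = z * ((cnj (F z) - z) * phi z) - - of_real (1 / \<gamma>)"
        unfolding Pz .
      moreover have "norm (z * ((cnj (F z) - z) * phi z) - - of_real (1 / \<gamma>)) < \<epsilon>"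
        using R0[of z] z R(2) unfolding dist_norm by linarith
      ultimately have "norm (z * (P \<sigma> z - - (of_real (1 / \<gamma>) * inverse z))) < \<epsilon>" by (simp only:)
      then have "norm z * norm (P \<sigma> z - - (of_real (1 / \<gamma>) * inverse z)) \<le> \<epsilon>"
        unfolding norm_mult by (rule less_imp_le)
      then have "norm (P \<sigma> z - - (of_real (1 / \<gamma>) * inverse z)) \<le> \<epsilon> / norm z"
        using z0 by (subst pos_le_divide_eq) (simp_all only: mult.commute zero_less_norm_iff not_False_eq_True)
      also have "\<dots> \<le> \<epsilon> / R" using z R(1) \<epsilon>(1) by (intro frac_le) auto
      finally show ?thesis .
    qed
    have c1: "continuous_on (- {0}) (P \<sigma>)" by (rule continuous_on_subset[OF P_cont[OF \<sigma>(1)]]) simp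
    have c2: "continuous_on (- {0}) (\<lambda>z::complex. - (of_real (1 / \<gamma>) * inverse z))" by (intro continuous_intros) auto
    have bneg: "box_boundary_integral R (\<lambda>z. - (of_real (1 / \<gamma>) * inverse z)) = - of_real (1 / \<gamma>) * (2 * pi)"
    proof -
      have r: "- (of_real (1 / \<gamma>) * w) - - (of_real (1 / \<gamma>) * w') = - of_real (1 / \<gamma>) * (w - w')" for w w' :: complex
        by (simp add: right_diff_distrib)
      have "box_boundary_integral R (\<lambda>z. - (of_real (1 / \<gamma>) * inverse z)) = - of_real (1 / \<gamma>) * box_boundary_integral R inverse"
        unfolding box_boundary_integral_def r integral_mult_right by (simp only: distrib_left mult.left_commute)
      then show ?thesis unfolding box_boundary_integral_inverse[OF R(1)] by simp
    qed
    have "norm (box_boundary_integral R (P \<sigma>) - - of_real (1 / \<gamma>) * (2 * pi)) \<le> 8 * R * (\<epsilon> / R)"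
      unfolding bneg[symmetric] box_boundary_integral_diff[OF c1 c2 R(1), symmetric]
      by (rule box_boundary_integral_bound[OF continuous_on_diff[OF c1 c2] R(1) P_far])
    then have far: "norm (box_boundary_integral R (P \<sigma>) + of_real (2 * pi / \<gamma>)) \<le> 8 * \<epsilon>"
      using R(1) by (simp add: mult.commute)
    \<comment> \<open>Green's formula for \<open>P\<close>: the first term survives as the collar
      shrinks, while the second carries the small values of \<open>e\<close>.\<close>
    have split: "box_boundary_integral R (P \<sigma>) =
       (LINT z:square R|lborel. indicator Om z *\<^sub>R (Z z * weight \<sigma> z))
       + (LINT z:square R|lborel. cutoff_grad \<sigma> z * (e z * phi0 z))"
    proof -
      have i2: "set_integrable lborel (square R) (\<lambda>z. cutoff_grad \<sigma> z * (e z * phi0 z))"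
      proof (rule continuous_set_integrable_square)
        have "continuous_on UNIV (\<lambda>z. e z * (cutoff_grad \<sigma> z * phi0 z))"
          by (intro continuous_intros e_cont weight_continuous(3)[OF \<sigma>(1)])
        then show "continuous_on UNIV (\<lambda>z. cutoff_grad \<sigma> z * (e z * phi0 z))" by (simp add: mult_ac)
      qed
      have "set_integrable lborel (square R) (\<lambda>z. Px \<sigma> z + \<i> * Py \<sigma> z)"
        by (intro set_integral_add(1) P_integrable[OF \<sigma>(1) R(1)] set_integrable_mult_right)
      then have "set_integrable lborel (square R) (\<lambda>z. (Px \<sigma> z + \<i> * Py \<sigma> z) - cutoff_grad \<sigma> z * (e z * phi0 z))"
        by (rule set_integral_diff(1)[OF _ i2])
      then have i1: "set_integrable lborel (square R) (\<lambda>z. indicator Om z *\<^sub>R (Z z * weight \<sigma> z))"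
        unfolding P_Dbar by simp
      show ?thesis
        unfolding Green_P[OF \<sigma>(1) R(1), symmetric] P_Dbar by (rule set_integral_add(2)[OF i1 i2])
    qed
    have n1: "norm (complex_of_real (2 * pi / \<gamma>)) \<le> norm (box_boundary_integral R (P \<sigma>)) + 8 * \<epsilon>"
    proof -
      have "complex_of_real (2 * pi / \<gamma>) = (box_boundary_integral R (P \<sigma>) + of_real (2 * pi / \<gamma>)) - box_boundary_integral R (P \<sigma>)"
        by simp
      then have "norm (complex_of_real (2 * pi / \<gamma>)) \<le> norm (box_boundary_integral R (P \<sigma>) + of_real (2 * pi / \<gamma>))
          + norm (box_boundary_integral R (P \<sigma>))"
        by (metis norm_triangle_ineq4)
      then show ?thesis using far by linarith
    qed
    have n2: "norm (box_boundary_integral R (P \<sigma>)) \<le> (\<gamma> * area G / (1 - k\<^sup>2) + pi / \<gamma>) + 2 * pi * \<epsilon>"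
      unfolding split
      by (rule order_trans[OF norm_triangle_ineq add_mono[OF weighted_energy_bound[OF \<sigma>(1)]
          collar_term_bound[OF \<sigma>(1) col \<sigma>(3)]]])
    have n3: "norm (complex_of_real (2 * pi / \<gamma>)) = 2 * pi / \<gamma>"
      unfolding norm_of_real using gamma_pos by (intro abs_of_nonneg) simp
    have "2 * pi * \<epsilon> + 8 * \<epsilon> = x" unfolding \<epsilon>(2)[symmetric] by (simp add: algebra_simps)
    then show ?thesis using n1 n2 unfolding n3 by linarith
  qed
  then have "2 * pi / \<gamma> \<le> \<gamma> * area G / (1 - k\<^sup>2) + pi / \<gamma>"
    by (rule field_le_epsilon)
  \<comment> \<open>One of the two copies of pi / \<gamma> on the left cancels against the weight's
    share on the right.\<close>
  then have "pi / \<gamma> \<le> \<gamma> * area G / (1 - k\<^sup>2)" by simp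
  then have "pi / \<gamma> * (\<gamma> * (1 - k\<^sup>2)) \<le> \<gamma> * area G / (1 - k\<^sup>2) * (\<gamma> * (1 - k\<^sup>2))"
    using gamma_pos k1 by (intro mult_right_mono) auto
  then show ?thesis using gamma_pos k1 by (simp add: power2_eq_square mult_ac)
qed

end

section \<open>The theorem\<close>

text \<open>In the finite charts of source and target the map is defined off the single point that
  is sent to infinity; the involution identifies it as \<open>a\<close>. The involution also gives
  injectivity on the exterior.\<close>

lemma quasiconformal_reflection_chart:
  fixes y :: "complex option \<Rightarrow> complex option"
  assumes refl: "quasiconformal_reflection G K a y"
  defines "F \<equiv> \<lambda>z. the (map_option cnj (y (Some z)))"
  shows "continuous_on (- {a}) F"
    and "absolutely_continuous_on_lines (- {a}) F"
    and "AE z in lebesgue. z \<noteq> a \<longrightarrow>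
        (\<exists>fx fy.
           ((\<lambda>s. F (z + of_real s)) has_vector_derivative fx) (at 0) \<and>
           ((\<lambda>t. F (z + \<i> * of_real t)) has_vector_derivative fy) (at 0) \<and>
           norm ((fx + \<i> * fy) / 2) \<le> (K - 1) / (K + 1) * norm ((fx - \<i> * fy) / 2))"
    and "\<And>z. z \<in> - closure G \<Longrightarrow> cnj (F z) \<in> G"
    and "inj_on F (- closure G)"
    and "\<And>z. z \<in> frontier G \<Longrightarrow> F z = cnj z"
proof -
  have y: "quasiconformal_sphere_map K (\<lambda>z. map_option cnj (y z))"
    "y ` sphere_exterior G = Some ` G" "y (Some a) = None" "y None = Some a"
    "\<And>z. z \<in> frontier G \<Longrightarrow> y (Some z) = Some z" "\<And>z. y (y z) = z"
    using refl unfolding quasiconformal_reflection_def by auto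
  have dom: "{z. id (map_option cnj (y (id (Some z)))) \<noteq> None} = - {a}"
  proof -
    have "y (Some z) = None \<longleftrightarrow> z = a" for z
      using y(3,4) y(6)[of "Some z"] by (metis option.inject)
    then show ?thesis by auto
  qed
  have "quasiconformal_on K {z. id (map_option cnj (y (id (Some z)))) \<noteq> None}
      (\<lambda>z. the (id (map_option cnj (y (id (Some z))))))"
    using y(1) unfolding quasiconformal_sphere_map_def by blast
  then have qc: "quasiconformal_on K (- {a}) F"
    unfolding dom F_def by simp
  then show "continuous_on (- {a}) F" "absolutely_continuous_on_lines (- {a}) F"
    unfolding quasiconformal_on_def by (auto dest: homeomorphism_cont1)
  from qc show "AE z in lebesgue. z \<noteq> a \<longrightarrow>
        (\<exists>fx fy.
           ((\<lambda>s. F (z + of_real s)) has_vector_derivative fx) (at 0) \<and>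
           ((\<lambda>t. F (z + \<i> * of_real t)) has_vector_derivative fy) (at 0) \<and>
           norm ((fx + \<i> * fy) / 2) \<le> (K - 1) / (K + 1) * norm ((fx - \<i> * fy) / 2))"
    unfolding quasiconformal_on_def Compl_iff singleton_iff by blast
  show "F z = cnj z" if "z \<in> frontier G" for z
    using y(5)[OF that] by (simp add: F_def)
  have ext: "\<exists>w\<in>G. y (Some z) = Some w" if "z \<in> - closure G" for z
  proof -
    have "Some z \<in> sphere_exterior G" using that by (auto simp: sphere_exterior_def)
    then show ?thesis using y(2) by blast
  qed
  show "cnj (F z) \<in> G" if "z \<in> - closure G" for z
    using ext[OF that] by (auto simp: F_def)
  show "inj_on F (- closure G)"
  proof (rule inj_onI)
    fix z w assume z: "z \<in> - closure G" and w: "w \<in> - closure G" and eq: "F z = F w"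
    obtain z' w' where zw: "y (Some z) = Some z'" "y (Some w) = Some w'"
      using ext[OF z] ext[OF w] by blast
    then have "z' = w'" using eq by (simp add: F_def)
    then have "y (y (Some z)) = y (y (Some w))" using zw by simp
    then show "z = w" unfolding y(6) by simp
  qed
qed

theorem theorem1p3:
  fixes G :: "complex set"
    and \<Phi> \<Psi> :: "complex \<Rightarrow> complex"
    and \<gamma> K k :: real
    and b :: "nat \<Rightarrow> complex"
    and y :: "complex option \<Rightarrow> complex option"
    and a :: complex
    and p :: "nat \<Rightarrow> complex poly"
    and lam \<alpha> :: "nat \<Rightarrow> real"
  assumes G: "open G" "connected G" "simply_connected G" "bounded G"
    and jordan: "jordan_curve (frontier G)"
    and quasiconformal: "quasiconformal_curve (frontier G)"
    and rectifiable: "rectifiable_jordan_curve (frontier G)"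
    and reflection: "quasiconformal_reflection G K a y"
    and k: "k = (K - 1) / (K + 1)"
    and Phi: "exterior_conformal_map G \<gamma> \<Phi>"
    and Psi: "\<And>w. norm w > 1 \<Longrightarrow> \<Psi> w = inv_into (- closure G) \<Phi> w"
    and Laurent: "\<And>w. norm w > 1 \<Longrightarrow> (\<lambda>j. b j / w ^ j) sums (\<Psi> w - of_real (1 / \<gamma>) * w)"
    and bergman: "bergman_polynomials G p lam"
    and alpha: "\<And>n. n \<ge> 1 \<Longrightarrow>
      real (n + 1) / pi * (\<gamma> ^ (2 * (n + 1)) / (lam n)\<^sup>2) = 1 - \<alpha> n"
  shows "\<forall>n\<ge>1. \<alpha> n \<ge> pi * (1 - k\<^sup>2) / area G * real (n + 1) * (norm (b (n + 1)))\<^sup>2"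
proof (intro allI impI)
  fix n :: nat assume n: "n \<ge> 1"
  have aG: "a \<in> G" and K: "K \<ge> 1"
    using reflection by (auto simp: quasiconformal_reflection_def)
  interpret exterior_map G \<gamma> \<Phi> \<Psi> b
    by unfold_locales (use G(4) Phi Psi Laurent in auto)
  interpret exterior_reflection G \<gamma> \<Phi> \<Psi> b "\<lambda>z. the (map_option cnj (y (Some z)))" a k
  proof unfold_locales
    show "0 \<le> k" "k < 1" using K by (auto simp: k)
  qed (use G(1) aG quasiconformal_reflection_chart[OF reflection] in \<open>auto simp: k Om_def\<close>)
  have area: "area G > 0"
  proof -
    have "G \<in> lmeasurable" using G by (simp add: lmeasurable_open)
    moreover have "\<not> negligible G" using G(1) aG open_not_negligible by blast
    ultimately show ?thesis
      unfolding area_def by (metis measure_nonneg negligible_iff_measure order_le_less)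
  qed
  have "pi * (1 - k\<^sup>2) / area G \<le> \<gamma>\<^sup>2"
    using area_ge area by (simp add: pos_divide_le_eq)
  then have "pi * (1 - k\<^sup>2) / area G * (real (n + 1) * (norm (b (n + 1)))\<^sup>2)
      \<le> \<gamma>\<^sup>2 * (real (n + 1) * (norm (b (n + 1)))\<^sup>2)"
    by (rule mult_right_mono) simp
  also have "\<dots> \<le> \<alpha> n"
    using leading_coefficient_bound[OF G(1) bergman, of n] alpha[OF n] by (simp add: mult_ac)
  finally show "\<alpha> n \<ge> pi * (1 - k\<^sup>2) / area G * real (n + 1) * (norm (b (n + 1)))\<^sup>2"
    by (simp add: mult.assoc)
qed

end
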